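(* Let $\mathcal G$ be an ample locally compact étale groupoid (not necessarily Hausdorff) with Hausdorff unit space $\mathcal G^{(0)}$. Then, for every representation $\pi$ of the Steinberg algebra $A(\mathcal G)$ on a pre-Hilbert space, we have $\|\pi(a)\|\le\|a\|_I$ for all $a\in A(\mathcal G)$. In particular, the universal C$^*$-completion of $A(\mathcal G)$ is well-defined, and then the embedding $A(\mathcal G)\hookrightarrow C_c(\mathcal G)$ extends to an isomorphism of this completion onto $C^*(\mathcal G)$.
   Context: **Groupoids.** A locally compact étale groupoid $\mathcal G$ is a locally compact topological groupoid whose range and source maps $r(g)=gg^{-1}$, $s(g)=g^{-1}g$ are local homeomorphisms onto the unit space $\mathcal G^{(0)}$. $\mathcal G^{(0)}$ is Hausdorff in the relative topology; $\mathcal G$ need not be Hausdorff. Put $\mathcal G^x=r^{-1}(x)$, $\mathcal G_x=s^{-1}(x)$. A bisection is a subset $W\subset\mathcal G$ such that $r|_W$ and $s|_W$ are injective. $\mathcal G$ is ample if $\mathcal G^{(0)}$ is totally disconnected. **Algebras.** For open Hausdorff $U\subset\mathcal G$, $C_c(U)$ is the space of continuous compactly supported functions on $U$, extended by zero to $\mathcal G$. $C_c(\mathcal G)$ is the linear span of all such spaces $C_c(U)$. It is a $*$-algebra with $(f_1*f_2)(g)=\sum_{h\in\mathcal G^{r(g)}}f_1(h)f_2(h^{-1}g)$ and $f^*(g)=\overline{f(g^{-1})}$. $C^*(\mathcal G)$ is the completion of $C_c(\mathcal G)$ in the norm $\|f\|=\sup_\pi\|\pi(f)\|$ over all $*$-representations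 of $C_c(\mathcal G)$ by bounded operators on Hilbert spaces (this is a finite norm). The (complex) Steinberg algebra $A(\mathcal G)\subset C_c(\mathcal G)$ is the linear span of the characteristic functions $\mathbf 1_W$ of compact open bisections $W$; it is a $*$-subalgebra. **$I$-norm.** $\|f\|_I=\max\{\sup_{x\in\mathcal G^{(0)}}\sum_{g\in\mathcal G_x}|f(g)|,\ \sup_{x\in\mathcal G^{(0)}}\sum_{g\in\mathcal G^x}|f(g)|\}$ for $f\in C_c(\mathcal G)$. **Representations.** A representation of a $*$-algebra $\mathcal A$ on a pre-Hilbert space $H$ is an algebra homomorphism $\pi$ into the algebra of all, not a priori bounded, linear operators $H\to H$ such that $(\pi(a)\xi,\zeta)=(\xi,\pi(a^* )\zeta)$ for all $a\in\mathcal A$, $\xi,\zeta\in H$. The universal C$^*$-completion of $\mathcal A$ is the (separated) completion of $\mathcal A$ in the C$^*$-seminorm $\sup_\pi\|\pi(a)\|$ over all $*$-representations by bounded operators on Hilbert spaces; it is well-defined if this supremum is finite for every $a\in\mathcal A$. *)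

theory Defs
  imports "HOL-Analysis.Analysis" "HOL-Algebra.Module" "HOL-Library.Function_Algebras"
begin

section \<open>Complex vector spaces, inner products and $*$-algebras on carrier sets\<close>

text \<open>
  Complex vector spaces are modules over the field of complex numbers in the sense of
  HOL-Algebra.  The record type of modules extends that of rings; for a plain vector space the
  fields for multiplication and unit carry no meaning, for a (not necessarily unital) algebra
  the field for the unit carries no meaning.
\<close>

definition complex_ring :: "complex ring" where
  "complex_ring = \<lparr>carrier = UNIV, mult = (*), one = 1, zero = 0, add = (+)\<rparr>"

record 'h inner_space = "(complex, 'h) module" +
  ip :: "'h \<Rightarrow> 'h \<Rightarrow> complex"

definition ip_norm :: "('h, 'm) inner_space_scheme \<Rightarrow> 'h \<Rightarrow> real" where
  "ip_norm H x = sqrt (Re (ip H x x))"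

text \<open>The locale of metric spaces wants the distance to be nonnegative and symmetric off the carrier, too.\<close>

definition ip_dist :: "('h, 'm) inner_space_scheme \<Rightarrow> 'h \<Rightarrow> 'h \<Rightarrow> real" where
  "ip_dist H x y = (if x \<in> carrier H \<and> y \<in> carrier H then ip_norm H (x \<ominus>\<^bsub>H\<^esub> y) else 0)"

locale pre_hilbert_space = module complex_ring H for H :: "('h, 'm) inner_space_scheme" (structure) +
  assumes ip_add: "\<lbrakk>x \<in> carrier H; y \<in> carrier H; z \<in> carrier H\<rbrakk>
      \<Longrightarrow> ip H (x \<oplus> y) z = ip H x z + ip H y z"
    and ip_smult: "\<lbrakk>x \<in> carrier H; z \<in> carrier H\<rbrakk> \<Longrightarrow> ip H (c \<odot> x) z = c * ip H x z"
    and ip_cnj: "\<lbrakk>x \<in> carrier H; y \<in> carrier H\<rbrakk> \<Longrightarrow> ip H y x = cnj (ip H x y)"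
    and ip_nonneg: "x \<in> carrier H \<Longrightarrow> 0 \<le> Re (ip H x x)"
    and ip_definite: "\<lbrakk>x \<in> carrier H; ip H x x = 0\<rbrakk> \<Longrightarrow> x = \<zero>"

locale hilbert_space = pre_hilbert_space +
  assumes complete: "Metric_space.mcomplete (carrier H) (ip_dist H)"

text \<open>The operator norm takes the value \<open>\<infinity>\<close> on unbounded operators.\<close>

definition op_norm :: "('h, 'm) inner_space_scheme \<Rightarrow> ('h \<Rightarrow> 'h) \<Rightarrow> ennreal" where
  "op_norm H T = (SUP \<xi>\<in>{\<xi> \<in> carrier H. ip_norm H \<xi> \<le> 1}. ennreal (ip_norm H (T \<xi>)))"

record 'a star_alg = "(complex, 'a) module" +
  star :: "'a \<Rightarrow> 'a"

locale star_algebra = module complex_ring A for A :: "('a, 'm) star_alg_scheme" (structure) +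
  assumes mult_closed: "\<lbrakk>a \<in> carrier A; b \<in> carrier A\<rbrakk> \<Longrightarrow> a \<otimes> b \<in> carrier A"
    and mult_assoc: "\<lbrakk>a \<in> carrier A; b \<in> carrier A; c \<in> carrier A\<rbrakk>
      \<Longrightarrow> (a \<otimes> b) \<otimes> c = a \<otimes> (b \<otimes> c)"
    and distrib_left: "\<lbrakk>a \<in> carrier A; b \<in> carrier A; c \<in> carrier A\<rbrakk>
      \<Longrightarrow> a \<otimes> (b \<oplus> c) = a \<otimes> b \<oplus> a \<otimes> c"
    and distrib_right: "\<lbrakk>a \<in> carrier A; b \<in> carrier A; c \<in> carrier A\<rbrakk>
      \<Longrightarrow> (a \<oplus> b) \<otimes> c = a \<otimes> c \<oplus> b \<otimes> c"
    and smult_mult_left: "\<lbrakk>a \<in> carrier A; b \<in> carrier A\<rbrakk> \<Longrightarrow> (z \<odot> a) \<otimes> b = z \<odot> (a \<otimes> b)"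
    and smult_mult_right: "\<lbrakk>a \<in> carrier A; b \<in> carrier A\<rbrakk> \<Longrightarrow> a \<otimes> (z \<odot> b) = z \<odot> (a \<otimes> b)"
    and star_closed: "a \<in> carrier A \<Longrightarrow> star A a \<in> carrier A"
    and star_star: "a \<in> carrier A \<Longrightarrow> star A (star A a) = a"
    and star_add: "\<lbrakk>a \<in> carrier A; b \<in> carrier A\<rbrakk> \<Longrightarrow> star A (a \<oplus> b) = star A a \<oplus> star A b"
    and star_smult: "a \<in> carrier A \<Longrightarrow> star A (z \<odot> a) = cnj z \<odot> star A a"
    and star_mult: "\<lbrakk>a \<in> carrier A; b \<in> carrier A\<rbrakk> \<Longrightarrow> star A (a \<otimes> b) = star A b \<otimes> star A a"


section \<open>Representations\<close>

definition linear_operator :: "('h, 'm) inner_space_scheme \<Rightarrow> ('h \<Rightarrow> 'h) \<Rightarrow> bool" where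
  "linear_operator H T \<longleftrightarrow>
     T \<in> carrier H \<rightarrow> carrier H \<and>
     (\<forall>\<xi>\<in>carrier H. \<forall>\<eta>\<in>carrier H. T (\<xi> \<oplus>\<^bsub>H\<^esub> \<eta>) = T \<xi> \<oplus>\<^bsub>H\<^esub> T \<eta>) \<and>
     (\<forall>c. \<forall>\<xi>\<in>carrier H. T (c \<odot>\<^bsub>H\<^esub> \<xi>) = c \<odot>\<^bsub>H\<^esub> T \<xi>)"

text \<open>
  Representations by not a priori bounded operators; no non-degeneracy is required.
\<close>

locale representation = pre_hilbert_space H
  for A :: "('a, 'm) star_alg_scheme" and H :: "('h, 'n) inner_space_scheme" (structure)
    and \<pi> :: "'a \<Rightarrow> 'h \<Rightarrow> 'h" +
  assumes rep_linear_operator: "a \<in> carrier A \<Longrightarrow> linear_operator H (\<pi> a)"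
    and rep_add: "\<lbrakk>a \<in> carrier A; b \<in> carrier A; \<xi> \<in> carrier H\<rbrakk>
      \<Longrightarrow> \<pi> (a \<oplus>\<^bsub>A\<^esub> b) \<xi> = \<pi> a \<xi> \<oplus> \<pi> b \<xi>"
    and rep_smult: "\<lbrakk>a \<in> carrier A; \<xi> \<in> carrier H\<rbrakk> \<Longrightarrow> \<pi> (c \<odot>\<^bsub>A\<^esub> a) \<xi> = c \<odot> \<pi> a \<xi>"
    and rep_mult: "\<lbrakk>a \<in> carrier A; b \<in> carrier A; \<xi> \<in> carrier H\<rbrakk>
      \<Longrightarrow> \<pi> (a \<otimes>\<^bsub>A\<^esub> b) \<xi> = \<pi> a (\<pi> b \<xi>)"
    and rep_star: "\<lbrakk>a \<in> carrier A; \<xi> \<in> carrier H; \<zeta> \<in> carrier H\<rbrakk>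
      \<Longrightarrow> ip H (\<pi> a \<xi>) \<zeta> = ip H \<xi> (\<pi> (star A a) \<zeta>)"

locale bounded_representation = representation A H \<pi> + hilbert_space H
  for A :: "('a, 'm) star_alg_scheme" and H :: "('h, 'n) inner_space_scheme" (structure)
    and \<pi> :: "'a \<Rightarrow> 'h \<Rightarrow> 'h" +
  assumes rep_bounded: "a \<in> carrier A \<Longrightarrow> op_norm H (\<pi> a) < \<infinity>"


section \<open>Universal C*-completions\<close>

text \<open>
  The supremum in the universal C*-seminorm has to be taken over Hilbert spaces on subsets of one
  fixed type.  Every vector of a Hilbert space lies in an invariant closed subspace whose points
  are limits of sequences \<open>c\<^sub>n \<xi> + \<pi>(a\<^sub>n) \<xi>\<close>, so the type of sequences of pairs
  \<open>(c\<^sub>n, a\<^sub>n)\<close> is large enough; \<open>op_norm_le_cstar_seminorm\<close> below shows that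
  representations on Hilbert spaces over an arbitrary type are dominated by this supremum.
\<close>

definition cstar_seminorm :: "'a star_alg \<Rightarrow> 'a \<Rightarrow> ennreal" where
  "cstar_seminorm A a =
     (SUP (H, \<pi>) \<in> {(H :: (nat \<Rightarrow> complex \<times> 'a) inner_space, \<pi>). bounded_representation A H \<pi>}.
        op_norm H (\<pi> a))"

record 'a normed_star_alg = "'a star_alg" +
  nrm :: "'a \<Rightarrow> real"

definition cauchy_seqs :: "'a star_alg \<Rightarrow> ('a \<Rightarrow> real) \<Rightarrow> (nat \<Rightarrow> 'a) set" where
  "cauchy_seqs A p = {x. range x \<subseteq> carrier A \<and>
     (\<forall>e>0. \<exists>N. \<forall>m\<ge>N. \<forall>n\<ge>N. p (x m \<ominus>\<^bsub>A\<^esub> x n) < e)}"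

definition null_rel :: "'a star_alg \<Rightarrow> ('a \<Rightarrow> real) \<Rightarrow> ((nat \<Rightarrow> 'a) \<times> (nat \<Rightarrow> 'a)) set" where
  "null_rel A p = {(x, y). x \<in> cauchy_seqs A p \<and> y \<in> cauchy_seqs A p \<and>
     (\<lambda>n. p (x n \<ominus>\<^bsub>A\<^esub> y n)) \<longlonglongrightarrow> 0}"

text \<open>
  The separated completion as the set of classes of Cauchy sequences; the operations are the
  termwise ones on representatives.
\<close>

definition completion :: "'a star_alg \<Rightarrow> ('a \<Rightarrow> real) \<Rightarrow> (nat \<Rightarrow> 'a) set normed_star_alg" where
  "completion A p =
     (let cls = (\<lambda>x. null_rel A p `` {x}) in
      \<lparr>carrier = cauchy_seqs A p // null_rel A p,
       mult = (\<lambda>X Y. \<Union>x\<in>X. \<Union>y\<in>Y. cls (\<lambda>n. x n \<otimes>\<^bsub>A\<^esub> y n)),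
       one = undefined,
       zero = cls (\<lambda>_. \<zero>\<^bsub>A\<^esub>),
       add = (\<lambda>X Y. \<Union>x\<in>X. \<Union>y\<in>Y. cls (\<lambda>n. x n \<oplus>\<^bsub>A\<^esub> y n)),
       smult = (\<lambda>c X. \<Union>x\<in>X. cls (\<lambda>n. c \<odot>\<^bsub>A\<^esub> x n)),
       star = (\<lambda>X. \<Union>x\<in>X. cls (\<lambda>n. star A (x n))),
       nrm = (\<lambda>X. the_elem (\<Union>x\<in>X. {lim (\<lambda>n. p (x n))}))\<rparr>)"

definition completion_embed :: "'a star_alg \<Rightarrow> ('a \<Rightarrow> real) \<Rightarrow> 'a \<Rightarrow> (nat \<Rightarrow> 'a) set" where
  "completion_embed A p a = null_rel A p `` {\<lambda>_. a}"

text \<open>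
  The universal C*-completion is well-defined if the seminorm is finite on \<open>A\<close>; only in this
  case are the following two definitions meaningful.
\<close>

definition cstar_completion_well_defined :: "'a star_alg \<Rightarrow> bool" where
  "cstar_completion_well_defined A \<longleftrightarrow> (\<forall>a\<in>carrier A. cstar_seminorm A a < \<infinity>)"

definition cstar_completion :: "'a star_alg \<Rightarrow> (nat \<Rightarrow> 'a) set normed_star_alg" where
  "cstar_completion A = completion A (\<lambda>a. enn2real (cstar_seminorm A a))"

definition cstar_embed :: "'a star_alg \<Rightarrow> 'a \<Rightarrow> (nat \<Rightarrow> 'a) set" where
  "cstar_embed A = completion_embed A (\<lambda>a. enn2real (cstar_seminorm A a))"

definition cstar_isomorphism ::
    "('a, 'm) normed_star_alg_scheme \<Rightarrow> ('b, 'n) normed_star_alg_scheme \<Rightarrow> ('a \<Rightarrow> 'b) \<Rightarrow> bool" where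
  "cstar_isomorphism A B \<Phi> \<longleftrightarrow>
     bij_betw \<Phi> (carrier A) (carrier B) \<and>
     (\<forall>a\<in>carrier A. \<forall>b\<in>carrier A. \<Phi> (a \<oplus>\<^bsub>A\<^esub> b) = \<Phi> a \<oplus>\<^bsub>B\<^esub> \<Phi> b) \<and>
     (\<forall>c. \<forall>a\<in>carrier A. \<Phi> (c \<odot>\<^bsub>A\<^esub> a) = c \<odot>\<^bsub>B\<^esub> \<Phi> a) \<and>
     (\<forall>a\<in>carrier A. \<forall>b\<in>carrier A. \<Phi> (a \<otimes>\<^bsub>A\<^esub> b) = \<Phi> a \<otimes>\<^bsub>B\<^esub> \<Phi> b) \<and>
     (\<forall>a\<in>carrier A. \<Phi> (star A a) = star B (\<Phi> a)) \<and>
     (\<forall>a\<in>carrier A. nrm B (\<Phi> a) = nrm A a)"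


section \<open>Groupoids\<close>

text \<open>The unit space is not a separate datum: it is the common image of the range and source maps.\<close>

record 'g groupoid_data =
  arrows :: "'g topology"
  composable :: "('g \<times> 'g) set"
  gmult :: "'g \<Rightarrow> 'g \<Rightarrow> 'g"
  ginv :: "'g \<Rightarrow> 'g"

definition grange :: "'g groupoid_data \<Rightarrow> 'g \<Rightarrow> 'g" where
  "grange G g = gmult G g (ginv G g)"

definition gsource :: "'g groupoid_data \<Rightarrow> 'g \<Rightarrow> 'g" where
  "gsource G g = gmult G (ginv G g) g"

definition units :: "'g groupoid_data \<Rightarrow> 'g set" where
  "units G = grange G ` topspace (arrows G)"

definition unit_space :: "'g groupoid_data \<Rightarrow> 'g topology" where
  "unit_space G = subtopology (arrows G) (units G)"

definition range_fibre :: "'g groupoid_data \<Rightarrow> 'g \<Rightarrow> 'g set" where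
  "range_fibre G x = {g \<in> topspace (arrows G). grange G g = x}"

definition source_fibre :: "'g groupoid_data \<Rightarrow> 'g \<Rightarrow> 'g set" where
  "source_fibre G x = {g \<in> topspace (arrows G). gsource G g = x}"

text \<open>
  The algebraic axioms are Renault's; by \<open>composable_iff\<close> below, \<open>(g, h)\<close> is composable iff
  \<open>gsource G g = grange G h\<close>.
\<close>

locale groupoid =
  fixes G :: "'g groupoid_data"
  assumes composable_subset:
      "composable G \<subseteq> topspace (arrows G) \<times> topspace (arrows G)"
    and gmult_closed: "(g, h) \<in> composable G \<Longrightarrow> gmult G g h \<in> topspace (arrows G)"
    and ginv_closed: "g \<in> topspace (arrows G) \<Longrightarrow> ginv G g \<in> topspace (arrows G)"
    and ginv_ginv: "g \<in> topspace (arrows G) \<Longrightarrow> ginv G (ginv G g) = g"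
    and gmult_assoc: "\<lbrakk>(g, h) \<in> composable G; (h, k) \<in> composable G\<rbrakk>
      \<Longrightarrow> (gmult G g h, k) \<in> composable G \<and> (g, gmult G h k) \<in> composable G \<and>
          gmult G (gmult G g h) k = gmult G g (gmult G h k)"
    and composable_ginv: "g \<in> topspace (arrows G)
      \<Longrightarrow> (g, ginv G g) \<in> composable G \<and> (ginv G g, g) \<in> composable G"
    and ginv_gmult_cancel: "(g, h) \<in> composable G \<Longrightarrow> gmult G (ginv G g) (gmult G g h) = h"
    and gmult_ginv_cancel: "(g, h) \<in> composable G \<Longrightarrow> gmult G (gmult G g h) (ginv G h) = g"

locale topological_groupoid = groupoid +
  assumes continuous_gmult:
      "continuous_map (subtopology (prod_topology (arrows G) (arrows G)) (composable G)) (arrows G)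
         (\<lambda>(g, h). gmult G g h)"
    and continuous_ginv: "continuous_map (arrows G) (arrows G) (ginv G)"

definition local_homeomorphism :: "'a topology \<Rightarrow> 'b topology \<Rightarrow> ('a \<Rightarrow> 'b) \<Rightarrow> bool" where
  "local_homeomorphism X Y f \<longleftrightarrow>
     (\<forall>x\<in>topspace X. \<exists>U. openin X U \<and> x \<in> U \<and> openin Y (f ` U) \<and>
        homeomorphic_map (subtopology X U) (subtopology Y (f ` U)) f)"

locale lc_etale_groupoid = topological_groupoid +
  assumes locally_compact: "locally_compact_space (arrows G)"
    and local_homeo_range: "local_homeomorphism (arrows G) (unit_space G) (grange G)"
    and local_homeo_source: "local_homeomorphism (arrows G) (unit_space G) (gsource G)"
    and Hausdorff_unit_space: "Hausdorff_space (unit_space G)"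

definition totally_disconnected_space :: "'a topology \<Rightarrow> bool" where
  "totally_disconnected_space X \<longleftrightarrow> (\<forall>S. connectedin X S \<longrightarrow> (\<exists>a. S \<subseteq> {a}))"

locale ample_groupoid = lc_etale_groupoid +
  assumes totally_disconnected: "totally_disconnected_space (unit_space G)"

definition bisection :: "'g groupoid_data \<Rightarrow> 'g set \<Rightarrow> bool" where
  "bisection G W \<longleftrightarrow> W \<subseteq> topspace (arrows G) \<and> inj_on (grange G) W \<and> inj_on (gsource G) W"


section \<open>Function algebras of a groupoid\<close>

text \<open>All functions are extended by zero outside the set of arrows.\<close>

definition fscale :: "complex \<Rightarrow> ('g \<Rightarrow> complex) \<Rightarrow> 'g \<Rightarrow> complex" where
  "fscale c f = (\<lambda>g. c * f g)"

definition lin_span :: "('g \<Rightarrow> complex) set \<Rightarrow> ('g \<Rightarrow> complex) set" where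
  "lin_span S = Modules.module.span fscale S"

definition Cc_open :: "'g groupoid_data \<Rightarrow> 'g set \<Rightarrow> ('g \<Rightarrow> complex) set" where
  "Cc_open G U = {f.
     continuous_map (subtopology (arrows G) U) euclidean f \<and>
     compactin (subtopology (arrows G) U) (subtopology (arrows G) U closure_of {g \<in> U. f g \<noteq> 0}) \<and>
     (\<forall>g. g \<notin> U \<longrightarrow> f g = 0)}"

definition Cc :: "'g groupoid_data \<Rightarrow> ('g \<Rightarrow> complex) set" where
  "Cc G = lin_span (\<Union>U\<in>{U. openin (arrows G) U \<and> Hausdorff_space (subtopology (arrows G) U)}.
     Cc_open G U)"

definition steinberg :: "'g groupoid_data \<Rightarrow> ('g \<Rightarrow> complex) set" where
  "steinberg G =
     lin_span {indicator W | W. openin (arrows G) W \<and> compactin (arrows G) W \<and> bisection G W}"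

text \<open>For \<open>f1\<close> in \<open>Cc G\<close> the sums in the convolution have only finitely many nonzero terms.\<close>

definition conv :: "'g groupoid_data \<Rightarrow> ('g \<Rightarrow> complex) \<Rightarrow> ('g \<Rightarrow> complex) \<Rightarrow> 'g \<Rightarrow> complex" where
  "conv G f1 f2 g =
     (if g \<in> topspace (arrows G)
      then \<Sum>\<^sub>\<infinity>h\<in>range_fibre G (grange G g). f1 h * f2 (gmult G (ginv G h) g)
      else 0)"

definition fstar :: "'g groupoid_data \<Rightarrow> ('g \<Rightarrow> complex) \<Rightarrow> 'g \<Rightarrow> complex" where
  "fstar G f g = (if g \<in> topspace (arrows G) then cnj (f (ginv G g)) else 0)"

definition function_alg :: "'g groupoid_data \<Rightarrow> ('g \<Rightarrow> complex) set \<Rightarrow> ('g \<Rightarrow> complex) star_alg" where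
  "function_alg G F = \<lparr>carrier = F, mult = conv G, one = undefined, zero = 0, add = (+),
     smult = fscale, star = fstar G\<rparr>"

abbreviation Cc_alg :: "'g groupoid_data \<Rightarrow> ('g \<Rightarrow> complex) star_alg" where
  "Cc_alg G \<equiv> function_alg G (Cc G)"

abbreviation steinberg_alg :: "'g groupoid_data \<Rightarrow> ('g \<Rightarrow> complex) star_alg" where
  "steinberg_alg G \<equiv> function_alg G (steinberg G)"

definition groupoid_cstar ::
    "'g groupoid_data \<Rightarrow> (nat \<Rightarrow> 'g \<Rightarrow> complex) set normed_star_alg" where
  "groupoid_cstar G = cstar_completion (Cc_alg G)"

definition I_norm :: "'g groupoid_data \<Rightarrow> ('g \<Rightarrow> complex) \<Rightarrow> ennreal" where
  "I_norm G f = max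
     (SUP x\<in>units G. \<Sum>\<^sub>\<infinity>g\<in>source_fibre G x. ennreal (cmod (f g)))
     (SUP x\<in>units G. \<Sum>\<^sub>\<infinity>g\<in>range_fibre G x. ennreal (cmod (f g)))"


section \<open>Adequacy of the encodings\<close>

subsection \<open>Groupoids and function algebras\<close>

lemma vector_space_fscale: "vector_space fscale"
  by (rule vector_space.intro) (simp_all add: fscale_def fun_eq_iff algebra_simps)

lemma composable_iff:
  assumes "groupoid G"
  shows "(g, h) \<in> composable G \<longleftrightarrow>
    g \<in> topspace (arrows G) \<and> h \<in> topspace (arrows G) \<and> gsource G g = grange G h"
proof -
  interpret groupoid G by fact
  show ?thesis
  proof (intro iffI conjI)
    assume gh: "(g, h) \<in> composable G"
    show g: "g \<in> topspace (arrows G)" and h: "h \<in> topspace (arrows G)"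
      using gh composable_subset by auto
    note a = gmult_assoc[OF conjunct2[OF composable_ginv[OF g]] gh]
    have "gmult G (gsource G g) h = h"
      using a ginv_gmult_cancel[OF gh] by (simp add: gsource_def)
    moreover have "(gsource G g, h) \<in> composable G"
      using a by (simp add: gsource_def)
    ultimately show "gsource G g = grange G h"
      using gmult_ginv_cancel[of "gsource G g" h] by (simp add: grange_def)
  next
    assume *: "g \<in> topspace (arrows G) \<and> h \<in> topspace (arrows G) \<and> gsource G g = grange G h"
    then have g: "g \<in> topspace (arrows G)" and h: "h \<in> topspace (arrows G)"
      and eq: "gsource G g = grange G h" by auto
    note cg = composable_ginv[OF g] and ch = composable_ginv[OF h]
    have "(g, gsource G g) \<in> composable G"
      using gmult_assoc[OF conjunct1[OF cg] conjunct2[OF cg]] by (simp add: gsource_def)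
    moreover have "(grange G h, h) \<in> composable G"
      using gmult_assoc[OF conjunct1[OF ch] conjunct2[OF ch]] by (simp add: grange_def)
    moreover have "gmult G (grange G h) h = h"
      using gmult_ginv_cancel[OF conjunct1[OF ch]] ginv_ginv[OF h] by (simp add: grange_def)
    ultimately show "(g, h) \<in> composable G"
      using gmult_assoc[of g "gsource G g" h] eq by simp
  qed
qed

lemma steinberg_subset_Cc:
  assumes "lc_etale_groupoid G"
  shows "steinberg G \<subseteq> Cc G"
proof -
  interpret lc_etale_groupoid G by fact
  interpret V: vector_space fscale by (rule vector_space_fscale)
  let ?T = "arrows G"
  have cont: "continuous_map ?T (unit_space G) (grange G)"
  proof -
    have "\<exists>U. openin ?T U \<and> x \<in> U \<and> continuous_map (subtopology ?T U) (unit_space G) (grange G)"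
      if x: "x \<in> topspace ?T" for x
    proof -
      obtain U where U: "openin ?T U" "x \<in> U"
          "homeomorphic_map (subtopology ?T U) (subtopology (unit_space G) (grange G ` U)) (grange G)"
        using bspec[OF local_homeo_range[unfolded local_homeomorphism_def] x] by blast
      from homeomorphic_imp_continuous_map[OF U(3)] U(1,2) show ?thesis
        by (intro exI[of _ U]) (simp add: continuous_map_in_subtopology)
    qed
    then have "\<forall>x\<in>topspace ?T. \<exists>U. openin ?T U \<and> x \<in> U \<and>
        continuous_map (subtopology ?T U) (unit_space G) (grange G)" by blast
    from bchoice[OF this] obtain U where U: "\<forall>x\<in>topspace ?T. openin ?T (U x) \<and> x \<in> U x \<and>
        continuous_map (subtopology ?T (U x)) (unit_space G) (grange G)" ..
    show ?thesis
    proof (rule pasting_lemma[where I = "topspace ?T" and T = U and f = "\<lambda>_. grange G"])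
      fix x assume "x \<in> topspace ?T"
      then show "\<exists>j. j \<in> topspace ?T \<and> x \<in> U j \<and> grange G x = grange G x" using U by blast
    qed (use U in simp_all)
  qed
  have "indicator W \<in> (\<Union>U\<in>{U. openin ?T U \<and> Hausdorff_space (subtopology ?T U)}. Cc_open G U)"
    if W: "openin ?T W" "compactin ?T W" "bisection G W" for W
  proof (rule UN_I[of W], clarify)
    have sub: "W \<subseteq> topspace ?T" using W by (simp add: openin_subset)
    have "continuous_map (subtopology ?T W) (unit_space G) (grange G)"
      using cont by (rule continuous_map_from_subtopology)
    then have "Hausdorff_space (subtopology ?T W)"
      using Hausdorff_space_injective_preimage[of "unit_space G" "subtopology ?T W" "grange G"] W(3) Hausdorff_unit_space sub unfolding bisection_def
      by (simp add: Int_absorb1)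
    then show "openin ?T W \<and> Hausdorff_space (subtopology ?T W)" using W by simp
    have "continuous_map (subtopology ?T W) euclidean (indicator W :: 'a \<Rightarrow> complex)"
      by (rule continuous_map_eq[where f = "\<lambda>_. 1"]) (auto simp: indicator_def)
    moreover have "subtopology ?T W closure_of W = W"
      using sub closure_of_topspace[of "subtopology ?T W"] by (simp add: Int_absorb1)
    moreover have "{g \<in> W. indicator W g \<noteq> (0 :: complex)} = W" by auto
    ultimately show "indicator W \<in> Cc_open G W"
      using W(2) sub by (simp add: Cc_open_def compactin_subtopology)
  qed
  then have "{indicator W | W. openin ?T W \<and> compactin ?T W \<and> bisection G W} \<subseteq>
      (\<Union>U\<in>{U. openin ?T U \<and> Hausdorff_space (subtopology ?T U)}. Cc_open G U)" by blast
  then show ?thesis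
    unfolding steinberg_def Cc_def lin_span_def by (rule V.span_mono)
qed


subsection \<open>Representations on Hilbert spaces over an arbitrary type\<close>

lemma complex_ring_simps [simp]:
  "carrier complex_ring = UNIV" "mult complex_ring = (*)" "one complex_ring = 1"
  "zero complex_ring = 0" "add complex_ring = (+)"
  by (simp_all add: complex_ring_def)

lemma cring_complex_ring: "cring complex_ring"
  by (rule cringI, rule abelian_groupI)
    (auto simp: algebra_simps intro: comm_monoidI exI[of _ "- x" for x :: complex])

context pre_hilbert_space
begin

lemma ip_zero: "z \<in> carrier H \<Longrightarrow> ip H \<zero> z = 0"
  using ip_add[of "\<zero>" "\<zero>" z] by simp

lemma ip_a_inv: "\<lbrakk>x \<in> carrier H; z \<in> carrier H\<rbrakk> \<Longrightarrow> ip H (\<ominus> x) z = - ip H x z"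
  using ip_add[of x "\<ominus> x" z] ip_zero[of z] by (simp add: M.r_neg eq_neg_iff_add_eq_0 add.commute)

lemma ip_diff: "\<lbrakk>x \<in> carrier H; y \<in> carrier H; z \<in> carrier H\<rbrakk>
    \<Longrightarrow> ip H (x \<ominus> y) z = ip H x z - ip H y z"
  by (simp add: a_minus_def ip_add ip_a_inv)

lemma ip_add2: "\<lbrakk>x \<in> carrier H; y \<in> carrier H; z \<in> carrier H\<rbrakk>
    \<Longrightarrow> ip H z (x \<oplus> y) = ip H z x + ip H z y"
  by (metis M.a_closed complex_cnj_add ip_add ip_cnj)

lemma smult_closed' [simp]: "x \<in> carrier H \<Longrightarrow> c \<odot> x \<in> carrier H"
  using smult_closed by simp

lemma ip_smult2: "\<lbrakk>x \<in> carrier H; z \<in> carrier H\<rbrakk> \<Longrightarrow> ip H z (c \<odot> x) = cnj c * ip H z x"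
  by (metis complex_cnj_mult ip_cnj ip_smult smult_closed')

lemma smult_minus_one: "x \<in> carrier H \<Longrightarrow> (-1) \<odot> x = \<ominus> x"
proof -
  assume x: "x \<in> carrier H"
  have "(-1) \<odot> x \<oplus> 1 \<odot> x = 0 \<odot> x"
    using smult_l_distr[of "-1" 1 x] x by simp
  also have "0 \<odot> x = \<zero>" using smult_l_null[OF x] by simp
  finally show ?thesis
    using x smult_one[OF x] by (simp add: M.minus_equality)
qed

lemma ip_norm_nonneg [simp]: "x \<in> carrier H \<Longrightarrow> 0 \<le> ip_norm H x"
  by (simp add: ip_norm_def ip_nonneg)

lemma ip_norm_sq: "x \<in> carrier H \<Longrightarrow> (ip_norm H x)\<^sup>2 = Re (ip H x x)"
  by (simp add: ip_norm_def ip_nonneg)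

lemma ip_self_Im: "x \<in> carrier H \<Longrightarrow> Im (ip H x x) = 0"
  using ip_cnj[of x x] by (simp add: complex_eq_iff)

lemma ip_norm_eq_0: "x \<in> carrier H \<Longrightarrow> ip_norm H x = 0 \<longleftrightarrow> x = \<zero>"
  using ip_definite[of x] ip_self_Im[of x] ip_zero[of "\<zero>"]
  by (auto simp: ip_norm_def complex_eq_iff)

lemma ip_norm_smult: "x \<in> carrier H \<Longrightarrow> ip_norm H (c \<odot> x) = cmod c * ip_norm H x"
proof -
  assume x: "x \<in> carrier H"
  have "ip H (c \<odot> x) (c \<odot> x) = (c * cnj c) * ip H x x"
    using x by (simp add: ip_smult ip_smult2)
  then have "Re (ip H (c \<odot> x) (c \<odot> x)) = (cmod c)\<^sup>2 * Re (ip H x x)"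
    using ip_self_Im[OF x] by (simp add: complex_mult_cnj cmod_power2)
  then show ?thesis by (simp add: ip_norm_def real_sqrt_mult)
qed

lemma Re_ip_le: 
  assumes x: "x \<in> carrier H" and y: "y \<in> carrier H"
  shows "Re (ip H x y) \<le> ip_norm H x * ip_norm H y"
proof (cases "y = \<zero>")
  case True
  have "ip H x y = 0" using ip_cnj[OF y x] ip_zero[OF x] True ip_cnj[OF x y] by simp
  then show ?thesis using x y by simp
next
  case False
  let ?a = "Re (ip H x x)" and ?b = "Re (ip H x y)" and ?c = "Re (ip H y y)"
  have c: "?c > 0"
    using False ip_norm_eq_0[OF y] ip_nonneg[OF y] by (auto simp: ip_norm_def less_le)
  define t where "t = - ?b / ?c"
  have "Re (ip H (x \<oplus> complex_of_real t \<odot> y) (x \<oplus> complex_of_real t \<odot> y)) \<ge> 0"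
    using x y by (intro ip_nonneg) auto
  also have "ip H y x = cnj (ip H x y)" using ip_cnj x y by blast
  then have "Re (ip H (x \<oplus> complex_of_real t \<odot> y) (x \<oplus> complex_of_real t \<odot> y)) =
      ?a + 2 * t * ?b + t * t * ?c"
    using x y by (simp add: ip_add ip_add2 ip_smult ip_smult2 algebra_simps)
  also have "\<dots> = ?a - ?b\<^sup>2 / ?c"
    using c by (simp add: t_def power2_eq_square field_simps)
  finally have "?b\<^sup>2 \<le> ?a * ?c" using c by (simp add: field_simps)
  then have "sqrt (?b\<^sup>2) \<le> sqrt (?a * ?c)" by (rule real_sqrt_le_mono)
  then show ?thesis by (simp add: ip_norm_def real_sqrt_mult)
qed

lemma ip_norm_triangle:
  assumes x: "x \<in> carrier H" and y: "y \<in> carrier H"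
  shows "ip_norm H (x \<oplus> y) \<le> ip_norm H x + ip_norm H y"
proof (rule power2_le_imp_le)
  have "ip H y x = cnj (ip H x y)" using ip_cnj x y by blast
  then have "(ip_norm H (x \<oplus> y))\<^sup>2 = (ip_norm H x)\<^sup>2 + 2 * Re (ip H x y) + (ip_norm H y)\<^sup>2"
    using x y by (simp add: ip_norm_sq ip_add ip_add2)
  also have "\<dots> \<le> (ip_norm H x)\<^sup>2 + 2 * (ip_norm H x * ip_norm H y) + (ip_norm H y)\<^sup>2"
    using Re_ip_le[OF x y] by simp
  finally show "(ip_norm H (x \<oplus> y))\<^sup>2 \<le> (ip_norm H x + ip_norm H y)\<^sup>2"
    by (simp add: power2_sum)
qed (use x y in simp)


lemma ip_dist_eq: "\<lbrakk>x \<in> carrier H; y \<in> carrier H\<rbrakk> \<Longrightarrow> ip_dist H x y = ip_norm H (x \<ominus> y)"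
  by (simp add: ip_dist_def)

lemma ip_norm_a_inv: "x \<in> carrier H \<Longrightarrow> ip_norm H (\<ominus> x) = ip_norm H x"
  using ip_norm_smult[of x "-1"] by (simp add: smult_minus_one)

lemma diff_eq_0: "\<lbrakk>x \<in> carrier H; y \<in> carrier H\<rbrakk> \<Longrightarrow> x \<ominus> y = \<zero> \<longleftrightarrow> x = y"
  by (metis M.a_inv_closed M.add.inv_closed M.minus_equality M.minus_minus M.r_neg a_minus_def)

lemma Metric_space_ip_dist: "Metric_space (carrier H) (ip_dist H)"
proof
  fix x y
  show "0 \<le> ip_dist H x y"
    by (simp add: ip_dist_def)
  show "ip_dist H x y = ip_dist H y x"
  proof (cases "x \<in> carrier H \<and> y \<in> carrier H")
    case True
    then have "x \<ominus> y = \<ominus> (y \<ominus> x)"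
      by (simp add: a_minus_def M.minus_add M.a_comm)
    then show ?thesis using True ip_norm_a_inv[of "y \<ominus> x"] by (simp add: ip_dist_def)
  qed (auto simp: ip_dist_def)
next
  fix x y assume "x \<in> carrier H" "y \<in> carrier H"
  then show "ip_dist H x y = 0 \<longleftrightarrow> x = y"
    by (simp add: ip_dist_eq ip_norm_eq_0 diff_eq_0)
next
  fix x y z assume *: "x \<in> carrier H" "y \<in> carrier H" "z \<in> carrier H"
  have "x \<ominus> z = (x \<ominus> y) \<oplus> (y \<ominus> z)"
    using * by (simp add: a_minus_def M.a_assoc M.r_neg1)
  then show "ip_dist H x z \<le> ip_dist H x y + ip_dist H y z"
    using * ip_norm_triangle[of "x \<ominus> y" "y \<ominus> z"] by (simp add: ip_dist_eq)
qed

lemma ip_norm_le_op_norm: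
  assumes T: "linear_operator H T" and bd: "op_norm H T < \<infinity>" and x: "x \<in> carrier H"
  shows "ip_norm H (T x) \<le> enn2real (op_norm H T) * ip_norm H x"
proof (cases "x = \<zero>")
  case True
  have "T (0 \<odot> x) = 0 \<odot> T x" and Tx: "T x \<in> carrier H"
    using T x by (auto simp: linear_operator_def)
  then have "T x = \<zero>" using True smult_l_null[OF x] smult_l_null[OF Tx] by simp
  then show ?thesis using ip_norm_eq_0[of "\<zero>"] x by simp
next
  case False
  let ?n = "ip_norm H x"
  have n: "?n > 0" using False x ip_norm_eq_0[OF x] ip_norm_nonneg[OF x] by linarith
  let ?y = "complex_of_real (1 / ?n) \<odot> x"
  have y: "?y \<in> carrier H" "ip_norm H ?y \<le> 1"
    using x n by (simp_all add: ip_norm_smult del: of_real_divide)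
  have Tx: "T x \<in> carrier H" "T ?y = complex_of_real (1 / ?n) \<odot> T x"
    using T x by (auto simp: linear_operator_def)
  have "ennreal (ip_norm H (T ?y)) \<le> op_norm H T"
    unfolding op_norm_def using y by (intro SUP_upper) auto
  then have "ip_norm H (T ?y) \<le> enn2real (op_norm H T)"
    using bd by (metis Tx(1) Tx(2) ennreal_enn2real ennreal_le_iff enn2real_nonneg infinity_ennreal_def)
  moreover have "ip_norm H (T ?y) = ip_norm H (T x) / ?n"
    using Tx n by (simp add: ip_norm_smult del: of_real_divide)
  ultimately have "ip_norm H (T x) / ?n \<le> enn2real (op_norm H T)" by linarith
  then show ?thesis using n by (simp add: pos_divide_le_eq)
qed

end


context bounded_representation
begin

definition cyc_vec :: "'h \<Rightarrow> complex \<times> 'a \<Rightarrow> 'h" where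
  "cyc_vec \<xi> q = (fst q \<odot> \<xi>) \<oplus> \<pi> (snd q) \<xi>"

definition cyc_space :: "'h \<Rightarrow> 'h set" where
  "cyc_space \<xi> = {k \<in> carrier H. \<forall>e>0. \<exists>q. snd q \<in> carrier A \<and> ip_dist H k (cyc_vec \<xi> q) < e}"

definition cyc_code :: "'h \<Rightarrow> 'h \<Rightarrow> nat \<Rightarrow> complex \<times> 'a" where
  "cyc_code \<xi> k = (SOME x. \<forall>n. snd (x n) \<in> carrier A \<and> ip_dist H k (cyc_vec \<xi> (x n)) < 1 / (real n + 1))"

lemma rep_closed [simp]: "\<lbrakk>a \<in> carrier A; \<xi> \<in> carrier H\<rbrakk> \<Longrightarrow> \<pi> a \<xi> \<in> carrier H"
  using rep_linear_operator[of a] by (auto simp: linear_operator_def)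

lemma vec_closed [simp]: "\<lbrakk>\<xi> \<in> carrier H; snd q \<in> carrier A\<rbrakk> \<Longrightarrow> cyc_vec \<xi> q \<in> carrier H"
  by (simp add: cyc_vec_def)

lemma cyclic_subset: "cyc_space \<xi> \<subseteq> carrier H"
  by (auto simp: cyc_space_def)

lemma code_props:
  assumes "k \<in> cyc_space \<xi>"
  shows "snd (cyc_code \<xi> k n) \<in> carrier A" "ip_dist H k (cyc_vec \<xi> (cyc_code \<xi> k n)) < 1 / (real n + 1)"
proof -
  have "\<forall>n. \<exists>q. snd q \<in> carrier A \<and> ip_dist H k (cyc_vec \<xi> q) < 1 / (real n + 1)"
    using assms by (auto simp: cyc_space_def)
  then have "\<exists>x. \<forall>n. snd (x n) \<in> carrier A \<and> ip_dist H k (cyc_vec \<xi> (x n)) < 1 / (real n + 1)"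
    by metis
  from someI_ex[OF this] show "snd (cyc_code \<xi> k n) \<in> carrier A"
      "ip_dist H k (cyc_vec \<xi> (cyc_code \<xi> k n)) < 1 / (real n + 1)"
    unfolding cyc_code_def by blast+
qed

lemma inj_code:
  assumes \<xi>: "\<xi> \<in> carrier H"
  shows "inj_on (cyc_code \<xi>) (cyc_space \<xi>)"
proof (rule inj_onI, rule ccontr)
  interpret D: Metric_space "carrier H" "ip_dist H" by (rule Metric_space_ip_dist)
  fix k l assume k: "k \<in> cyc_space \<xi>" and l: "l \<in> cyc_space \<xi>" and eq: "cyc_code \<xi> k = cyc_code \<xi> l" and ne: "k \<noteq> l"
  have kl: "k \<in> carrier H" "l \<in> carrier H" using k l cyclic_subset by auto
  let ?d = "ip_dist H k l"
  have d: "?d > 0" using kl ne by (simp add: D.mdist_pos_less)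
  then obtain n where n: "1 / (real n + 1) < ?d / 2"
    using reals_Archimedean[of "?d/2"] by (auto simp: inverse_eq_divide add.commute)
  let ?v = "cyc_vec \<xi> (cyc_code \<xi> k n)"
  have v: "?v \<in> carrier H" using code_props[OF k] \<xi> by simp
  have "?d \<le> ip_dist H k ?v + ip_dist H ?v l" using D.triangle kl v by blast
  also have "\<dots> < ?d / 2 + ?d / 2"
    using code_props(2)[OF k, of n] code_props(2)[OF l, of n] n D.commute[of l ?v] eq by simp
  finally show False by simp
qed

lemma cyclic_closed:
  assumes \<xi>: "\<xi> \<in> carrier H" and l: "l \<in> carrier H"
    and ap: "\<And>e. e > 0 \<Longrightarrow> \<exists>k\<in>cyc_space \<xi>. ip_dist H l k < e"
  shows "l \<in> cyc_space \<xi>"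
proof -
  interpret D: Metric_space "carrier H" "ip_dist H" by (rule Metric_space_ip_dist)
  have "\<exists>q. snd q \<in> carrier A \<and> ip_dist H l (cyc_vec \<xi> q) < e" if e: "e > 0" for e
  proof -
    obtain k where k: "k \<in> cyc_space \<xi>" "ip_dist H l k < e/2" using ap[of "e/2"] e by auto
    obtain q where q: "snd q \<in> carrier A" "ip_dist H k (cyc_vec \<xi> q) < e/2"
      using k e by (auto simp: cyc_space_def dest!: spec[of _ "e/2"])
    have "ip_dist H l (cyc_vec \<xi> q) \<le> ip_dist H l k + ip_dist H k (cyc_vec \<xi> q)"
      using D.triangle l k(1) q(1) \<xi> cyclic_subset by (metis subsetD vec_closed)
    with k q show ?thesis by (intro exI[of _ q]) auto
  qed
  with l show ?thesis by (auto simp: cyc_space_def)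
qed

lemma vec_in_cyclic: "\<lbrakk>\<xi> \<in> carrier H; snd q \<in> carrier A\<rbrakk> \<Longrightarrow> cyc_vec \<xi> q \<in> cyc_space \<xi>"
proof -
  interpret D: Metric_space "carrier H" "ip_dist H" by (rule Metric_space_ip_dist)
  assume "\<xi> \<in> carrier H" "snd q \<in> carrier A"
  then show ?thesis by (auto simp: cyc_space_def intro!: exI[of _ "fst q"] exI[of _ "snd q"])
qed

lemma smult_add': "x \<in> carrier H \<Longrightarrow> y \<in> carrier H \<Longrightarrow> c \<odot> (x \<oplus> y) = (c \<odot> x) \<oplus> (c \<odot> y)"
  using smult_r_distr by simp

lemma add_smult': "x \<in> carrier H \<Longrightarrow> (c + d) \<odot> x = (c \<odot> x) \<oplus> (d \<odot> x)"
  using smult_l_distr[of c d x] by simp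

lemma smult_smult': "x \<in> carrier H \<Longrightarrow> (c * d) \<odot> x = c \<odot> (d \<odot> x)"
  using smult_assoc1[of c d x] by simp

lemma smult_one': "x \<in> carrier H \<Longrightarrow> 1 \<odot> x = x"
  using smult_one[of x] by simp

lemma diff_add_add:
  assumes "x \<in> carrier H" "y \<in> carrier H" "x' \<in> carrier H" "y' \<in> carrier H"
  shows "(x \<oplus> y) \<ominus> (x' \<oplus> y') = (x \<ominus> x') \<oplus> (y \<ominus> y')"
  using assms by (simp add: a_minus_def M.minus_add M.a_ac)

lemma linear_diff:
  assumes T: "linear_operator H T" and x: "x \<in> carrier H" "y \<in> carrier H"
  shows "T (x \<ominus> y) = T x \<ominus> T y"
proof -
  have T1: "T x \<in> carrier H" "T y \<in> carrier H" using T x by (auto simp: linear_operator_def)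
  have "T (x \<oplus> (-1) \<odot> y) = T x \<oplus> (-1) \<odot> T y"
    using T x by (auto simp: linear_operator_def)
  then show ?thesis using x T1 by (simp add: a_minus_def smult_minus_one)
qed

lemma vec_add:
  assumes SA: "star_algebra A" and \<xi>: "\<xi> \<in> carrier H" and q: "snd q \<in> carrier A" "snd r \<in> carrier A"
  shows "cyc_vec \<xi> q \<oplus> cyc_vec \<xi> r = cyc_vec \<xi> (fst q + fst r, snd q \<oplus>\<^bsub>A\<^esub> snd r)"
  using \<xi> q by (simp add: cyc_vec_def add_smult' rep_add M.a_ac)

lemma vec_smult:
  assumes SA: "star_algebra A" and \<xi>: "\<xi> \<in> carrier H" and q: "snd q \<in> carrier A"
  shows "c \<odot> cyc_vec \<xi> q = cyc_vec \<xi> (c * fst q, c \<odot>\<^bsub>A\<^esub> snd q)"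
  using \<xi> q by (simp add: cyc_vec_def smult_add' smult_smult' rep_smult)

lemma rep_vec:
  assumes SA: "star_algebra A" and \<xi>: "\<xi> \<in> carrier H" and q: "snd q \<in> carrier A" and b: "b \<in> carrier A"
  shows "\<pi> b (cyc_vec \<xi> q) = cyc_vec \<xi> (0, fst q \<odot>\<^bsub>A\<^esub> b \<oplus>\<^bsub>A\<^esub> b \<otimes>\<^bsub>A\<^esub> snd q)"
proof -
  interpret SA: star_algebra A by fact
  have "fst q \<odot>\<^bsub>A\<^esub> b \<in> carrier A" "b \<otimes>\<^bsub>A\<^esub> snd q \<in> carrier A"
    using SA.smult_closed[of "fst q" b] SA.mult_closed b q by auto
  moreover have "\<pi> b (cyc_vec \<xi> q) = \<pi> b (fst q \<odot> \<xi>) \<oplus> \<pi> b (\<pi> (snd q) \<xi>)"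
    "\<pi> b (fst q \<odot> \<xi>) = fst q \<odot> \<pi> b \<xi>"
    using rep_linear_operator[OF b] \<xi> q by (auto simp: cyc_vec_def linear_operator_def)
  ultimately show ?thesis
    using smult_l_null[OF \<xi>] \<xi> b q by (simp add: cyc_vec_def rep_add rep_smult rep_mult)
qed

lemma rep_zero:
  assumes SA: "star_algebra A" and \<xi>: "\<xi> \<in> carrier H"
  shows "\<pi> \<zero>\<^bsub>A\<^esub> \<xi> = \<zero>"
proof -
  interpret SA: star_algebra A by fact
  have "\<zero>\<^bsub>A\<^esub> = 0 \<odot>\<^bsub>A\<^esub> \<zero>\<^bsub>A\<^esub>" using SA.smult_l_null[of "\<zero>\<^bsub>A\<^esub>"] by simp
  then have "\<pi> \<zero>\<^bsub>A\<^esub> \<xi> = 0 \<odot> \<pi> \<zero>\<^bsub>A\<^esub> \<xi>" using rep_smult[of "\<zero>\<^bsub>A\<^esub>" \<xi> 0] \<xi> by simp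
  then show ?thesis using smult_l_null[of "\<pi> \<zero>\<^bsub>A\<^esub> \<xi>"] \<xi> by simp
qed

lemma cyclic_subspace:
  assumes SA: "star_algebra A" and \<xi>: "\<xi> \<in> carrier H"
  shows "\<zero> \<in> cyc_space \<xi>" "\<xi> \<in> cyc_space \<xi>"
    "\<lbrakk>x \<in> cyc_space \<xi>; y \<in> cyc_space \<xi>\<rbrakk> \<Longrightarrow> x \<oplus> y \<in> cyc_space \<xi>"
    "x \<in> cyc_space \<xi> \<Longrightarrow> c \<odot> x \<in> cyc_space \<xi>"
    "\<lbrakk>b \<in> carrier A; x \<in> cyc_space \<xi>\<rbrakk> \<Longrightarrow> \<pi> b x \<in> cyc_space \<xi>"
proof -
  interpret SA: star_algebra A by fact
  have SAs: "\<And>c a. a \<in> carrier A \<Longrightarrow> c \<odot>\<^bsub>A\<^esub> a \<in> carrier A"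
    using SA.smult_closed by simp
  have "cyc_vec \<xi> (0, \<zero>\<^bsub>A\<^esub>) = \<zero>" "cyc_vec \<xi> (1, \<zero>\<^bsub>A\<^esub>) = \<xi>"
    using rep_zero[OF SA \<xi>] smult_l_null[OF \<xi>] smult_one[OF \<xi>] \<xi> by (simp_all add: cyc_vec_def)
  then show "\<zero> \<in> cyc_space \<xi>" "\<xi> \<in> cyc_space \<xi>"
    using vec_in_cyclic[OF \<xi>, of "(0, \<zero>\<^bsub>A\<^esub>)"] vec_in_cyclic[OF \<xi>, of "(1, \<zero>\<^bsub>A\<^esub>)"] by auto
  show "x \<oplus> y \<in> cyc_space \<xi>" if x: "x \<in> cyc_space \<xi>" and y: "y \<in> cyc_space \<xi>"
  proof (rule cyclic_closed[OF \<xi>])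
    have xy: "x \<in> carrier H" "y \<in> carrier H" using x y cyclic_subset by auto
    then show "x \<oplus> y \<in> carrier H" by simp
    fix e :: real assume e: "e > 0"
    obtain q where q: "snd q \<in> carrier A" "ip_dist H x (cyc_vec \<xi> q) < e/2"
      using x e by (auto simp: cyc_space_def dest!: spec[of _ "e/2"])
    obtain r where r: "snd r \<in> carrier A" "ip_dist H y (cyc_vec \<xi> r) < e/2"
      using y e by (auto simp: cyc_space_def dest!: spec[of _ "e/2"])
    have "ip_norm H ((x \<oplus> y) \<ominus> (cyc_vec \<xi> q \<oplus> cyc_vec \<xi> r)) \<le>
        ip_norm H (x \<ominus> cyc_vec \<xi> q) + ip_norm H (y \<ominus> cyc_vec \<xi> r)"
      using xy q(1) r(1) \<xi> by (simp add: diff_add_add ip_norm_triangle)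
    then have "ip_dist H (x \<oplus> y) (cyc_vec \<xi> q \<oplus> cyc_vec \<xi> r) < e"
      using xy q r \<xi> by (simp add: ip_dist_eq)
    moreover have "cyc_vec \<xi> q \<oplus> cyc_vec \<xi> r \<in> cyc_space \<xi>"
      using vec_add[OF SA \<xi> q(1) r(1)] vec_in_cyclic[OF \<xi>] q(1) r(1) by simp
    ultimately show "\<exists>k\<in>cyc_space \<xi>. ip_dist H (x \<oplus> y) k < e" by blast
  qed
  have image: "T x \<in> cyc_space \<xi>"
    if x: "x \<in> cyc_space \<xi>" and T: "linear_operator H T"
      and B: "\<And>y. y \<in> carrier H \<Longrightarrow> ip_norm H (T y) \<le> B * ip_norm H y" "B \<ge> 0"
      and Tv: "\<And>q. snd q \<in> carrier A \<Longrightarrow> T (cyc_vec \<xi> q) \<in> cyc_space \<xi>" for T B x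
  proof (rule cyclic_closed[OF \<xi>])
    have x': "x \<in> carrier H" using x cyclic_subset by auto
    then show "T x \<in> carrier H" using T by (auto simp: linear_operator_def)
    fix e :: real assume e: "e > 0"
    then have "e / (B + 1) > 0" using B(2) by simp
    then obtain q where q: "snd q \<in> carrier A" "ip_dist H x (cyc_vec \<xi> q) < e / (B + 1)"
      using x by (auto simp: cyc_space_def)
    have v: "cyc_vec \<xi> q \<in> carrier H" using q(1) \<xi> by simp
    then have Tc: "T x \<in> carrier H" "T (cyc_vec \<xi> q) \<in> carrier H"
      using T x' by (auto simp: linear_operator_def)
    have "ip_dist H (T x) (T (cyc_vec \<xi> q)) = ip_norm H (T (x \<ominus> cyc_vec \<xi> q))"
      using Tc linear_diff[OF T x' v] by (simp add: ip_dist_eq)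
    also have "\<dots> \<le> B * ip_dist H x (cyc_vec \<xi> q)"
      using B(1)[of "x \<ominus> cyc_vec \<xi> q"] x' v by (simp add: ip_dist_eq)
    also have "\<dots> \<le> B * (e / (B + 1))"
      using B(2) q(2) by (intro mult_left_mono) auto
    also have "\<dots> < e" using B(2) e by (simp add: field_simps)
    finally show "\<exists>k\<in>cyc_space \<xi>. ip_dist H (T x) k < e" using Tv[OF q(1)] by blast
  qed
  show "c \<odot> x \<in> cyc_space \<xi>" if x: "x \<in> cyc_space \<xi>"
  proof (rule image[OF x, of "\<lambda>y. c \<odot> y" "cmod c"])
    show "linear_operator H ((\<odot>) c)"
      by (auto simp: linear_operator_def smult_add' smult_smult'[symmetric] mult.commute)
    show "c \<odot> cyc_vec \<xi> q \<in> cyc_space \<xi>" if "snd q \<in> carrier A" for q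
      using vec_smult[OF SA \<xi> that] vec_in_cyclic[OF \<xi>] SAs that by simp
  qed (simp_all add: ip_norm_smult)
  show "\<pi> b x \<in> cyc_space \<xi>" if b: "b \<in> carrier A" and x: "x \<in> cyc_space \<xi>"
  proof (rule image[OF x])
    show "linear_operator H (\<pi> b)" by (rule rep_linear_operator[OF b])
    show "ip_norm H (\<pi> b y) \<le> enn2real (op_norm H (\<pi> b)) * ip_norm H y" if "y \<in> carrier H" for y
      using ip_norm_le_op_norm[OF rep_linear_operator[OF b] rep_bounded[OF b] that] .
    show "\<pi> b (cyc_vec \<xi> q) \<in> cyc_space \<xi>" if q: "snd q \<in> carrier A" for q
      using rep_vec[OF SA \<xi> q b] vec_in_cyclic[OF \<xi>] q b SAs SA.mult_closed by simp
  qed simp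
qed

end

lemma op_norm_le_cstar_seminorm:
  fixes A :: "'a star_alg" and H :: "('h, 'm) inner_space_scheme" (structure)
  assumes SA: "star_algebra A" and rep: "bounded_representation A H \<pi>" and a: "a \<in> carrier A"
  shows "op_norm H (\<pi> a) \<le> cstar_seminorm A a"
  unfolding op_norm_def
proof (rule SUP_least, clarify)
  interpret bounded_representation A H \<pi> by fact
  interpret SA: star_algebra A by fact
  fix \<xi> assume \<xi>: "\<xi> \<in> carrier H" and \<xi>1: "ip_norm H \<xi> \<le> 1"
  note cyc = cyclic_subspace[OF SA \<xi>]
  let ?K = "cyc_space \<xi>"
  have KH: "\<And>x. x \<in> ?K \<Longrightarrow> x \<in> carrier H" using cyclic_subset by auto
  define c where "c = cyc_code \<xi>"
  define d where "d = inv_into ?K c"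
  have dc [simp]: "d (c x) = x" if "x \<in> ?K" for x
    using inj_code[OF \<xi>] that by (simp add: c_def d_def)
  have dK [simp]: "d u \<in> ?K" if "u \<in> c ` ?K" for u using that by auto
  have cd [simp]: "c (d u) = u" if "u \<in> c ` ?K" for u using that by auto
  define L :: "(nat \<Rightarrow> complex \<times> 'a) inner_space" where
    "L = \<lparr>carrier = c ` ?K, mult = undefined, one = undefined, zero = c \<zero>,
      add = (\<lambda>u v. c (d u \<oplus> d v)), smult = (\<lambda>z u. c (z \<odot> d u)), ip = (\<lambda>u v. ip H (d u) (d v))\<rparr>"
  define \<rho> where "\<rho> b u = c (\<pi> b (d u))" for b u
  have L [simp]: "carrier L = c ` ?K" "\<zero>\<^bsub>L\<^esub> = c \<zero>" "u \<oplus>\<^bsub>L\<^esub> v = c (d u \<oplus> d v)"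
      "z \<odot>\<^bsub>L\<^esub> u = c (z \<odot> d u)" "ip L u v = ip H (d u) (d v)" for u v z
    by (simp_all add: L_def)
  have minus_K: "\<ominus> x \<in> ?K" if "x \<in> ?K" for x
    using cyc(4)[OF that, of "-1"] KH[OF that] by (simp add: smult_minus_one)
  have abL: "abelian_group L"
  proof (rule abelian_groupI, goal_cases)
    case (3 x y z) then show ?case using cyc KH by (auto simp: M.a_assoc)
  next
    case (4 x y) then show ?case using cyc KH by (auto simp: M.a_comm)
  next
    case (6 x)
    then show ?case using cyc KH minus_K
      by (intro bexI[of _ "c (\<ominus> (d x))"]) (auto simp: M.l_neg)
  qed (use cyc KH in auto)
  have "module complex_ring L"
    by (rule moduleI[OF cring_complex_ring abL])
      (use cyc KH in \<open>auto simp: add_smult' smult_add' smult_smult' smult_one'\<close>)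
  then interpret L: pre_hilbert_space L
  proof (rule pre_hilbert_space.intro, unfold_locales, goal_cases)
    case (1 x y z) then show ?case using cyc KH by (auto simp: ip_add)
  next
    case (2 x z w) then show ?case using cyc KH by (auto simp: ip_smult)
  next
    case (3 x y) then show ?case using KH by (auto intro: ip_cnj)
  next
    case (4 x) then show ?case using KH by (auto intro: ip_nonneg)
  next
    case (5 x)
    then have "x \<in> c ` ?K" "ip H (d x) (d x) = 0" by auto
    then have "d x = \<zero>" using ip_definite KH dK by blast
    then show ?case using cd[OF \<open>x \<in> c ` ?K\<close>] by simp
  qed
  have normL: "ip_norm L u = ip_norm H (d u)" for u by (simp add: ip_norm_def)
  have minusL: "\<ominus>\<^bsub>L\<^esub> u = c (\<ominus> (d u))" if u: "u \<in> c ` ?K" for u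
    using u minus_K[OF dK[OF u]] KH[OF dK[OF u]] by (intro L.minus_equality) (auto simp: M.l_neg)
  have distL: "ip_dist L u v = ip_dist H (d u) (d v)" if "u \<in> c ` ?K" "v \<in> c ` ?K" for u v
  proof -
    have "d (u \<ominus>\<^bsub>L\<^esub> v) = d u \<ominus> d v"
      using that minus_K[OF dK[OF that(2)]] cyc(3) by (simp add: a_minus_def minusL)
    then show ?thesis using that KH by (simp add: ip_dist_def normL)
  qed
  interpret D: Metric_space "carrier H" "ip_dist H" by (rule Metric_space_ip_dist)
  interpret E: Metric_space "carrier L" "ip_dist L" by (rule L.Metric_space_ip_dist)
  have "E.mcomplete"
    unfolding E.mcomplete_def
  proof (intro allI impI)
    fix \<sigma> assume \<sigma>: "E.MCauchy \<sigma>"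
    then have r: "\<sigma> n \<in> c ` ?K" for n unfolding E.MCauchy_def by auto
    then have rK: "d (\<sigma> n) \<in> ?K" for n by simp
    have "D.MCauchy (\<lambda>n. d (\<sigma> n))"
      using \<sigma> KH rK r distL unfolding D.MCauchy_def E.MCauchy_def by (auto simp del: dK)
    then obtain l where l: "limitin D.mtopology (\<lambda>n. d (\<sigma> n)) l sequentially"
      using complete by (auto simp: D.mcomplete_def)
    then have l1: "l \<in> carrier H" and l2: "(\<lambda>n. ip_dist H (d (\<sigma> n)) l) \<longlonglongrightarrow> 0"
      by (auto simp: D.limitin_metric_dist_null)
    have lK: "l \<in> ?K"
    proof (rule cyclic_closed[OF \<xi> l1])
      fix e :: real assume "e > 0"
      then have "\<forall>\<^sub>F n in sequentially. ip_dist H (d (\<sigma> n)) l < e"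
        using l2 by (auto dest: order_tendstoD(2))
      then obtain n where "ip_dist H (d (\<sigma> n)) l < e"
        by (auto simp: eventually_sequentially)
      then show "\<exists>k\<in>?K. ip_dist H l k < e" using rK D.commute by auto
    qed
    have "(\<lambda>n. ip_dist L (\<sigma> n) (c l)) \<longlonglongrightarrow> 0"
      using l2 lK r by (simp add: distL)
    then have "limitin E.mtopology \<sigma> (c l) sequentially"
      unfolding E.limitin_metric_dist_null using lK r by auto
    then show "\<exists>x. limitin E.mtopology \<sigma> x sequentially" by (rule exI[of _ "c l"])
  qed
  then interpret L: hilbert_space L by unfold_locales
  have lin: "linear_operator L (\<rho> b)" if b: "b \<in> carrier A" for b
    using rep_linear_operator[OF b] cyc KH b by (auto simp: linear_operator_def \<rho>_def)
  have repL: "bounded_representation A L \<rho>"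
  proof (unfold_locales, goal_cases)
    case (1 b) then show ?case by (rule lin)
  next
    case (2 a b u) then show ?case using cyc KH by (auto simp: \<rho>_def rep_add)
  next
    case (3 a u z) then show ?case using cyc KH by (auto simp: \<rho>_def rep_smult)
  next
    case (4 a b u) then show ?case using cyc KH by (auto simp: \<rho>_def rep_mult)
  next
    case (5 a u v) then show ?case using cyc KH SA.star_closed by (auto simp: \<rho>_def rep_star)
  next
    case (6 b)
    have "ennreal (ip_norm L (\<rho> b u)) \<le> op_norm H (\<pi> b)"
      if "u \<in> carrier L" "ip_norm L u \<le> 1" for u
      unfolding op_norm_def
      by (rule SUP_upper2[of "d u"]) (use that cyc(5)[OF 6] KH in \<open>auto simp: normL \<rho>_def\<close>)
    then have "op_norm L (\<rho> b) \<le> op_norm H (\<pi> b)"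
      unfolding op_norm_def[of L] by (intro SUP_least) auto
    then show ?case using rep_bounded[OF 6] by order
  qed
  have "ennreal (ip_norm H (\<pi> a \<xi>)) = ennreal (ip_norm L (\<rho> a (c \<xi>)))"
    using cyc a by (simp add: normL \<rho>_def)
  also have "\<dots> \<le> op_norm L (\<rho> a)"
    unfolding op_norm_def by (rule SUP_upper) (use cyc \<xi>1 in \<open>auto simp: normL\<close>)
  also have "\<dots> \<le> cstar_seminorm A a"
    unfolding cstar_seminorm_def by (rule SUP_upper2[of "(L, \<rho>)"]) (use repL in auto)
  finally show "ennreal (ip_norm H (\<pi> a \<xi>)) \<le> cstar_seminorm A a" .
qed

end

theory Submission
  imports Defs
begin

text \<open>
  Write \<open>\<mu>\<^sub>\<xi>(K) = (\<pi>(1\<^sub>K)\<xi>, \<xi>)\<close> for compact open sets \<open>K\<close> of units. A nonnegative locally constant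
  function is the square of another one, so \<open>\<mu>\<^sub>\<xi>\<close> extends to a positive functional. If \<open>a\<close> is a
  combination of indicators of compact open bisections \<open>L\<^sub>j\<close> with coefficients \<open>d\<^sub>j\<close>, then by
  Cauchy-Schwarz \<open>\<bar>(\<pi>(a)\<xi>, \<zeta>)\<bar>\<close> is at most half the sum of the numbers
  \<open>\<bar>d\<^sub>j\<bar> (\<mu>\<^sub>\<xi>(s L\<^sub>j) + \<mu>\<^sub>\<zeta>(r L\<^sub>j))\<close>, and for disjoint bisections this gives the bound by the I-norm.
  In the non-Hausdorff case the bisections cannot be made disjoint, but their intersections can be
  made arbitrarily small for \<open>\<mu>\<^sub>\<xi>\<close> and \<open>\<mu>\<^sub>\<zeta>\<close>, with a bound on the number of bisections and on the
  coefficients that does not depend on how small; this suffices.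

  Every function in \<open>C\<^sub>c(G)\<close> is a sum of continuous functions on compact open bisections, hence a limit
  of elements of the Steinberg algebra in a norm that dominates both the I-norm and the
  C*-seminorm of \<open>C\<^sub>c(G)\<close>. So every bounded representation of the Steinberg algebra extends to
  \<open>C\<^sub>c(G)\<close> by continuity, the two C*-seminorms agree, and so do the completions.
\<close>

section \<open>Separated completions\<close>

text \<open>The I-norm sees cancellation, the sum of the numbers attached to the bisections does
  not: where bisections overlap, coefficients may cancel in a while their absolute values add up.
  Off the overlaps each bisection contributes an arrow of its own to a fibre and the two agree. With
  at most N bisections and coefficients of size at most B, the weight on the overlaps is at most N
  B; there are at most N^2 overlaps, each of content at most e, so the error is at most N^3 B e. N
  and B are fixed before e, which may therefore tend to 0. The contents are only finitely additive
  and only defined on compact open sets of units, so an overlap, which may fail to be compact, is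
  called small when every compact open set inside it is small. In the second half, \<pi>(f) is
  bounded on one bisection W by the sup norm c of f because f^* f + h^* h = c^2 1_{s W} for a
  suitable h; this is why convergence is measured one bisection at a time and not by fibre
  sums.\<close>

locale seminormed_star_algebra = star_algebra A for A :: "'a star_alg" (structure) +
  fixes p :: "'a \<Rightarrow> real"
  assumes p_nonneg: "a \<in> carrier A \<Longrightarrow> 0 \<le> p a"
    and p_add: "\<lbrakk>a \<in> carrier A; b \<in> carrier A\<rbrakk> \<Longrightarrow> p (a \<oplus> b) \<le> p a + p b"
    and p_smult: "a \<in> carrier A \<Longrightarrow> p (z \<odot> a) = cmod z * p a"
    and p_mult: "\<lbrakk>a \<in> carrier A; b \<in> carrier A\<rbrakk> \<Longrightarrow> p (a \<otimes> b) \<le> p a * p b"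
    and p_star: "a \<in> carrier A \<Longrightarrow> p (star A a) \<le> p a"
begin

lemma alg_smult_closed [simp]: "a \<in> carrier A \<Longrightarrow> z \<odot> a \<in> carrier A"
  using smult_closed by simp

lemma alg_smult_minus_one: "a \<in> carrier A \<Longrightarrow> (-1) \<odot> a = \<ominus> a"
proof -
  assume a: "a \<in> carrier A"
  have "(-1) \<odot> a \<oplus> 1 \<odot> a = 0 \<odot> a"
    using smult_l_distr[of "-1" 1 a] a by simp
  also have "0 \<odot> a = \<zero>" using smult_l_null[OF a] by simp
  finally show ?thesis
    using a smult_one[OF a] by (simp add: M.minus_equality)
qed

lemma p_zero [simp]: "p \<zero> = 0"
  using p_smult[of \<zero> 0] smult_l_null[of \<zero>] by simp

lemma p_minus: "a \<in> carrier A \<Longrightarrow> p (\<ominus> a) = p a"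
  using p_smult[of a "-1"] by (simp add: alg_smult_minus_one)

lemma p_diff_commute: "\<lbrakk>a \<in> carrier A; b \<in> carrier A\<rbrakk> \<Longrightarrow> p (a \<ominus> b) = p (b \<ominus> a)"
  using p_minus[of "b \<ominus> a"] by (simp add: a_minus_def M.minus_add M.a_comm)

lemma p_triangle:
  "\<lbrakk>a \<in> carrier A; b \<in> carrier A; c \<in> carrier A\<rbrakk> \<Longrightarrow> p (a \<ominus> c) \<le> p (a \<ominus> b) + p (b \<ominus> c)"
  using p_add[of "a \<ominus> b" "b \<ominus> c"] by (simp add: a_minus_def M.a_assoc M.r_neg1)

lemma p_diff_self [simp]: "a \<in> carrier A \<Longrightarrow> p (a \<ominus> a) = 0"
  by (simp add: a_minus_def M.r_neg)

lemma p_le_diff: "\<lbrakk>a \<in> carrier A; b \<in> carrier A\<rbrakk> \<Longrightarrow> \<bar>p a - p b\<bar> \<le> p (a \<ominus> b)"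
proof -
  assume *: "a \<in> carrier A" "b \<in> carrier A"
  then have "a = (a \<ominus> b) \<oplus> b" "b = (b \<ominus> a) \<oplus> a"
    by (simp_all add: a_minus_def M.a_assoc M.l_neg)
  then have "p a \<le> p (a \<ominus> b) + p b" "p b \<le> p (b \<ominus> a) + p a"
    using * by (metis M.minus_closed p_add)+
  then show ?thesis using p_diff_commute[OF *] by simp
qed

lemma p_add_diff:
  "\<lbrakk>a \<in> carrier A; b \<in> carrier A; c \<in> carrier A; d \<in> carrier A\<rbrakk>
    \<Longrightarrow> p ((a \<oplus> b) \<ominus> (c \<oplus> d)) \<le> p (a \<ominus> c) + p (b \<ominus> d)"
proof -
  assume *: "a \<in> carrier A" "b \<in> carrier A" "c \<in> carrier A" "d \<in> carrier A"
  then have "(a \<oplus> b) \<ominus> (c \<oplus> d) = (a \<ominus> c) \<oplus> (b \<ominus> d)"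
    by (simp add: a_minus_def M.minus_add M.a_ac)
  then show ?thesis using * p_add by simp
qed

lemma smult_diff: "\<lbrakk>a \<in> carrier A; b \<in> carrier A\<rbrakk> \<Longrightarrow> (z \<odot> a) \<ominus> (z \<odot> b) = z \<odot> (a \<ominus> b)"
  using smult_r_distr[of z a "\<ominus> b"] smult_assoc1[of z "-1" b] smult_assoc1[of "-1" z b]
  by (simp add: a_minus_def flip: alg_smult_minus_one)

lemma star_diff: "\<lbrakk>a \<in> carrier A; b \<in> carrier A\<rbrakk> \<Longrightarrow> star A a \<ominus> star A b = star A (a \<ominus> b)"
  using star_add[of a "\<ominus> b"] star_smult[of b "-1"] star_closed
  by (simp add: a_minus_def alg_smult_minus_one)

text \<open>Uses \<open>a \<otimes> d\<close> as the middle term. When sequences vary, it is enough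
  to bound the first factor of one product and the second factor of the other.\<close>

lemma p_mult_diff:
  assumes "a \<in> carrier A" "b \<in> carrier A" "c \<in> carrier A" "d \<in> carrier A"
  shows "p (a \<otimes> b \<ominus> c \<otimes> d) \<le> p a * p (b \<ominus> d) + p (a \<ominus> c) * p d"
proof -
  have neg1: "a \<otimes> (\<ominus> d) = \<ominus> (a \<otimes> d)" 
    using smult_mult_right[of a d "-1"] assms by (simp add: alg_smult_minus_one mult_closed)
  have neg2: "(\<ominus> c) \<otimes> d = \<ominus> (c \<otimes> d)"
    using smult_mult_left[of c d "-1"] assms by (simp add: alg_smult_minus_one mult_closed)
  have "a \<otimes> (b \<ominus> d) = a \<otimes> b \<ominus> a \<otimes> d" "(a \<ominus> c) \<otimes> d = a \<otimes> d \<ominus> c \<otimes> d"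
    using assms by (simp_all add: a_minus_def distrib_left distrib_right neg1 neg2)
  moreover have "p (a \<otimes> b \<ominus> c \<otimes> d) \<le> p (a \<otimes> b \<ominus> a \<otimes> d) + p (a \<otimes> d \<ominus> c \<otimes> d)"
    using p_triangle[of "a \<otimes> b" "a \<otimes> d" "c \<otimes> d"] assms by (simp add: mult_closed)
  moreover have "p (a \<otimes> (b \<ominus> d)) \<le> p a * p (b \<ominus> d)" "p ((a \<ominus> c) \<otimes> d) \<le> p (a \<ominus> c) * p d"
    using assms by (auto intro!: p_mult)
  ultimately show ?thesis by simp
qed

lemma cauchy_carrier: "x \<in> cauchy_seqs A p \<Longrightarrow> x n \<in> carrier A"
  by (auto simp: cauchy_seqs_def)

lemma cauchyD: "\<lbrakk>x \<in> cauchy_seqs A p; e > 0\<rbrakk> \<Longrightarrow> \<exists>N. \<forall>m\<ge>N. \<forall>n\<ge>N. p (x m \<ominus> x n) < e"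
  by (auto simp: cauchy_seqs_def)

lemma const_cauchy: "a \<in> carrier A \<Longrightarrow> (\<lambda>_. a) \<in> cauchy_seqs A p"
  by (auto simp: cauchy_seqs_def)

lemma Cauchy_p: "x \<in> cauchy_seqs A p \<Longrightarrow> Cauchy (\<lambda>n. p (x n))"
proof (rule metric_CauchyI)
  fix e :: real assume x: "x \<in> cauchy_seqs A p" and "e > 0"
  then obtain N where "\<forall>m\<ge>N. \<forall>n\<ge>N. p (x m \<ominus> x n) < e" using cauchyD by blast
  then show "\<exists>M. \<forall>m\<ge>M. \<forall>n\<ge>M. dist (p (x m)) (p (x n)) < e"
    unfolding dist_real_def using p_le_diff[OF cauchy_carrier[OF x] cauchy_carrier[OF x]]
    by (blast intro: le_less_trans)
qed

lemma cauchy_bounded: "x \<in> cauchy_seqs A p \<Longrightarrow> \<exists>C>0. \<forall>n. p (x n) \<le> C"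
  using Cauchy_p[of x] p_nonneg[OF cauchy_carrier, of x]
  by (auto dest!: Cauchy_Bseq simp: Bseq_def)

text \<open>One criterion for all operations; unary ones pass the same sequence twice.
  \<open>C\<close> and \<open>D\<close> are strictly positive so that \<open>e / (2 * C)\<close> and
  \<open>e / (2 * D)\<close> are admissible tolerances.\<close>

lemma cauchy_of_dominated:
  assumes x: "x \<in> cauchy_seqs A p" and y: "y \<in> cauchy_seqs A p" and z: "\<And>n. z n \<in> carrier A"
    and le: "\<And>m n. p (z m \<ominus> z n) \<le> C * p (x m \<ominus> x n) + D * p (y m \<ominus> y n)"
    and CD: "C > 0" "D > 0"
  shows "z \<in> cauchy_seqs A p"
  unfolding cauchy_seqs_def
proof (intro CollectI conjI allI impI)
  show "range z \<subseteq> carrier A" using z by auto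
  fix e :: real assume e: "e > 0"
  obtain N where N: "\<forall>m\<ge>N. \<forall>n\<ge>N. p (x m \<ominus> x n) < e / (2 * C)"
    using cauchyD[OF x, of "e / (2 * C)"] e CD by auto
  obtain M where M: "\<forall>m\<ge>M. \<forall>n\<ge>M. p (y m \<ominus> y n) < e / (2 * D)"
    using cauchyD[OF y, of "e / (2 * D)"] e CD by auto
  show "\<exists>N. \<forall>m\<ge>N. \<forall>n\<ge>N. p (z m \<ominus> z n) < e"
  proof (intro exI allI impI)
    fix m n assume "max M N \<le> m" "max M N \<le> n"
    then have "p (x m \<ominus> x n) < e / (2 * C)" "p (y m \<ominus> y n) < e / (2 * D)"
      using N M by auto
    then have "C * p (x m \<ominus> x n) < C * (e / (2 * C))" "D * p (y m \<ominus> y n) < D * (e / (2 * D))"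
      using CD by (simp_all only: mult_strict_left_mono)
    then show "p (z m \<ominus> z n) < e" using le[of m n] CD by simp
  qed
qed

lemma cauchy_add:
  assumes "x \<in> cauchy_seqs A p" "y \<in> cauchy_seqs A p"
  shows "(\<lambda>n. x n \<oplus> y n) \<in> cauchy_seqs A p"
  by (rule cauchy_of_dominated[OF assms, where C = 1 and D = 1])
    (use assms in \<open>auto simp: cauchy_carrier p_add_diff\<close>)

lemma cauchy_mult:
  assumes x: "x \<in> cauchy_seqs A p" and y: "y \<in> cauchy_seqs A p"
  shows "(\<lambda>n. x n \<otimes> y n) \<in> cauchy_seqs A p"
proof -
  obtain C where C: "C > 0" "\<And>n. p (x n) \<le> C" using cauchy_bounded[OF x] by auto
  obtain D where D: "D > 0" "\<And>n. p (y n) \<le> D" using cauchy_bounded[OF y] by auto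
  show ?thesis
  proof (rule cauchy_of_dominated[OF x y, where C = D and D = C])
    fix m n
    note cx = cauchy_carrier[OF x] and cy = cauchy_carrier[OF y]
    have "p (x m) * p (y m \<ominus> y n) \<le> C * p (y m \<ominus> y n)" "p (x m \<ominus> x n) * p (y n) \<le> p (x m \<ominus> x n) * D"
      using C D cx cy by (auto intro!: mult_right_mono mult_left_mono p_nonneg)
    then show "p (x m \<otimes> y m \<ominus> x n \<otimes> y n) \<le> D * p (x m \<ominus> x n) + C * p (y m \<ominus> y n)"
      using p_mult_diff[OF cx cy cx cy, of m m n n] by (simp add: mult.commute)
  qed (use C D x y in \<open>auto simp: cauchy_carrier mult_closed\<close>)
qed

lemma cauchy_smult:
  assumes "x \<in> cauchy_seqs A p" shows "(\<lambda>n. z \<odot> x n) \<in> cauchy_seqs A p"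
\<comment> \<open>\<open>cmod z + 1\<close> stays positive when \<open>z\<close> is 0.\<close>
proof (rule cauchy_of_dominated[OF assms assms, where C = "cmod z + 1" and D = 1])
  fix m n
  note cx = cauchy_carrier[OF assms]
  have "0 \<le> p (x m \<ominus> x n)" using cx by (simp add: p_nonneg)
  then show "p (z \<odot> x m \<ominus> z \<odot> x n) \<le> (cmod z + 1) * p (x m \<ominus> x n) + 1 * p (x m \<ominus> x n)"
    using cx by (simp add: smult_diff p_smult algebra_simps)
qed (use assms in \<open>auto simp: cauchy_carrier add_nonneg_pos\<close>)

lemma cauchy_star:
  assumes "x \<in> cauchy_seqs A p" shows "(\<lambda>n. star A (x n)) \<in> cauchy_seqs A p"
proof (rule cauchy_of_dominated[OF assms assms, where C = 1 and D = 1])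
  fix m n
  note cx = cauchy_carrier[OF assms]
  have "0 \<le> p (x m \<ominus> x n)" using cx by (simp add: p_nonneg)
  then show "p (star A (x m) \<ominus> star A (x n)) \<le> 1 * p (x m \<ominus> x n) + 1 * p (x m \<ominus> x n)"
    using cx p_star[of "x m \<ominus> x n"] by (simp add: star_diff)
qed (use assms in \<open>auto simp: cauchy_carrier star_closed\<close>)

section \<open>Null sequences and the termwise operations\<close>

lemma null_relI:
  assumes x: "x \<in> cauchy_seqs A p" and y: "y \<in> cauchy_seqs A p"
    and le: "\<And>n. p (x n \<ominus> y n) \<le> f n" and f: "f \<longlonglongrightarrow> 0"
  shows "(x, y) \<in> null_rel A p"
proof -
  have "(\<lambda>n. p (x n \<ominus> y n)) \<longlonglongrightarrow> 0"
    by (rule tendsto_sandwich[OF _ _ tendsto_const f])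
      (use le x y in \<open>auto simp: p_nonneg cauchy_carrier\<close>)
  then show ?thesis using x y by (simp add: null_rel_def)
qed

lemma null_relD:
  assumes "(x, y) \<in> null_rel A p"
  shows "x \<in> cauchy_seqs A p" "y \<in> cauchy_seqs A p" "(\<lambda>n. p (x n \<ominus> y n)) \<longlonglongrightarrow> 0"
  using assms by (auto simp: null_rel_def)

lemma equiv_null_rel: "equiv (cauchy_seqs A p) (null_rel A p)"
proof (rule equivI)
  show "refl_on (cauchy_seqs A p) (null_rel A p)"
    by (rule refl_onI) (auto intro!: null_relI[where f = "\<lambda>_. 0"] simp: cauchy_carrier)
  show "sym (null_rel A p)"
  proof (rule symI)
    fix x y assume *: "(x, y) \<in> null_rel A p"
    note D = null_relD[OF *]
    show "(y, x) \<in> null_rel A p"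
      by (rule null_relI[OF D(2,1) _ D(3)]) (use D in \<open>auto simp: cauchy_carrier p_diff_commute\<close>)
  qed
  show "trans (null_rel A p)"
  proof (rule transI)
    fix x y z assume *: "(x, y) \<in> null_rel A p" "(y, z) \<in> null_rel A p"
    note D = null_relD[OF *(1)] and E = null_relD[OF *(2)]
    show "(x, z) \<in> null_rel A p"
    proof (rule null_relI[OF D(1) E(2), where f = "\<lambda>n. p (x n \<ominus> y n) + p (y n \<ominus> z n)"])
      show "(\<lambda>n. p (x n \<ominus> y n) + p (y n \<ominus> z n)) \<longlonglongrightarrow> 0"
        using tendsto_add[OF D(3) E(3)] by simp
    qed (use D E in \<open>auto intro!: p_triangle simp: cauchy_carrier\<close>)
  qed
qed (auto simp: null_rel_def)

lemmas cls_eq = equiv_class_eq[OF equiv_null_rel]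

lemma completion_add:
  assumes x: "x \<in> cauchy_seqs A p" and y: "y \<in> cauchy_seqs A p"
  shows "add (completion A p) (null_rel A p `` {x}) (null_rel A p `` {y}) =
    null_rel A p `` {\<lambda>n. x n \<oplus> y n}"
proof -
  have "(\<lambda>x y. null_rel A p `` {\<lambda>n. x n \<oplus> y n}) respects2 (null_rel A p)"
  proof (intro congruent2I' cls_eq)
    fix x x' y y' assume *: "(x, x') \<in> null_rel A p" "(y, y') \<in> null_rel A p"
    note D = null_relD[OF *(1)] and E = null_relD[OF *(2)]
    show "(\<lambda>n. x n \<oplus> y n, \<lambda>n. x' n \<oplus> y' n) \<in> null_rel A p"
    proof (rule null_relI[where f = "\<lambda>n. p (x n \<ominus> x' n) + p (y n \<ominus> y' n)"])
      show "(\<lambda>n. p (x n \<ominus> x' n) + p (y n \<ominus> y' n)) \<longlonglongrightarrow> 0"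
        using tendsto_add[OF D(3) E(3)] by simp
    qed (use D E in \<open>auto intro!: p_add_diff cauchy_add simp: cauchy_carrier\<close>)
  qed
  from UN_equiv_class2[OF equiv_null_rel equiv_null_rel this x y] show ?thesis
    by (simp add: completion_def Let_def)
qed

lemma completion_mult:
  assumes x: "x \<in> cauchy_seqs A p" and y: "y \<in> cauchy_seqs A p"
  shows "mult (completion A p) (null_rel A p `` {x}) (null_rel A p `` {y}) =
    null_rel A p `` {\<lambda>n. x n \<otimes> y n}"
proof -
  have "(\<lambda>x y. null_rel A p `` {\<lambda>n. x n \<otimes> y n}) respects2 (null_rel A p)"
  proof (intro congruent2I' cls_eq)
    fix x x' y y' assume *: "(x, x') \<in> null_rel A p" "(y, y') \<in> null_rel A p"
    note D = null_relD[OF *(1)] and E = null_relD[OF *(2)]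
    obtain C where C: "C > 0" "\<And>n. p (x n) \<le> C" using cauchy_bounded[OF D(1)] by auto
    obtain C' where C': "C' > 0" "\<And>n. p (y' n) \<le> C'" using cauchy_bounded[OF E(2)] by auto
    show "(\<lambda>n. x n \<otimes> y n, \<lambda>n. x' n \<otimes> y' n) \<in> null_rel A p"
    proof (rule null_relI[where f = "\<lambda>n. C * p (y n \<ominus> y' n) + p (x n \<ominus> x' n) * C'"])
      show "(\<lambda>n. C * p (y n \<ominus> y' n) + p (x n \<ominus> x' n) * C') \<longlonglongrightarrow> 0"
        using tendsto_add[OF tendsto_mult_left[OF E(3), of C] tendsto_mult_right[OF D(3), of C']] by simp
      fix n
      note c = D(1,2)[THEN cauchy_carrier] E(1,2)[THEN cauchy_carrier]
      have "p (x n) * p (y n \<ominus> y' n) \<le> C * p (y n \<ominus> y' n)"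
          "p (x n \<ominus> x' n) * p (y' n) \<le> p (x n \<ominus> x' n) * C'"
        using C C' c by (auto intro!: mult_right_mono mult_left_mono p_nonneg)
      then show "p (x n \<otimes> y n \<ominus> x' n \<otimes> y' n) \<le> C * p (y n \<ominus> y' n) + p (x n \<ominus> x' n) * C'"
        using p_mult_diff[of "x n" "y n" "x' n" "y' n"] c by simp
    qed (use D E in \<open>auto intro!: cauchy_mult\<close>)
  qed
  from UN_equiv_class2[OF equiv_null_rel equiv_null_rel this x y] show ?thesis
    by (simp add: completion_def Let_def)
qed

lemma completion_smult:
  assumes x: "x \<in> cauchy_seqs A p"
  shows "smult (completion A p) z (null_rel A p `` {x}) = null_rel A p `` {\<lambda>n. z \<odot> x n}"
proof -
  have "(\<lambda>x. null_rel A p `` {\<lambda>n. z \<odot> x n}) respects (null_rel A p)"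
  proof (intro congruentI cls_eq)
    fix x x' assume *: "(x, x') \<in> null_rel A p"
    note D = null_relD[OF *]
    show "(\<lambda>n. z \<odot> x n, \<lambda>n. z \<odot> x' n) \<in> null_rel A p"
    proof (rule null_relI[where f = "\<lambda>n. cmod z * p (x n \<ominus> x' n)"])
      show "(\<lambda>n. cmod z * p (x n \<ominus> x' n)) \<longlonglongrightarrow> 0"
        using tendsto_mult_left[OF D(3), of "cmod z"] by simp
    qed (use D in \<open>auto intro!: cauchy_smult simp: smult_diff p_smult cauchy_carrier\<close>)
  qed
  from UN_equiv_class[OF equiv_null_rel this x] show ?thesis
    by (simp add: completion_def Let_def)
qed

lemma completion_star:
  assumes x: "x \<in> cauchy_seqs A p"
  shows "star (completion A p) (null_rel A p `` {x}) = null_rel A p `` {\<lambda>n. star A (x n)}"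
proof -
  have "(\<lambda>x. null_rel A p `` {\<lambda>n. star A (x n)}) respects (null_rel A p)"
  proof (intro congruentI cls_eq)
    fix x x' assume *: "(x, x') \<in> null_rel A p"
    note D = null_relD[OF *]
    show "(\<lambda>n. star A (x n), \<lambda>n. star A (x' n)) \<in> null_rel A p"
      by (rule null_relI[OF _ _ _ D(3)])
        (use D in \<open>auto intro!: cauchy_star p_star simp: star_diff cauchy_carrier\<close>)
  qed
  from UN_equiv_class[OF equiv_null_rel this x] show ?thesis
    by (simp add: completion_def Let_def)
qed

lemma completion_nrm:
  assumes x: "x \<in> cauchy_seqs A p"
  shows "nrm (completion A p) (null_rel A p `` {x}) = lim (\<lambda>n. p (x n))"
proof -
  have "(\<lambda>x. {lim (\<lambda>n. p (x n))}) respects (null_rel A p)"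
  proof (rule congruentI)
    fix x x' assume *: "(x, x') \<in> null_rel A p"
    note D = null_relD[OF *]
    obtain l where l: "(\<lambda>n. p (x n)) \<longlonglongrightarrow> l"
      using Cauchy_p[OF D(1)] by (auto simp: Cauchy_convergent_iff convergent_def)
    have "(\<lambda>n. p (x n) - p (x' n)) \<longlonglongrightarrow> 0"
      by (rule Lim_null_comparison[OF _ D(3)]) (use D in \<open>auto simp: cauchy_carrier p_le_diff\<close>)
    from tendsto_diff[OF l this] have "(\<lambda>n. p (x' n)) \<longlonglongrightarrow> l" by simp
    with l show "{lim (\<lambda>n. p (x n))} = {lim (\<lambda>n. p (x' n))}" by (simp add: limI)
  qed
  from UN_equiv_class[OF equiv_null_rel this x] show ?thesis
    by (simp add: completion_def Let_def)
qed

lemma completion_carrier: "carrier (completion A p) = (\<lambda>x. null_rel A p `` {x}) ` cauchy_seqs A p"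
  by (auto simp: completion_def Let_def quotient_def)

end

text \<open>Since \<open>p\<close> is \<open>q\<close> on \<open>A\<close> and the operations agree,
  a Cauchy sequence of \<open>A\<close> is one of \<open>B\<close>, and the map takes its class to
  its class in \<open>B\<close>; everything except surjectivity is then termwise. The image of
  \<open>X\<close> under \<open>null_rel B q\<close> is the union of the \<open>B\<close>-classes of
  the representatives in \<open>X\<close>, all of which coincide.\<close>

lemma completion_dense_subalgebra_iso:
  fixes A B :: "'a star_alg"
  assumes A: "seminormed_star_algebra A p" and B: "seminormed_star_algebra B q"
    and sub: "carrier A \<subseteq> carrier B"
    and ops: "add A = add B" "mult A = mult B" "smult A = smult B" "star A = star B"
    and pq: "\<And>a. a \<in> carrier A \<Longrightarrow> p a = q a"
    and dense: "\<And>b e. b \<in> carrier B \<Longrightarrow> e > 0 \<Longrightarrow> \<exists>a\<in>carrier A. q (b \<ominus>\<^bsub>B\<^esub> a) < e"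
  shows "cstar_isomorphism (completion A p) (completion B q) (\<lambda>X. null_rel B q `` X)"
    and "a \<in> carrier A \<Longrightarrow> null_rel B q `` completion_embed A p a = completion_embed B q a"
proof -
  interpret A: seminormed_star_algebra A p by fact
  interpret B: seminormed_star_algebra B q by fact
  \<comment> \<open>Additive inverses are defined relative to the carrier, so those of
    \<open>A\<close> and \<open>B\<close> are compared through multiplication by -1.\<close>
  have diff: "a \<ominus>\<^bsub>A\<^esub> b = a \<ominus>\<^bsub>B\<^esub> b" if "a \<in> carrier A" "b \<in> carrier A" for a b
    using A.alg_smult_minus_one[OF that(2)] B.alg_smult_minus_one[of b] that sub
    by (auto simp: a_minus_def ops)
  have pd: "p (a \<ominus>\<^bsub>A\<^esub> b) = q (a \<ominus>\<^bsub>B\<^esub> b)" if "a \<in> carrier A" "b \<in> carrier A" for a b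
    using pq[of "a \<ominus>\<^bsub>A\<^esub> b"] A.M.minus_closed[OF that] by (simp add: diff that)
  have cauchy: "x \<in> cauchy_seqs A p \<longleftrightarrow> x \<in> cauchy_seqs B q \<and> range x \<subseteq> carrier A" for x
    using sub by (auto simp: cauchy_seqs_def pd range_subsetD)
  have null: "(x, y) \<in> null_rel A p \<longleftrightarrow> x \<in> cauchy_seqs A p \<and> y \<in> cauchy_seqs A p \<and> (x, y) \<in> null_rel B q" for x y
    using cauchy by (auto simp: null_rel_def pd range_subsetD)
  define \<Phi> where "\<Phi> X = null_rel B q `` X" for X
  have \<Phi>: "\<Phi> (null_rel A p `` {x}) = null_rel B q `` {x}" if x: "x \<in> cauchy_seqs A p" for x
  proof
    show "\<Phi> (null_rel A p `` {x}) \<subseteq> null_rel B q `` {x}"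
      using B.equiv_null_rel null unfolding \<Phi>_def equiv_def trans_def by blast
    show "null_rel B q `` {x} \<subseteq> \<Phi> (null_rel A p `` {x})"
      using x A.equiv_null_rel unfolding \<Phi>_def equiv_def refl_on_def by blast
  qed
  have eqA: "null_rel A p `` {x} = null_rel A p `` {y}"
    if "x \<in> cauchy_seqs A p" "y \<in> cauchy_seqs A p" "null_rel B q `` {x} = null_rel B q `` {y}" for x y
  proof -
    have "(x, y) \<in> null_rel B q"
      using that cauchy eq_equiv_class[OF that(3) B.equiv_null_rel] by blast
    then show ?thesis using that null by (intro A.cls_eq) auto
  qed
  have surj: "\<exists>x\<in>cauchy_seqs A p. null_rel B q `` {x} = null_rel B q `` {y}"
    if y: "y \<in> cauchy_seqs B q" for y
  proof -
    \<comment> \<open>Approximating \<open>y n\<close> within \<open>1 / Suc n\<close> gives a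
      sequence of \<open>A\<close> whose distance to \<open>y\<close> tends to 0; three terms below
      \<open>e / 3\<close> make it Cauchy, and it represents the class of \<open>y\<close>.\<close>
    have "\<forall>n. \<exists>a\<in>carrier A. q (y n \<ominus>\<^bsub>B\<^esub> a) < 1 / Suc n"
      using dense B.cauchy_carrier[OF y] by simp
    then obtain x where x: "\<And>n. x n \<in> carrier A" "\<And>n. q (y n \<ominus>\<^bsub>B\<^esub> x n) < 1 / Suc n"
      by metis
    have xB: "x n \<in> carrier B" for n using x sub by auto
    note yB = B.cauchy_carrier[OF y]
    have lim: "(\<lambda>n. q (y n \<ominus>\<^bsub>B\<^esub> x n)) \<longlonglongrightarrow> 0"
      by (rule tendsto_sandwich[OF _ _ tendsto_const LIMSEQ_inverse_real_of_nat])
        (use x xB yB in \<open>auto simp: B.p_nonneg inverse_eq_divide less_imp_le\<close>)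
    have "x \<in> cauchy_seqs B q"
      unfolding cauchy_seqs_def
    proof (intro CollectI conjI allI impI)
      fix e :: real assume e: "e > 0"
      obtain N where N: "\<forall>m\<ge>N. \<forall>n\<ge>N. q (y m \<ominus>\<^bsub>B\<^esub> y n) < e / 3"
        using B.cauchyD[OF y, of "e/3"] e by auto
      obtain M where M: "\<forall>n\<ge>M. q (y n \<ominus>\<^bsub>B\<^esub> x n) < e / 3"
        using order_tendstoD(2)[OF lim, of "e/3"] e by (auto simp: eventually_sequentially)
      have "q (x m \<ominus>\<^bsub>B\<^esub> x n) < e" if "m \<ge> max M N" "n \<ge> max M N" for m n
      proof -
        have "q (x m \<ominus>\<^bsub>B\<^esub> x n) \<le> q (x m \<ominus>\<^bsub>B\<^esub> y m) + q (y m \<ominus>\<^bsub>B\<^esub> x n)"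
          by (rule B.p_triangle) (use xB yB in auto)
        moreover have "q (y m \<ominus>\<^bsub>B\<^esub> x n) \<le> q (y m \<ominus>\<^bsub>B\<^esub> y n) + q (y n \<ominus>\<^bsub>B\<^esub> x n)"
          by (rule B.p_triangle) (use xB yB in auto)
        moreover have "q (y m \<ominus>\<^bsub>B\<^esub> y n) < e/3" "q (y m \<ominus>\<^bsub>B\<^esub> x m) < e/3" "q (y n \<ominus>\<^bsub>B\<^esub> x n) < e/3"
          using N M that by auto
        ultimately show ?thesis using B.p_diff_commute[of "x m" "y m"] xB yB by simp
      qed
      then show "\<exists>N. \<forall>m\<ge>N. \<forall>n\<ge>N. q (x m \<ominus>\<^bsub>B\<^esub> x n) < e" by blast
    qed (use xB in auto)
    then have "x \<in> cauchy_seqs A p" "(y, x) \<in> null_rel B q"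
      using x cauchy y lim by (auto simp: null_rel_def)
    then show ?thesis using B.cls_eq by blast
  qed
  have cB: "x \<in> cauchy_seqs B q" if "x \<in> cauchy_seqs A p" for x using cauchy that by auto
  have "bij_betw \<Phi> (carrier (completion A p)) (carrier (completion B q))"
    unfolding bij_betw_def
  proof
    show "inj_on \<Phi> (carrier (completion A p))"
    proof (rule inj_onI)
      fix X Y assume "X \<in> carrier (completion A p)" "Y \<in> carrier (completion A p)" and eq: "\<Phi> X = \<Phi> Y"
      then obtain x y where x: "x \<in> cauchy_seqs A p" "X = null_rel A p `` {x}"
        and y: "y \<in> cauchy_seqs A p" "Y = null_rel A p `` {y}"
        unfolding A.completion_carrier by blast
      then show "X = Y" using eq eqA[OF x(1) y(1)] by (simp only: \<Phi>)
    qed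
    have "\<Phi> ` carrier (completion A p) = (\<lambda>x. null_rel B q `` {x}) ` cauchy_seqs A p"
      unfolding A.completion_carrier image_image by (rule image_cong[OF refl \<Phi>])
    also have "\<dots> = carrier (completion B q)"
    proof
      show "(\<lambda>x. null_rel B q `` {x}) ` cauchy_seqs A p \<subseteq> carrier (completion B q)"
        using cB unfolding B.completion_carrier by blast
      show "carrier (completion B q) \<subseteq> (\<lambda>x. null_rel B q `` {x}) ` cauchy_seqs A p"
      proof
        fix Y assume "Y \<in> carrier (completion B q)"
        then obtain y where "y \<in> cauchy_seqs B q" "Y = null_rel B q `` {y}"
          unfolding B.completion_carrier by blast
        then show "Y \<in> (\<lambda>x. null_rel B q `` {x}) ` cauchy_seqs A p"
          using surj[of y] by (metis imageI)
      qed
    qed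
    finally show "\<Phi> ` carrier (completion A p) = carrier (completion B q)" .
  qed
  moreover have "\<Phi> (add (completion A p) X Y) = add (completion B q) (\<Phi> X) (\<Phi> Y)"
      "\<Phi> (mult (completion A p) X Y) = mult (completion B q) (\<Phi> X) (\<Phi> Y)"
    if "X \<in> carrier (completion A p)" "Y \<in> carrier (completion A p)" for X Y
  proof -
    obtain x y where x: "x \<in> cauchy_seqs A p" "X = null_rel A p `` {x}"
      and y: "y \<in> cauchy_seqs A p" "Y = null_rel A p `` {y}"
      using \<open>X \<in> _\<close> \<open>Y \<in> _\<close> unfolding A.completion_carrier by blast
    show "\<Phi> (add (completion A p) X Y) = add (completion B q) (\<Phi> X) (\<Phi> Y)"
      unfolding x(2) y(2) A.completion_add[OF x(1) y(1)] \<Phi>[OF x(1)] \<Phi>[OF y(1)]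
        \<Phi>[OF A.cauchy_add[OF x(1) y(1)]] B.completion_add[OF x(1)[THEN cB] y(1)[THEN cB]]
      unfolding ops ..
    show "\<Phi> (mult (completion A p) X Y) = mult (completion B q) (\<Phi> X) (\<Phi> Y)"
      unfolding x(2) y(2) A.completion_mult[OF x(1) y(1)] \<Phi>[OF x(1)] \<Phi>[OF y(1)]
        \<Phi>[OF A.cauchy_mult[OF x(1) y(1)]] B.completion_mult[OF x(1)[THEN cB] y(1)[THEN cB]]
      unfolding ops ..
  qed
  moreover have "\<Phi> (smult (completion A p) z X) = smult (completion B q) z (\<Phi> X)"
      "\<Phi> (star (completion A p) X) = star (completion B q) (\<Phi> X)"
      "nrm (completion B q) (\<Phi> X) = nrm (completion A p) X"
    if "X \<in> carrier (completion A p)" for z X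
  proof -
    obtain x where x: "x \<in> cauchy_seqs A p" "X = null_rel A p `` {x}"
      using \<open>X \<in> _\<close> unfolding A.completion_carrier by blast
    show "\<Phi> (smult (completion A p) z X) = smult (completion B q) z (\<Phi> X)"
      unfolding x(2) A.completion_smult[OF x(1)] \<Phi>[OF x(1)]
        \<Phi>[OF A.cauchy_smult[OF x(1)]] B.completion_smult[OF x(1)[THEN cB]]
      unfolding ops ..
    show "\<Phi> (star (completion A p) X) = star (completion B q) (\<Phi> X)"
      unfolding x(2) A.completion_star[OF x(1)] \<Phi>[OF x(1)]
        \<Phi>[OF A.cauchy_star[OF x(1)]] B.completion_star[OF x(1)[THEN cB]]
      unfolding ops ..
    show "nrm (completion B q) (\<Phi> X) = nrm (completion A p) X"
      unfolding x(2) A.completion_nrm[OF x(1)] \<Phi>[OF x(1)] B.completion_nrm[OF x(1)[THEN cB]]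
      using pq A.cauchy_carrier[OF x(1)] by simp
  qed
  ultimately have "cstar_isomorphism (completion A p) (completion B q) \<Phi>"
    unfolding cstar_isomorphism_def by blast
  then show "cstar_isomorphism (completion A p) (completion B q) (\<lambda>X. null_rel B q `` X)"
    by (simp add: \<Phi>_def[abs_def])
  show "null_rel B q `` completion_embed A p a = completion_embed B q a" if "a \<in> carrier A"
    using \<Phi>[OF A.const_cauchy[OF that]] by (simp add: \<Phi>_def completion_embed_def)
qed

section \<open>The universal C*-seminorm\<close>

text \<open>Trades the \<open>ennreal\<close> supremum over the unit ball for a real inequality on
  all vectors, the form in which most later estimates are made.\<close>

lemma (in pre_hilbert_space) op_norm_le_ennreal_iff:
  assumes T: "linear_operator H T" and c: "0 \<le> c"
  shows "op_norm H T \<le> ennreal c \<longleftrightarrow> (\<forall>\<xi>\<in>carrier H. ip_norm H (T \<xi>) \<le> c * ip_norm H \<xi>)"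
proof
  assume le: "op_norm H T \<le> ennreal c"
  then have fin: "op_norm H T < \<infinity>" by (simp add: le_less_trans)
  have "enn2real (op_norm H T) \<le> c"
    using le c fin by (metis enn2real_leI)
  then show "\<forall>\<xi>\<in>carrier H. ip_norm H (T \<xi>) \<le> c * ip_norm H \<xi>"
    using ip_norm_le_op_norm[OF T fin] by (meson ip_norm_nonneg mult_right_mono order_trans)
next
  assume *: "\<forall>\<xi>\<in>carrier H. ip_norm H (T \<xi>) \<le> c * ip_norm H \<xi>"
  show "op_norm H T \<le> ennreal c"
    unfolding op_norm_def
  proof (intro SUP_least ennreal_leI)
    fix \<xi> assume "\<xi> \<in> {\<xi> \<in> carrier H. ip_norm H \<xi> \<le> 1}"
    then have "ip_norm H (T \<xi>) \<le> c * ip_norm H \<xi>" "c * ip_norm H \<xi> \<le> c"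
      using * c by (auto simp: mult_left_le)
    then show "ip_norm H (T \<xi>) \<le> c" by linarith
  qed
qed

definition cstar_norm :: "'a star_alg \<Rightarrow> 'a \<Rightarrow> real" where
  "cstar_norm A a = enn2real (cstar_seminorm A a)"

lemma (in bounded_representation) representation_norm_le:
  assumes a: "a \<in> carrier A" and \<xi>: "\<xi> \<in> carrier H" and le: "op_norm H (\<pi> a) \<le> ennreal c" "0 \<le> c"
  shows "ip_norm H (\<pi> a \<xi>) \<le> c * ip_norm H \<xi>"
  using op_norm_le_ennreal_iff[OF rep_linear_operator[OF a] le(2)] le(1) \<xi> by blast

lemma cstar_norm_bound:
  fixes A :: "'a star_alg" and H :: "(nat \<Rightarrow> complex \<times> 'a) inner_space"
  assumes wd: "cstar_completion_well_defined A" and rep: "bounded_representation A H \<pi>"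
    and a: "a \<in> carrier A" and \<xi>: "\<xi> \<in> carrier H"
  shows "ip_norm H (\<pi> a \<xi>) \<le> cstar_norm A a * ip_norm H \<xi>"
proof -
  interpret bounded_representation A H \<pi> by fact
  have "op_norm H (\<pi> a) \<le> cstar_seminorm A a"
    unfolding cstar_seminorm_def by (rule SUP_upper2[of "(H, \<pi>)"]) (use rep in auto)
  also have "cstar_seminorm A a = ennreal (cstar_norm A a)"
    using wd a by (simp add: cstar_norm_def cstar_completion_well_defined_def)
  finally show ?thesis
    by (rule representation_norm_le[OF a \<xi>]) (simp add: cstar_norm_def)
qed

lemma cstar_seminorm_leI:
  fixes A :: "'a star_alg"
  assumes c: "0 \<le> c" and a: "a \<in> carrier A"
    and le: "\<And>(H :: (nat \<Rightarrow> complex \<times> 'a) inner_space) \<pi> \<xi>. \<lbrakk>bounded_representation A H \<pi>; \<xi> \<in> carrier H\<rbrakk>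
      \<Longrightarrow> ip_norm H (\<pi> a \<xi>) \<le> c * ip_norm H \<xi>"
  shows "cstar_seminorm A a \<le> ennreal c"
  unfolding cstar_seminorm_def
proof (rule SUP_least, clarify)
  fix H :: "(nat \<Rightarrow> complex \<times> 'a) inner_space" and \<pi>
  assume rep: "bounded_representation A H \<pi>"
  interpret bounded_representation A H \<pi> by fact
  show "op_norm H (\<pi> a) \<le> ennreal c"
    using op_norm_le_ennreal_iff[OF rep_linear_operator[OF a] c] le[OF rep] by blast
qed

lemma cstar_norm_leI:
  fixes A :: "'a star_alg"
  assumes c: "0 \<le> c" and a: "a \<in> carrier A"
    and le: "\<And>(H :: (nat \<Rightarrow> complex \<times> 'a) inner_space) \<pi> \<xi>. \<lbrakk>bounded_representation A H \<pi>; \<xi> \<in> carrier H\<rbrakk>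
      \<Longrightarrow> ip_norm H (\<pi> a \<xi>) \<le> c * ip_norm H \<xi>"
  shows "cstar_norm A a \<le> c"
proof -
  have "cstar_seminorm A a \<le> ennreal c" by (rule cstar_seminorm_leI[OF c a]) (rule le)
  then show ?thesis using c unfolding cstar_norm_def by (simp add: enn2real_leI)
qed

text \<open>The source of all positivity: at an element of the form a^* a the functional of \<xi>
  takes a squared norm as its value, for unbounded operators as well.\<close>

lemma (in representation) rep_norm_sq:
  assumes "star_algebra A" "a \<in> carrier A" "\<xi> \<in> carrier H"
  shows "(ip_norm H (\<pi> a \<xi>))\<^sup>2 = Re (ip H (\<pi> (star A a \<otimes>\<^bsub>A\<^esub> a) \<xi>) \<xi>)"
proof -
  interpret A: star_algebra A by fact
  have c: "\<pi> a \<xi> \<in> carrier H" "\<pi> (star A a) (\<pi> a \<xi>) \<in> carrier H" 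
    using rep_linear_operator[of a] rep_linear_operator[of "star A a"] assms A.star_closed
    by (auto simp: linear_operator_def Pi_iff)
  have "ip H (\<pi> (star A a \<otimes>\<^bsub>A\<^esub> a) \<xi>) \<xi> = ip H (\<pi> (star A a) (\<pi> a \<xi>)) \<xi>"
    using assms A.star_closed by (simp add: rep_mult)
  also have "\<dots> = ip H (\<pi> a \<xi>) (\<pi> a \<xi>)"
    using rep_star[of "star A a" "\<pi> a \<xi>" \<xi>] assms A.star_closed c by (simp add: A.star_star)
  finally show ?thesis using c by (simp add: ip_norm_sq)
qed

lemma seminormed_cstar_norm:
  fixes A :: "'a star_alg"
  assumes SA: "star_algebra A" and wd: "cstar_completion_well_defined A"
  shows "seminormed_star_algebra A (cstar_norm A)"
proof -
  interpret star_algebra A by fact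
  have nn: "0 \<le> cstar_norm A a" for a by (simp add: cstar_norm_def)
  have sm: "z \<odot>\<^bsub>A\<^esub> a \<in> carrier A" if "a \<in> carrier A" for z a
    using smult_closed that by simp
  note bound = cstar_norm_bound[OF wd]
  have smult_le: "cstar_norm A (z \<odot>\<^bsub>A\<^esub> a) \<le> cmod z * cstar_norm A a" if a: "a \<in> carrier A" for z a
  proof (rule cstar_norm_leI)
    fix H :: "(nat \<Rightarrow> complex \<times> 'a) inner_space" and \<pi> \<xi>
    assume rep: "bounded_representation A H \<pi>" and \<xi>: "\<xi> \<in> carrier H"
    interpret bounded_representation A H \<pi> by fact
    show "ip_norm H (\<pi> (z \<odot>\<^bsub>A\<^esub> a) \<xi>) \<le> cmod z * cstar_norm A a * ip_norm H \<xi>"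
      using bound[OF rep a \<xi>] a \<xi>
      by (simp add: rep_smult ip_norm_smult mult.assoc mult_left_mono)
  qed (use nn sm a in auto)
  show ?thesis
  proof (unfold_locales, goal_cases)
    case (1 a) show ?case by (rule nn)
  next
    case (2 a b)
    show ?case
    proof (rule cstar_norm_leI)
      fix H :: "(nat \<Rightarrow> complex \<times> 'a) inner_space" and \<pi> \<xi>
      assume rep: "bounded_representation A H \<pi>" and \<xi>: "\<xi> \<in> carrier H"
      interpret bounded_representation A H \<pi> by fact
      show "ip_norm H (\<pi> (a \<oplus>\<^bsub>A\<^esub> b) \<xi>) \<le> (cstar_norm A a + cstar_norm A b) * ip_norm H \<xi>"
        using bound[OF rep 2(1) \<xi>] bound[OF rep 2(2) \<xi>] 2 \<xi> ip_norm_triangle[of "\<pi> a \<xi>" "\<pi> b \<xi>"]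
        by (simp add: rep_add algebra_simps)
    qed (use nn 2 in \<open>auto intro: add_nonneg_nonneg\<close>)
  next
    case (3 a z)
    show ?case
    proof (cases "z = 0")
      case True
      then show ?thesis using smult_le[OF 3, of z] nn[of "z \<odot>\<^bsub>A\<^esub> a"] by simp
    next
      case False
      \<comment> \<open>Only \<open>\<le>\<close> is immediate from the representations; the
        opposite inequality is the same one applied to \<open>inverse z\<close>.\<close>
      have "a = inverse z \<odot>\<^bsub>A\<^esub> (z \<odot>\<^bsub>A\<^esub> a)"
        using smult_assoc1[of "inverse z" z a] smult_one[OF 3] 3 False by simp
      then have "cstar_norm A a \<le> cmod (inverse z) * cstar_norm A (z \<odot>\<^bsub>A\<^esub> a)"
        using smult_le[OF sm[OF 3], of "inverse z" z] by simp
      then have "cmod z * cstar_norm A a \<le> cstar_norm A (z \<odot>\<^bsub>A\<^esub> a)"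
        using False by (simp add: norm_inverse norm_divide field_simps)
      then show ?thesis using smult_le[OF 3, of z] by simp
    qed
  next
    case (4 a b)
    show ?case
    proof (rule cstar_norm_leI)
      fix H :: "(nat \<Rightarrow> complex \<times> 'a) inner_space" and \<pi> \<xi>
      assume rep: "bounded_representation A H \<pi>" and \<xi>: "\<xi> \<in> carrier H"
      interpret bounded_representation A H \<pi> by fact
      have "ip_norm H (\<pi> a (\<pi> b \<xi>)) \<le> cstar_norm A a * ip_norm H (\<pi> b \<xi>)"
        using bound[OF rep 4(1)] 4 \<xi> by simp
      also have "\<dots> \<le> cstar_norm A a * (cstar_norm A b * ip_norm H \<xi>)"
        using bound[OF rep 4(2) \<xi>] nn by (intro mult_left_mono)
      finally show "ip_norm H (\<pi> (a \<otimes>\<^bsub>A\<^esub> b) \<xi>) \<le> cstar_norm A a * cstar_norm A b * ip_norm H \<xi>"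
        using 4 \<xi> by (simp add: rep_mult mult.assoc)
    qed (use nn 4 mult_closed in auto)
  next
    case (5 a)
    show ?case
    proof (rule cstar_norm_leI)
      fix H :: "(nat \<Rightarrow> complex \<times> 'a) inner_space" and \<pi> \<xi>
      assume rep: "bounded_representation A H \<pi>" and \<xi>: "\<xi> \<in> carrier H"
      interpret bounded_representation A H \<pi> by fact
      \<comment> \<open>The square of \<open>?n\<close> is the value of a a^* at \<xi>, hence at
        most \<open>cstar_norm A a * ?n\<close> times the norm of \<xi>; one factor
        \<open>?n\<close> cancels.\<close>
      let ?n = "ip_norm H (\<pi> (star A a) \<xi>)"
      note sa = star_closed[OF 5]
      have c: "\<pi> (star A a) \<xi> \<in> carrier H" "\<pi> a (\<pi> (star A a) \<xi>) \<in> carrier H" using sa 5 \<xi> by auto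
      have "?n\<^sup>2 = Re (ip H (\<pi> a (\<pi> (star A a) \<xi>)) \<xi>)"
        using rep_norm_sq[OF SA sa \<xi>] 5 sa \<xi> by (simp add: star_star rep_mult)
      also have "\<dots> \<le> ip_norm H (\<pi> a (\<pi> (star A a) \<xi>)) * ip_norm H \<xi>"
        by (rule Re_ip_le[OF c(2) \<xi>])
      also have "\<dots> \<le> (cstar_norm A a * ?n) * ip_norm H \<xi>"
        using bound[OF rep 5 c(1)] \<xi> by (intro mult_right_mono) auto
      finally have "?n * ?n \<le> ?n * (cstar_norm A a * ip_norm H \<xi>)"
        by (simp add: power2_eq_square algebra_simps)
      then show "?n \<le> cstar_norm A a * ip_norm H \<xi>"
        using ip_norm_nonneg[OF c(1)] nn[of a] ip_norm_nonneg[OF \<xi>]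
        by (cases "?n = 0") (auto simp: mult_le_cancel_left)
    qed (use nn 5 star_closed in auto)
  qed
qed

section \<open>The convolution algebra of a groupoid\<close>

lemma has_sum_sum:
  fixes F :: "'i \<Rightarrow> 'a \<Rightarrow> 'b :: {topological_comm_monoid_add, t2_space}"
  assumes "finite S" "\<And>i. i \<in> S \<Longrightarrow> (F i has_sum c i) A"
  shows "((\<lambda>x. \<Sum>i\<in>S. F i x) has_sum (\<Sum>i\<in>S. c i)) A"
  using assms by (induction S rule: finite_induct) (auto intro: has_sum_add)

context groupoid
begin

abbreviation arr :: "'g set" where "arr \<equiv> topspace (arrows G)"
abbreviation r :: "'g \<Rightarrow> 'g" where "r \<equiv> grange G"
abbreviation s :: "'g \<Rightarrow> 'g" where "s \<equiv> gsource G"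
abbreviation iv :: "'g \<Rightarrow> 'g" where "iv \<equiv> ginv G"
abbreviation gm :: "'g \<Rightarrow> 'g \<Rightarrow> 'g" (infixl \<open>\<cdot>\<close> 70) where "g \<cdot> h \<equiv> gmult G g h"

section \<open>Groupoid arithmetic\<close>

lemma composable_eq: "(g, h) \<in> composable G \<longleftrightarrow> g \<in> arr \<and> h \<in> arr \<and> s g = r h"
  by (rule composable_iff[OF groupoid_axioms])

lemma iv_arr [simp]: "g \<in> arr \<Longrightarrow> iv g \<in> arr"
  by (rule ginv_closed)

lemma iv_iv [simp]: "g \<in> arr \<Longrightarrow> iv (iv g) = g"
  by (rule ginv_ginv)

lemma r_iv [simp]: "g \<in> arr \<Longrightarrow> r (iv g) = s g"
  and s_iv [simp]: "g \<in> arr \<Longrightarrow> s (iv g) = r g"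
  by (simp_all add: grange_def gsource_def)

lemma gm_arr [simp]: "\<lbrakk>g \<in> arr; h \<in> arr; s g = r h\<rbrakk> \<Longrightarrow> g \<cdot> h \<in> arr"
  using gmult_closed composable_eq by blast

lemma s_gm [simp]: "\<lbrakk>g \<in> arr; h \<in> arr; s g = r h\<rbrakk> \<Longrightarrow> s (g \<cdot> h) = s h"
  using gmult_assoc[of g h "iv h"] by (simp add: composable_eq)

lemma r_gm [simp]: "\<lbrakk>g \<in> arr; h \<in> arr; s g = r h\<rbrakk> \<Longrightarrow> r (g \<cdot> h) = r g"
  using gmult_assoc[of "iv g" g h] by (simp add: composable_eq)

lemma gm_assoc:
  "\<lbrakk>g \<in> arr; h \<in> arr; k \<in> arr; s g = r h; s h = r k\<rbrakk> \<Longrightarrow> (g \<cdot> h) \<cdot> k = g \<cdot> (h \<cdot> k)"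
  using gmult_assoc[of g h k] by (simp add: composable_eq)

lemma r_eq: "r g = g \<cdot> iv g" and s_eq: "s g = iv g \<cdot> g"
  by (simp_all add: grange_def gsource_def)

lemma r_arr [simp]: "g \<in> arr \<Longrightarrow> r g \<in> arr" and s_arr [simp]: "g \<in> arr \<Longrightarrow> s g \<in> arr"
  by (simp_all add: r_eq s_eq)

lemma rs_rs [simp]:
  assumes "g \<in> arr"
  shows "r (r g) = r g" "s (r g) = r g" "r (s g) = s g" "s (s g) = s g"
  using assms r_gm[of g "iv g"] s_gm[of g "iv g"] r_gm[of "iv g" g] s_gm[of "iv g" g]
  by (simp_all flip: r_eq s_eq)

lemma r_left [simp]: "g \<in> arr \<Longrightarrow> r g \<cdot> g = g"
  using gmult_ginv_cancel[of g "iv g"] by (simp add: composable_eq flip: r_eq)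

lemma s_right [simp]: "g \<in> arr \<Longrightarrow> g \<cdot> s g = g"
  using ginv_gmult_cancel[of "iv g" g] by (simp add: composable_eq flip: s_eq)

lemma gm_iv_cancel [simp]:
  assumes "g \<in> arr" "h \<in> arr"
  shows "s g = r h \<Longrightarrow> iv g \<cdot> (g \<cdot> h) = h" "r g = r h \<Longrightarrow> g \<cdot> (iv g \<cdot> h) = h"
    "s g = r h \<Longrightarrow> (g \<cdot> h) \<cdot> iv h = g" "s g = s h \<Longrightarrow> (g \<cdot> iv h) \<cdot> h = g"
  using assms ginv_gmult_cancel[of g h] ginv_gmult_cancel[of "iv g" h]
    gmult_ginv_cancel[of g h] gmult_ginv_cancel[of g "iv h"] by (simp_all add: composable_eq)

lemma units_iff: "x \<in> units G \<longleftrightarrow> x \<in> arr \<and> r x = x"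
  by (auto simp: units_def image_iff) metis

lemma unitsD:
  assumes "x \<in> units G"
  shows "x \<in> arr" "r x = x" "s x = x" "iv x = x" "x \<cdot> x = x"
proof -
  obtain g where g: "g \<in> arr" "x = r g" using assms by (auto simp: units_def)
  then show x: "x \<in> arr" "r x = x" "s x = x" by simp_all
  show "x \<cdot> x = x" using r_left[OF x(1)] x by simp
  have "r (iv x) \<cdot> iv x = iv x" using x by (simp only: r_left iv_arr)
  then show "iv x = x" using x r_eq[of x] by simp
qed

lemma r_units [simp]: "g \<in> arr \<Longrightarrow> r g \<in> units G" and s_units [simp]: "g \<in> arr \<Longrightarrow> s g \<in> units G"
  by (simp_all add: units_iff)

lemma iv_gm [simp]:
  assumes "g \<in> arr" "h \<in> arr" "s g = r h"
  shows "iv (g \<cdot> h) = iv h \<cdot> iv g"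
proof -
  have "(g \<cdot> h) \<cdot> (iv h \<cdot> iv g) = r g"
    using assms by (simp add: gm_assoc[of g h] flip: r_eq)
  moreover have "iv (g \<cdot> h) \<cdot> ((g \<cdot> h) \<cdot> (iv h \<cdot> iv g)) = iv h \<cdot> iv g"
    using assms by (intro gm_iv_cancel) simp_all
  ultimately show ?thesis using assms s_right[of "iv (g \<cdot> h)"] by simp
qed

section \<open>Fibres and convolution\<close>

lemma range_fibre_iff: "g \<in> range_fibre G x \<longleftrightarrow> g \<in> arr \<and> r g = x"
  by (simp add: range_fibre_def)

lemma bij_betw_translate:
  assumes "g \<in> arr"
  shows "bij_betw (\<lambda>h. g \<cdot> h) (range_fibre G (s g)) (range_fibre G (r g))"
  by (rule bij_betw_byWitness[where f' = "\<lambda>h. iv g \<cdot> h"])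
    (use assms in \<open>auto simp: range_fibre_iff\<close>)

text \<open>What the algebra laws retain of compact support: if the left factor has this property,
  every convolution sum is finite.\<close>

definition fibre_finite :: "('g \<Rightarrow> complex) \<Rightarrow> bool" where
  "fibre_finite f \<longleftrightarrow> (\<forall>x. finite {g \<in> range_fibre G x. f g \<noteq> 0})"

lemma summable_fibre:
  assumes "fibre_finite f" and "\<And>g. f g = 0 \<Longrightarrow> F g = 0"
  shows "F summable_on range_fibre G x"
proof -
  have fin: "finite {g \<in> range_fibre G x. f g \<noteq> 0}" using assms(1) by (simp add: fibre_finite_def)
  have "F summable_on {g \<in> range_fibre G x. f g \<noteq> 0}" using fin by simp
  moreover have "F summable_on range_fibre G x \<longleftrightarrow> F summable_on {g \<in> range_fibre G x. f g \<noteq> 0}"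
    by (rule summable_on_cong_neutral) (use assms(2) in auto)
  ultimately show ?thesis by simp
qed

lemma infsum_fibre:
  assumes "\<And>g. g \<in> range_fibre G x \<Longrightarrow> f g = 0 \<Longrightarrow> F g = 0" "finite {g \<in> range_fibre G x. f g \<noteq> 0}"
  shows "infsum F (range_fibre G x) = (\<Sum>g | g \<in> range_fibre G x \<and> f g \<noteq> 0. F g)"
proof -
  have "infsum F (range_fibre G x) = infsum F {g \<in> range_fibre G x. f g \<noteq> 0}"
    by (rule infsum_cong_neutral) (use assms in auto)
  then show ?thesis using assms(2) by simp
qed

lemma fibre_finite_add: "\<lbrakk>fibre_finite f; fibre_finite k\<rbrakk> \<Longrightarrow> fibre_finite (f + k)"
  unfolding fibre_finite_def
proof (intro allI)
  fix x assume *: "\<forall>x. finite {g \<in> range_fibre G x. f g \<noteq> 0}" "\<forall>x. finite {g \<in> range_fibre G x. k g \<noteq> 0}"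
  show "finite {g \<in> range_fibre G x. (f + k) g \<noteq> 0}"
    by (rule finite_subset[where B = "{g \<in> range_fibre G x. f g \<noteq> 0} \<union> {g \<in> range_fibre G x. k g \<noteq> 0}"])
      (use * in auto)
qed

lemma conv_add_left:
  assumes "fibre_finite f" "fibre_finite f'"
  shows "conv G (f + f') k = conv G f k + conv G f' k"
proof
  fix x
  have "(\<lambda>h. f h * k (iv h \<cdot> x)) summable_on range_fibre G (r x)"
    "(\<lambda>h. f' h * k (iv h \<cdot> x)) summable_on range_fibre G (r x)"
    by (rule summable_fibre[OF assms(1)], simp) (rule summable_fibre[OF assms(2)], simp)
  then show "conv G (f + f') k x = (conv G f k + conv G f' k) x"
    by (simp add: conv_def distrib_right infsum_add)
qed

lemma conv_add_right:
  assumes "fibre_finite f"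
  shows "conv G f (k + k') = conv G f k + conv G f k'"
  by (auto simp: conv_def fun_eq_iff distrib_left intro!: infsum_add summable_fibre[OF assms])

lemma conv_fscale_left: "conv G (fscale c f) k = fscale c (conv G f k)"
  by (simp add: conv_def fscale_def fun_eq_iff mult.assoc infsum_cmult_right')

lemma conv_fscale_right: "conv G f (fscale c k) = fscale c (conv G f k)"
  by (simp add: conv_def fscale_def fun_eq_iff mult.left_commute infsum_cmult_right')

text \<open>Left translation by \<open>h\<close> identifies the range fibre over \<open>s h\<close>
  with the one over \<open>r x\<close> and turns the inner sum into a convolution evaluated at
  \<open>iv h \<cdot> x\<close>. The two sums may be exchanged because one of them runs over the
  finite set \<open>S\<close>.\<close>

lemma conv_assoc:
  assumes f: "fibre_finite f" and g: "fibre_finite g"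
  shows "conv G (conv G f g) k = conv G f (conv G g k)"
proof
  fix x
  show "conv G (conv G f g) k x = conv G f (conv G g k) x"
  proof (cases "x \<in> arr")
    case x: True
    define S where "S = {h \<in> range_fibre G (r x). f h \<noteq> 0}"
    have S: "finite S" using f by (simp add: S_def fibre_finite_def)
    have SD: "h \<in> arr \<and> r h = r x" if "h \<in> S" for h using that by (simp add: S_def range_fibre_iff)
    have conv_f: "conv G f u m = (\<Sum>h\<in>S. f h * u (iv h \<cdot> m))" if "m \<in> arr" "r m = r x" for u m
    proof -
      have "conv G f u m = (\<Sum>\<^sub>\<infinity>h\<in>range_fibre G (r x). f h * u (iv h \<cdot> m))"
        using that by (simp add: conv_def)
      also have "\<dots> = (\<Sum>h\<in>S. f h * u (iv h \<cdot> m))"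
        using S unfolding S_def by (intro infsum_fibre) auto
      finally show ?thesis .
    qed
    have shift: "(\<Sum>\<^sub>\<infinity>m\<in>range_fibre G (r x). g (iv h \<cdot> m) * k (iv m \<cdot> x)) = conv G g k (iv h \<cdot> x)"
      and summable: "(\<lambda>m. g (iv h \<cdot> m) * k (iv m \<cdot> x)) summable_on range_fibre G (r x)"
      if h: "h \<in> S" for h
    proof -
      have h': "h \<in> arr" "r h = r x" using SD[OF h] by auto
      have bij: "bij_betw (\<lambda>l. h \<cdot> l) (range_fibre G (s h)) (range_fibre G (r x))"
        using bij_betw_translate[OF h'(1)] h' by simp
      have eq: "g (iv h \<cdot> (h \<cdot> l)) * k (iv (h \<cdot> l) \<cdot> x) = g l * k (iv l \<cdot> (iv h \<cdot> x))"
        if "l \<in> range_fibre G (s h)" for l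
        using that h' x by (simp add: range_fibre_iff gm_assoc)
      have "(\<Sum>\<^sub>\<infinity>m\<in>range_fibre G (r x). g (iv h \<cdot> m) * k (iv m \<cdot> x)) =
          (\<Sum>\<^sub>\<infinity>l\<in>range_fibre G (s h). g (iv h \<cdot> (h \<cdot> l)) * k (iv (h \<cdot> l) \<cdot> x))"
        by (rule infsum_reindex_bij_betw[OF bij, symmetric])
      also have "\<dots> = (\<Sum>\<^sub>\<infinity>l\<in>range_fibre G (s h). g l * k (iv l \<cdot> (iv h \<cdot> x)))"
        by (rule infsum_cong) (rule eq)
      also have "\<dots> = conv G g k (iv h \<cdot> x)" using h' x by (simp add: conv_def)
      finally show "(\<Sum>\<^sub>\<infinity>m\<in>range_fibre G (r x). g (iv h \<cdot> m) * k (iv m \<cdot> x)) = conv G g k (iv h \<cdot> x)" .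
      have "(\<lambda>l. g l * k (iv l \<cdot> (iv h \<cdot> x))) summable_on range_fibre G (s h)"
        by (rule summable_fibre[OF g]) simp
      then have "(\<lambda>l. g (iv h \<cdot> (h \<cdot> l)) * k (iv (h \<cdot> l) \<cdot> x)) summable_on range_fibre G (s h)"
        using summable_on_cong[of "range_fibre G (s h)"] eq by (metis (no_types, lifting))
      then show "(\<lambda>m. g (iv h \<cdot> m) * k (iv m \<cdot> x)) summable_on range_fibre G (r x)"
        using summable_on_reindex_bij_betw[OF bij, of "\<lambda>m. g (iv h \<cdot> m) * k (iv m \<cdot> x)"] by simp
    qed
    have "conv G (conv G f g) k x =
        (\<Sum>\<^sub>\<infinity>m\<in>range_fibre G (r x). (\<Sum>h\<in>S. f h * (g (iv h \<cdot> m) * k (iv m \<cdot> x))))"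
      using x by (auto simp: conv_def[of G _ k] range_fibre_iff conv_f sum_distrib_right mult.assoc intro!: infsum_cong)
    also have "\<dots> = (\<Sum>h\<in>S. \<Sum>\<^sub>\<infinity>m\<in>range_fibre G (r x). f h * (g (iv h \<cdot> m) * k (iv m \<cdot> x)))"
      by (rule infsumI, rule has_sum_sum[OF S], rule has_sum_infsum, rule summable_on_cmult_right, rule summable)
    also have "\<dots> = (\<Sum>h\<in>S. f h * conv G g k (iv h \<cdot> x))"
      by (rule sum.cong) (simp_all add: infsum_cmult_right' shift)
    also have "\<dots> = conv G f (conv G g k) x" using conv_f[of x] x by simp
    finally show ?thesis .
  qed (simp add: conv_def)
qed

text \<open>The substitution \<open>h = iv x \<cdot> l\<close> moves the sum from the range fibre
  over \<open>s x\<close> to the one over \<open>r x\<close> and swaps the two factors.\<close>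

lemma fstar_conv: "fstar G (conv G f g) = conv G (fstar G g) (fstar G f)"
proof
  fix x
  show "fstar G (conv G f g) x = conv G (fstar G g) (fstar G f) x"
  proof (cases "x \<in> arr")
    case x: True
    have bij: "bij_betw (\<lambda>l. iv x \<cdot> l) (range_fibre G (r x)) (range_fibre G (s x))"
      using bij_betw_translate[of "iv x"] x by simp
    have "fstar G (conv G f g) x = (\<Sum>\<^sub>\<infinity>h\<in>range_fibre G (s x). cnj (f h * g (iv h \<cdot> iv x)))"
      using x by (simp add: fstar_def conv_def flip: infsum_cnj)
    also have "\<dots> = (\<Sum>\<^sub>\<infinity>l\<in>range_fibre G (r x). cnj (f (iv x \<cdot> l) * g (iv (iv x \<cdot> l) \<cdot> iv x)))"
      by (rule infsum_reindex_bij_betw[OF bij, symmetric])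
    also have "\<dots> = (\<Sum>\<^sub>\<infinity>l\<in>range_fibre G (r x). fstar G g l * fstar G f (iv l \<cdot> x))"
      by (rule infsum_cong) (use x in \<open>auto simp: range_fibre_iff fstar_def\<close>)
    also have "\<dots> = conv G (fstar G g) (fstar G f) x" using x by (simp add: conv_def)
    finally show ?thesis .
  qed (simp add: fstar_def conv_def)
qed

lemma function_alg_simps [simp]:
  "carrier (function_alg G F) = F" "add (function_alg G F) = (+)" "zero (function_alg G F) = 0"
  "mult (function_alg G F) = conv G" "smult (function_alg G F) = fscale" "star (function_alg G F) = fstar G"
  by (simp_all add: function_alg_def)

text \<open>Serves \<open>Cc G\<close> and \<open>steinberg G\<close> alike. Vanishing off the
  arrows makes \<open>fstar\<close> an involution, since \<open>fstar\<close> erases values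
  there.\<close>

lemma star_algebra_function_alg:
  assumes zero: "0 \<in> F" and add: "\<And>f g. \<lbrakk>f \<in> F; g \<in> F\<rbrakk> \<Longrightarrow> f + g \<in> F"
    and scale: "\<And>c f. f \<in> F \<Longrightarrow> fscale c f \<in> F"
    and conv: "\<And>f g. \<lbrakk>f \<in> F; g \<in> F\<rbrakk> \<Longrightarrow> conv G f g \<in> F"
    and star: "\<And>f. f \<in> F \<Longrightarrow> fstar G f \<in> F"
    and fin: "\<And>f. f \<in> F \<Longrightarrow> fibre_finite f"
    and supp: "\<And>f g. \<lbrakk>f \<in> F; g \<notin> arr\<rbrakk> \<Longrightarrow> f g = 0"
  shows "star_algebra (function_alg G F)"
proof -
  have "\<exists>y\<in>F. y + x = 0" if "x \<in> F" for x
    using scale[OF that, of "-1"] by (intro bexI[of _ "fscale (-1) x"]) (auto simp: fscale_def fun_eq_iff)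
  then have "abelian_group (function_alg G F)"
    by (intro abelian_groupI) (auto simp: zero add algebra_simps)
  then have mod: "module complex_ring (function_alg G F)"
    by (rule moduleI[OF cring_complex_ring]) (auto simp: scale, auto simp: fscale_def fun_eq_iff algebra_simps)
  show ?thesis
  proof (rule star_algebra.intro[OF mod], unfold_locales, simp_all add: conv star)
    show "conv G (conv G a b) c = conv G a (conv G b c)" if "a \<in> F" "b \<in> F" for a b c
      using that by (simp add: conv_assoc fin)
    show "conv G a (b + c) = conv G a b + conv G a c" if "a \<in> F" for a b c
      using that by (simp add: conv_add_right fin)
    show "conv G (a + b) c = conv G a c + conv G b c" if "a \<in> F" "b \<in> F" for a b c
      using that by (simp add: conv_add_left fin)
    show "fstar G (fstar G a) = a" if "a \<in> F" for a
      using that supp by (auto simp: fstar_def fun_eq_iff)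
  qed (auto simp: conv_fscale_left conv_fscale_right fstar_conv, auto simp: fstar_def fscale_def fun_eq_iff)
qed

end

section \<open>Compact open bisections\<close>

lemma local_homeomorphism_imp_continuous_map:
  assumes "local_homeomorphism X Y f"
  shows "continuous_map X Y f"
proof -
  have "\<forall>x\<in>topspace X. \<exists>U. openin X U \<and> x \<in> U \<and> continuous_map (subtopology X U) Y f"
    using assms unfolding local_homeomorphism_def
    by (meson continuous_map_in_subtopology homeomorphic_imp_continuous_map)
  from bchoice[OF this] obtain U where U: "\<forall>x\<in>topspace X. openin X (U x) \<and> x \<in> U x \<and>
      continuous_map (subtopology X (U x)) Y f" ..
  show ?thesis
  proof (rule pasting_lemma[where I = "topspace X" and T = U and f = "\<lambda>_. f"])
    fix x assume "x \<in> topspace X"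
    then show "\<exists>j. j \<in> topspace X \<and> x \<in> U j \<and> f x = f x" using U by blast
  qed (use U in simp_all)
qed

lemma local_homeomorphism_imp_open_map:
  assumes "local_homeomorphism X Y f"
  shows "open_map X Y f"
  unfolding open_map_def
proof (intro allI impI)
  fix V assume V: "openin X V"
  show "openin Y (f ` V)"
  proof (subst openin_subopen, intro ballI)
    fix y assume "y \<in> f ` V"
    then obtain x where x: "x \<in> V" "y = f x" by auto
    then have "x \<in> topspace X" using V openin_subset by blast
    then obtain U where U: "openin X U" "x \<in> U" "openin Y (f ` U)"
        "homeomorphic_map (subtopology X U) (subtopology Y (f ` U)) f"
      using assms unfolding local_homeomorphism_def by blast
    have "openin (subtopology X U) (U \<inter> V)" using V by (simp add: openin_subtopology_Int2)
    then have "openin (subtopology Y (f ` U)) (f ` (U \<inter> V))"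
      using homeomorphic_imp_open_map[OF U(4)] by (simp add: open_map_def)
    then have "openin Y (f ` (U \<inter> V))" using U(3) by (rule openin_trans_full)
    then show "\<exists>T. openin Y T \<and> y \<in> T \<and> T \<subseteq> f ` V" using x U(2) by blast
  qed
qed

lemma homeomorphic_map_restrict_open:
  assumes "continuous_map X Y f" "open_map X Y f" "openin X W" "inj_on f W"
  shows "homeomorphic_map (subtopology X W) (subtopology Y (f ` W)) f"
proof (rule bijective_open_imp_homeomorphic_map)
  have W: "W \<subseteq> topspace X" using assms(3) by (rule openin_subset)
  show "continuous_map (subtopology X W) (subtopology Y (f ` W)) f"
    by (rule continuous_map_into_subtopology[OF continuous_map_from_subtopology[OF assms(1)]]) auto
  show "open_map (subtopology X W) (subtopology Y (f ` W)) f"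
    by (rule open_map_into_subtopology[OF open_map_from_subtopology[OF assms(2,3)]]) auto
  have "f ` W \<subseteq> topspace Y"
    using W continuous_map_image_subset_topspace[OF assms(1)] by blast
  then show "f ` topspace (subtopology X W) = topspace (subtopology Y (f ` W))" using W by auto
  show "inj_on f (topspace (subtopology X W))" using assms(4) W by (simp add: Int_absorb1)
qed

context lc_etale_groupoid
begin

lemma topspace_unit_space [simp]: "topspace (unit_space G) = units G"
  by (auto simp: unit_space_def units_iff)

lemma continuous_r: "continuous_map (arrows G) (unit_space G) r"
  and continuous_s: "continuous_map (arrows G) (unit_space G) s"
  and open_map_r: "open_map (arrows G) (unit_space G) r"
  and open_map_s: "open_map (arrows G) (unit_space G) s"
  using local_homeo_range local_homeo_source local_homeomorphism_imp_continuous_map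
    local_homeomorphism_imp_open_map by blast+

lemma continuous_r': "continuous_map (arrows G) (arrows G) r"
  and continuous_s': "continuous_map (arrows G) (arrows G) s"
  using continuous_r continuous_s by (auto simp: unit_space_def continuous_map_in_subtopology)

text \<open>Let \<open>r\<close> be injective on the open set \<open>U\<close> around a unit. If
  \<open>g\<close> and \<open>r g\<close> both lie in \<open>U\<close>, they have the same range and
  so coincide; hence the open set of all such \<open>g\<close> consists of units.\<close>

lemma openin_units: "openin (arrows G) (units G)"
proof (subst openin_subopen, intro ballI)
  fix u assume u: "u \<in> units G"
  then have "u \<in> arr" by (rule unitsD)
  then obtain U where U: "openin (arrows G) U" "u \<in> U"
      "homeomorphic_map (subtopology (arrows G) U) (subtopology (unit_space G) (r ` U)) r"
    using local_homeo_range unfolding local_homeomorphism_def by blast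
  have Uarr: "U \<subseteq> arr" using U(1) by (rule openin_subset)
  have inj: "inj_on r U"
    using homeomorphic_imp_injective_map[OF U(3)] Uarr by (simp add: Int_absorb1)
  have "openin (arrows G) {g \<in> U. r g \<in> U}"
    by (rule openin_continuous_map_preimage_gen[OF continuous_r' U(1) U(1)])
  moreover have "g \<in> units G" if "g \<in> U" "r g \<in> U" for g
  proof -
    have "r g = g" using inj_onD[OF inj, of "r g" g] that Uarr by auto
    then show ?thesis using that Uarr by (auto simp: units_iff)
  qed
  ultimately show "\<exists>T. openin (arrows G) T \<and> u \<in> T \<and> T \<subseteq> units G"
    using U(2) unitsD(2)[OF u] by (intro exI[of _ "{g \<in> U. r g \<in> U}"]) auto
qed

lemma openin_unit_space: "openin (unit_space G) V \<longleftrightarrow> openin (arrows G) V \<and> V \<subseteq> units G"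
  unfolding unit_space_def by (rule openin_open_subtopology[OF openin_units])

lemma compactin_unit_space: "compactin (unit_space G) K \<longleftrightarrow> compactin (arrows G) K \<and> K \<subseteq> units G"
  unfolding unit_space_def by (rule compactin_subtopology)

text \<open>In a non-Hausdorff space such sets may fail to be closed and their intersections may
  fail to be compact. This is why differences are formed inside a common Hausdorff subspace.\<close>

definition copen :: "'a set \<Rightarrow> bool" where
  "copen V \<longleftrightarrow> openin (arrows G) V \<and> compactin (arrows G) V"

lemma copenD: "copen V \<Longrightarrow> openin (arrows G) V" "copen V \<Longrightarrow> compactin (arrows G) V"
    "copen V \<Longrightarrow> V \<subseteq> arr"
  by (auto simp: copen_def openin_subset)

lemma copen_empty [simp]: "copen {}"
  by (simp add: copen_def)

lemma copen_Un: "\<lbrakk>copen V; copen W\<rbrakk> \<Longrightarrow> copen (V \<union> W)"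
  by (simp add: copen_def openin_Un compactin_Un)

lemma bisection_units: "bisection G (units G)"
  by (auto simp: bisection_def inj_on_def unitsD)

lemma bisection_mono: "\<lbrakk>bisection G B; W \<subseteq> B\<rbrakk> \<Longrightarrow> bisection G W"
  by (auto simp: bisection_def intro: inj_on_subset)

lemma Hausdorff_bisection: "bisection G B \<Longrightarrow> Hausdorff_space (subtopology (arrows G) B)"
  using Hausdorff_space_injective_preimage[of "unit_space G" "subtopology (arrows G) B" r]
    continuous_map_from_subtopology[OF continuous_r, of B] Hausdorff_unit_space
  by (simp add: bisection_def Int_absorb1)

lemma copen_closedin:
  assumes "Hausdorff_space (subtopology (arrows G) B)" "copen V" "V \<subseteq> B"
  shows "closedin (subtopology (arrows G) B) V"
  by (rule compactin_imp_closedin) (use assms in \<open>auto simp: compactin_subtopology copenD\<close>)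

text \<open>\<open>W\<close> is compact, hence closed in the Hausdorff space \<open>B\<close>. So
  \<open>V \<inter> W\<close> is clopen in the compact space \<open>V\<close>, and so is its
  complement there.\<close>

lemma copen_Diff:
  assumes H: "Hausdorff_space (subtopology (arrows G) B)" and V: "copen V" "V \<subseteq> B" and W: "copen W" "W \<subseteq> B"
  shows "copen (V - W)"
  unfolding copen_def
proof
  let ?S = "subtopology (arrows G) V"
  have "Hausdorff_space ?S"
    using Hausdorff_space_subtopology[OF H, of V] V(2) by (simp add: subtopology_subtopology Int_absorb1)
  moreover have VW: "closedin (subtopology (arrows G) B) W" by (rule copen_closedin[OF H W])
  ultimately have cl: "closedin ?S (V \<inter> W)"
    using V(2) by (metis closedin_subtopology_Int_subset inf.absorb_iff2 W(2))
  then have "openin ?S (topspace ?S - (V \<inter> W))" by blast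
  moreover have "topspace ?S - (V \<inter> W) = V - W" using copenD(3)[OF V(1)] by auto
  ultimately show "openin (arrows G) (V - W)"
    using copenD(1)[OF V(1)] openin_trans_full by metis
  have "openin ?S (V \<inter> W)" using copenD(1)[OF W(1)] by (simp add: openin_subtopology_Int2)
  then have "closedin ?S (topspace ?S - (V \<inter> W))" by blast
  then have "closedin ?S (V - W)" using \<open>topspace ?S - (V \<inter> W) = V - W\<close> by simp
  moreover have "compact_space ?S" using copenD(2)[OF V(1)] by (rule compact_space_subtopology)
  ultimately have "compactin ?S (V - W)" by (simp add: closedin_compact_space)
  then show "compactin (arrows G) (V - W)" by (simp add: compactin_subtopology)
qed

definition cobis :: "'a set \<Rightarrow> bool" where
  "cobis W \<longleftrightarrow> copen W \<and> bisection G W"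

lemma cobisD: 
  assumes "cobis W"
  shows "copen W" "bisection G W" "openin (arrows G) W" "compactin (arrows G) W" "W \<subseteq> arr"
    "inj_on r W" "inj_on s W" "Hausdorff_space (subtopology (arrows G) W)"
  using assms copenD Hausdorff_bisection by (auto simp: cobis_def bisection_def)

lemma cobis_empty [simp]: "cobis {}"
  by (simp add: cobis_def bisection_def)

lemma cobis_subset: "\<lbrakk>cobis W; copen V; V \<subseteq> W\<rbrakk> \<Longrightarrow> cobis V"
  by (auto simp: cobis_def intro: bisection_mono)

lemma cobis_Diff: "\<lbrakk>cobis W; copen V; V \<subseteq> W\<rbrakk> \<Longrightarrow> cobis (W - V)"
  by (rule cobis_subset, assumption, rule copen_Diff[of W]) (auto simp: cobisD)

lemma cobis_units: "\<lbrakk>copen K; K \<subseteq> units G\<rbrakk> \<Longrightarrow> cobis K"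
  by (auto simp: cobis_def intro: bisection_mono[OF bisection_units])

lemma copen_image:
  assumes V: "copen V"
  shows "copen (r ` V)" "copen (s ` V)" "r ` V \<subseteq> units G" "s ` V \<subseteq> units G"
proof -
  show "copen (r ` V)" "copen (s ` V)"
    using open_map_r open_map_s copenD[OF V] image_compactin[OF _ continuous_r'] image_compactin[OF _ continuous_s']
    by (auto simp: copen_def open_map_def openin_unit_space)
  show "r ` V \<subseteq> units G" "s ` V \<subseteq> units G" using copenD(3)[OF V] by auto
qed

text \<open>\<open>K\<close> is compact, hence closed in the Hausdorff unit space, so its preimage
  in the compact set \<open>W\<close> is both open and closed.\<close>

lemma copen_restrict:
  assumes W: "copen W" and H: "Hausdorff_space (subtopology (arrows G) W)" and K: "copen K" "K \<subseteq> units G"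
    and f: "continuous_map (arrows G) (unit_space G) f"
  shows "copen {g \<in> W. f g \<in> K}"
proof -
  have Ko: "openin (unit_space G) K" using K by (simp add: openin_unit_space copenD)
  have o: "openin (arrows G) {g \<in> W. f g \<in> K}"
    by (rule openin_continuous_map_preimage_gen[OF f copenD(1)[OF W] Ko])
  have "closedin (unit_space G) K"
    using Hausdorff_unit_space K by (intro compactin_imp_closedin) (auto simp: compactin_unit_space copenD)
  then have "closedin (subtopology (arrows G) W) {x \<in> topspace (subtopology (arrows G) W). f x \<in> K}"
    by (intro closedin_continuous_map_preimage[OF continuous_map_from_subtopology[OF f]])
  moreover have "{x \<in> topspace (subtopology (arrows G) W). f x \<in> K} = {g \<in> W. f g \<in> K}"
    using copenD(3)[OF W] by auto
  ultimately have "compactin (subtopology (arrows G) W) {g \<in> W. f g \<in> K}"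
    using compact_space_subtopology[OF copenD(2)[OF W]] by (metis closedin_compact_space)
  then show ?thesis using o by (simp add: copen_def compactin_subtopology)
qed

lemma bisection_section:
  assumes W: "openin (arrows G) W" and inj: "inj_on f W"
    and f: "continuous_map (arrows G) (unit_space G) f" "open_map (arrows G) (unit_space G) f"
  obtains \<sigma> where "continuous_map (subtopology (unit_space G) (f ` W)) (arrows G) \<sigma>"
    "\<And>g. g \<in> W \<Longrightarrow> \<sigma> (f g) = g"
proof -
  have Warr: "W \<subseteq> arr" using W by (rule openin_subset)
  obtain \<sigma> where "homeomorphic_maps (subtopology (arrows G) W) (subtopology (unit_space G) (f ` W)) f \<sigma>"
    using homeomorphic_map_restrict_open[OF f W inj] homeomorphic_map_maps by blast
  then show thesis
    using that[of \<sigma>] Warr by (auto simp: homeomorphic_maps_def continuous_map_in_subtopology)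
qed

lemma continuous_map_gm:
  assumes "continuous_map X (arrows G) a" "continuous_map X (arrows G) b"
    and "\<And>x. x \<in> topspace X \<Longrightarrow> s (a x) = r (b x)"
  shows "continuous_map X (arrows G) (\<lambda>x. a x \<cdot> b x)"
proof -
  have "continuous_map X (subtopology (prod_topology (arrows G) (arrows G)) (composable G)) (\<lambda>x. (a x, b x))"
    using assms continuous_map_image_subset_topspace[OF assms(1)] continuous_map_image_subset_topspace[OF assms(2)]
    by (simp add: continuous_map_in_subtopology continuous_map_paired composable_eq Pi_iff image_subset_iff)
  from continuous_map_compose[OF this continuous_gmult] show ?thesis by (simp add: o_def)
qed

text \<open>\<open>\<sigma> k\<close> is the arrow of \<open>W\<close> that has the range of
  \<open>k\<close>, so \<open>iv (\<sigma> k) \<cdot> k\<close> is what remains of \<open>k\<close>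
  after division by \<open>W\<close>. Its continuity makes products of bisections open and
  convolutions continuous.\<close>

lemma continuous_quotient:
  assumes W: "openin (arrows G) W" "bisection G W"
  obtains \<sigma> where
    "openin (arrows G) {k \<in> arr. r k \<in> r ` W}"
    "continuous_map (subtopology (arrows G) {k \<in> arr. r k \<in> r ` W}) (arrows G) \<sigma>"
    "continuous_map (subtopology (arrows G) {k \<in> arr. r k \<in> r ` W}) (arrows G) (\<lambda>k. iv (\<sigma> k) \<cdot> k)"
    "\<And>g k. \<lbrakk>g \<in> W; r k = r g\<rbrakk> \<Longrightarrow> \<sigma> k = g"
proof -
  let ?D = "{k \<in> arr. r k \<in> r ` W}"
  have Warr: "W \<subseteq> arr" and inj: "inj_on r W" using W by (auto simp: bisection_def)
  obtain \<tau> where \<tau>: "continuous_map (subtopology (unit_space G) (r ` W)) (arrows G) \<tau>"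
      "\<And>g. g \<in> W \<Longrightarrow> \<tau> (r g) = g"
    using bisection_section[OF W(1) inj continuous_r open_map_r] by blast
  have D: "openin (arrows G) ?D"
    using openin_continuous_map_preimage[OF continuous_r, of "r ` W"] open_map_r W(1)
    by (simp add: open_map_def)
  have "continuous_map (subtopology (arrows G) ?D) (subtopology (unit_space G) (r ` W)) r"
    by (rule continuous_map_into_subtopology[OF continuous_map_from_subtopology[OF continuous_r]]) auto
  from continuous_map_compose[OF this \<tau>(1)]
  have c: "continuous_map (subtopology (arrows G) ?D) (arrows G) (\<lambda>k. \<tau> (r k))" by (simp add: o_def)
  have "continuous_map (subtopology (arrows G) ?D) (arrows G) (\<lambda>k. iv (\<tau> (r k)) \<cdot> k)"
  proof (rule continuous_map_gm)
    show "continuous_map (subtopology (arrows G) ?D) (arrows G) (\<lambda>k. iv (\<tau> (r k)))"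
      using continuous_map_compose[OF c continuous_ginv] by (simp add: o_def)
    show "continuous_map (subtopology (arrows G) ?D) (arrows G) (\<lambda>k. k)"
      using continuous_map_from_subtopology[OF continuous_map_id] by (simp add: id_def)
    show "s (iv (\<tau> (r k))) = r k" if "k \<in> topspace (subtopology (arrows G) ?D)" for k
      using that \<tau>(2) Warr by auto
  qed
  with c D show thesis using that[of "\<lambda>k. \<tau> (r k)"] \<tau>(2) by simp
qed

section \<open>Products and inverses of bisections\<close>

definition bprod :: "'a set \<Rightarrow> 'a set \<Rightarrow> 'a set" where
  "bprod V W = {g \<cdot> h | g h. g \<in> V \<and> h \<in> W \<and> s g = r h}"

text \<open>The product is open as the set where the quotient by \<open>V\<close> lies in
  \<open>W\<close>. It is compact as the image of those arrows of \<open>V\<close> whose source is a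
  range of \<open>W\<close>, under right multiplication by the matching arrow of
  \<open>W\<close>.\<close>

lemma cobis_bprod:
  assumes V: "cobis V" and W: "cobis W"
  shows "cobis (bprod V W)"
proof -
  note cV = cobisD[OF V] and cW = cobisD[OF W]
  have sub: "bprod V W \<subseteq> arr" using cV(5) cW(5) by (auto simp: bprod_def subset_iff)
  have "inj_on r (bprod V W)"
  proof (rule inj_onI)
    fix x y assume "x \<in> bprod V W" "y \<in> bprod V W" and eq: "r x = r y"
    then obtain g h g' h' where *: "x = g \<cdot> h" "y = g' \<cdot> h'" "g \<in> V" "h \<in> W" "g' \<in> V" "h' \<in> W"
      "s g = r h" "s g' = r h'" by (auto simp: bprod_def)
    then have a: "g \<in> arr" "h \<in> arr" "g' \<in> arr" "h' \<in> arr" using cV(5) cW(5) by auto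
    then have "r g = r g'" using * eq by (metis r_gm)
    then have "g = g'" by (rule inj_onD[OF cV(6) _ *(3,5)])
    then have "h = h'" using *(7,8) by (intro inj_onD[OF cW(6) _ *(4,6)]) metis
    with \<open>g = g'\<close> * show "x = y" by simp
  qed
  moreover have "inj_on s (bprod V W)"
  proof (rule inj_onI)
    fix x y assume "x \<in> bprod V W" "y \<in> bprod V W" and eq: "s x = s y"
    then obtain g h g' h' where *: "x = g \<cdot> h" "y = g' \<cdot> h'" "g \<in> V" "h \<in> W" "g' \<in> V" "h' \<in> W"
      "s g = r h" "s g' = r h'" by (auto simp: bprod_def)
    then have a: "g \<in> arr" "h \<in> arr" "g' \<in> arr" "h' \<in> arr" using cV(5) cW(5) by auto
    then have "s h = s h'" using * eq by (metis s_gm)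
    then have "h = h'" by (rule inj_onD[OF cW(7) _ *(4,6)])
    then have "g = g'" using *(7,8) by (intro inj_onD[OF cV(7) _ *(3,5)]) metis
    with \<open>h = h'\<close> * show "x = y" by simp
  qed
  ultimately have bis: "bisection G (bprod V W)" using sub by (simp add: bisection_def)
  obtain \<sigma> where \<sigma>: "openin (arrows G) {k \<in> arr. r k \<in> r ` V}"
    "continuous_map (subtopology (arrows G) {k \<in> arr. r k \<in> r ` V}) (arrows G) \<sigma>"
    "continuous_map (subtopology (arrows G) {k \<in> arr. r k \<in> r ` V}) (arrows G) (\<lambda>k. iv (\<sigma> k) \<cdot> k)"
    "\<And>g k. \<lbrakk>g \<in> V; r k = r g\<rbrakk> \<Longrightarrow> \<sigma> k = g"
    using continuous_quotient[OF cV(3,2)] by blast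
  note \<sigma> = \<sigma>(1,3,4)
  let ?D = "{k \<in> arr. r k \<in> r ` V}"
  have "openin (arrows G) (bprod V W)"
  proof -
    have "openin (subtopology (arrows G) ?D) {k \<in> topspace (subtopology (arrows G) ?D). iv (\<sigma> k) \<cdot> k \<in> W}"
      by (rule openin_continuous_map_preimage[OF \<sigma>(2) cW(3)])
    then have "openin (arrows G) {k \<in> topspace (subtopology (arrows G) ?D). iv (\<sigma> k) \<cdot> k \<in> W}"
      using \<sigma>(1) by (rule openin_trans_full)
    also have "{k \<in> topspace (subtopology (arrows G) ?D). iv (\<sigma> k) \<cdot> k \<in> W} = bprod V W"
    proof (intro equalityI subsetI)
      fix k assume "k \<in> {k \<in> topspace (subtopology (arrows G) ?D). iv (\<sigma> k) \<cdot> k \<in> W}"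
      then obtain g where g: "k \<in> arr" "g \<in> V" "r k = r g" "iv (\<sigma> k) \<cdot> k \<in> W" by auto
      then have "iv g \<cdot> k \<in> W" "g \<in> arr" using \<sigma>(3)[of g k] cV(5) by auto
      moreover have "k = g \<cdot> (iv g \<cdot> k)" "s g = r (iv g \<cdot> k)" using g \<open>g \<in> arr\<close> by simp_all
      ultimately show "k \<in> bprod V W" using g(2) unfolding bprod_def by blast
    next
      fix k assume "k \<in> bprod V W"
      then obtain g h where k: "k = g \<cdot> h" "g \<in> V" "h \<in> W" "s g = r h" by (auto simp: bprod_def)
      then have "g \<in> arr" "h \<in> arr" using cV(5) cW(5) by auto
      then show "k \<in> {k \<in> topspace (subtopology (arrows G) ?D). iv (\<sigma> k) \<cdot> k \<in> W}"
        using k \<sigma>(3)[of g k] by auto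
    qed
    finally show ?thesis .
  qed
  moreover have "compactin (arrows G) (bprod V W)"
  proof -
    obtain \<tau> where \<tau>: "continuous_map (subtopology (unit_space G) (r ` W)) (arrows G) \<tau>"
        "\<And>g. g \<in> W \<Longrightarrow> \<tau> (r g) = g"
      using bisection_section[OF cW(3) cW(6) continuous_r open_map_r] by blast
    let ?V = "{g \<in> V. s g \<in> r ` W}"
    have "copen ?V"
      by (rule copen_restrict[OF cV(1,8) copen_image(1,3)[OF cW(1)] continuous_s])
    then have comp: "compactin (subtopology (arrows G) ?V) ?V"
      by (simp add: compactin_subtopology copenD)
    have "continuous_map (subtopology (arrows G) ?V) (subtopology (unit_space G) (r ` W)) s"
      by (rule continuous_map_into_subtopology[OF continuous_map_from_subtopology[OF continuous_s]]) auto
    from continuous_map_compose[OF this \<tau>(1)]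
    have c: "continuous_map (subtopology (arrows G) ?V) (arrows G) (\<lambda>k. \<tau> (s k))" by (simp add: o_def)
    have "continuous_map (subtopology (arrows G) ?V) (arrows G) (\<lambda>g. g \<cdot> \<tau> (s g))"
    proof (rule continuous_map_gm[OF _ c])
      show "continuous_map (subtopology (arrows G) ?V) (arrows G) (\<lambda>k. k)"
        using continuous_map_from_subtopology[OF continuous_map_id] by (simp add: id_def)
      show "s g = r (\<tau> (s g))" if "g \<in> topspace (subtopology (arrows G) ?V)" for g
        using that \<tau>(2) by auto
    qed
    from image_compactin[OF comp this] have "compactin (arrows G) ((\<lambda>g. g \<cdot> \<tau> (s g)) ` ?V)" .
    also have "(\<lambda>g. g \<cdot> \<tau> (s g)) ` ?V = bprod V W"
    proof (intro equalityI subsetI)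
      fix k assume "k \<in> (\<lambda>g. g \<cdot> \<tau> (s g)) ` ?V"
      then obtain g h where "g \<in> V" "h \<in> W" "s g = r h" "k = g \<cdot> \<tau> (s g)" by auto
      then show "k \<in> bprod V W" using \<tau>(2)[of h] by (auto simp: bprod_def)
    next
      fix k assume "k \<in> bprod V W"
      then obtain g h where k: "k = g \<cdot> h" "g \<in> V" "h \<in> W" "s g = r h" by (auto simp: bprod_def)
      then show "k \<in> (\<lambda>g. g \<cdot> \<tau> (s g)) ` ?V" using \<tau>(2)[of h] by (intro image_eqI[of _ _ g]) auto
    qed
    finally show ?thesis .
  qed
  ultimately show ?thesis using bis by (simp add: cobis_def copen_def)
qed

lemma cobis_iv:
  assumes W: "cobis W"
  shows "cobis (iv ` W)"
proof -
  note c = cobisD[OF W]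
  have eq: "iv ` W = {g \<in> arr. iv g \<in> W}"
    using c(5) by (force simp: image_iff subset_iff)
  have "openin (arrows G) (iv ` W)"
    unfolding eq by (rule openin_continuous_map_preimage[OF continuous_ginv c(3)])
  moreover have "compactin (arrows G) (iv ` W)" by (rule image_compactin[OF c(4) continuous_ginv])
  moreover have "inj_on r (iv ` W)" "inj_on s (iv ` W)"
    using c(5-7) by (auto simp: inj_on_def subset_iff)
  ultimately show ?thesis using c(5) by (auto simp: cobis_def copen_def bisection_def)
qed

text \<open>\<open>r\<close> is open and fixes units, so it carries a compact neighbourhood of a
  unit among the arrows to one in the unit space.\<close>

lemma locally_compact_unit_space: "locally_compact_space (unit_space G)"
  unfolding locally_compact_space_def
proof
  fix x assume "x \<in> topspace (unit_space G)"
  then have x: "x \<in> arr" "r x = x" by (simp_all add: unitsD)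
  then obtain U K where UK: "openin (arrows G) U" "compactin (arrows G) K" "x \<in> U" "U \<subseteq> K"
    using locally_compact unfolding locally_compact_space_def by blast
  have "openin (unit_space G) (r ` U)" using UK(1) open_map_r by (simp add: open_map_def)
  moreover have "compactin (unit_space G) (r ` K)" by (rule image_compactin[OF UK(2) continuous_r])
  moreover have "x \<in> r ` U" "r ` U \<subseteq> r ` K" using UK x by force+
  ultimately show "\<exists>U K. openin (unit_space G) U \<and> compactin (unit_space G) K \<and> x \<in> U \<and> U \<subseteq> K" by blast
qed

end

section \<open>Bases of compact open sets\<close>

context ample_groupoid
begin

text \<open>Components are points, and in a locally compact Hausdorff space a compact component
  inside an open set has a clopen neighbourhood there. The compact neighbourhood \<open>C\<close>
  makes this clopen set compact.\<close>

lemma copen_basis_units: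
  assumes Q: "openin (arrows G) Q" and x: "x \<in> Q" "x \<in> units G"
  obtains K where "copen K" "x \<in> K" "K \<subseteq> Q" "K \<subseteq> units G"
proof -
  let ?X = "unit_space G"
  obtain U C where UC: "openin ?X U" "compactin ?X C" "x \<in> U" "U \<subseteq> C"
    using locally_compact_unit_space x(2) unfolding locally_compact_space_def by auto
  have Oo: "openin ?X (Q \<inter> U)"
    using Q UC(1) by (auto simp: openin_unit_space openin_Int)
  have "connected_component_of_set ?X x = {x}"
  proof -
    obtain a where "connected_component_of_set ?X x \<subseteq> {a}"
      using totally_disconnected connectedin_connected_component_of[of ?X x]
      unfolding totally_disconnected_space_def by blast
    moreover have "x \<in> connected_component_of_set ?X x"
      using x(2) by (simp add: connected_component_of_refl)
    ultimately show ?thesis by blast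
  qed
  then have "{x} \<in> connected_components_of ?X"
    using x(2) unfolding connected_components_of_def by auto
  then obtain K V where KV: "openin ?X K" "openin ?X V" "disjnt K V" "K \<union> V = topspace ?X" "{x} \<subseteq> K" "K \<subseteq> Q \<inter> U"
    using wilder_locally_compact_component_thm[OF locally_compact_unit_space Hausdorff_unit_space, of "{x}" "Q \<inter> U"]
      Oo x UC(3) by (metis Int_iff compactin_sing empty_subsetI insert_subset topspace_unit_space)
  have "K = topspace ?X - V" using KV by (auto simp: disjnt_def)
  then have "closedin ?X K" using KV(2) by blast
  then have "compactin ?X K" using UC(2,4) KV(6) closed_compactin by (metis Int_subset_iff order_trans)
  then have "copen K" using KV(1) by (simp add: copen_def openin_unit_space compactin_unit_space)
  then show thesis using that KV UC(1) by (auto simp: openin_unit_space)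
qed

text \<open>Local injectivity of \<open>r\<close> and \<open>s\<close> yields an open bisection
  \<open>B\<close> inside \<open>Q\<close>; a compact open set of units around \<open>r g\<close> is
  then lifted to \<open>B\<close> by the inverse of \<open>r\<close>.\<close>

lemma cobis_basis:
  assumes Q: "openin (arrows G) Q" and g: "g \<in> Q"
  obtains W where "cobis W" "g \<in> W" "W \<subseteq> Q"
proof -
  have garr: "g \<in> arr" using assms openin_subset by blast
  obtain U where U: "openin (arrows G) U" "g \<in> U" "inj_on r U"
  proof -
    obtain U where U: "openin (arrows G) U" "g \<in> U"
        "homeomorphic_map (subtopology (arrows G) U) (subtopology (unit_space G) (r ` U)) r"
      using local_homeo_range garr unfolding local_homeomorphism_def by blast
    then have "inj_on r U"
      using homeomorphic_imp_injective_map[OF U(3)] openin_subset[OF U(1)] by (simp add: Int_absorb1)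
    with U that show thesis by blast
  qed
  obtain V where V: "openin (arrows G) V" "g \<in> V" "inj_on s V"
  proof -
    obtain V where V: "openin (arrows G) V" "g \<in> V"
        "homeomorphic_map (subtopology (arrows G) V) (subtopology (unit_space G) (s ` V)) s"
      using local_homeo_source garr unfolding local_homeomorphism_def by blast
    then have "inj_on s V"
      using homeomorphic_imp_injective_map[OF V(3)] openin_subset[OF V(1)] by (simp add: Int_absorb1)
    with V that show thesis by blast
  qed
  define B where "B = Q \<inter> U \<inter> V"
  have B: "openin (arrows G) B" "g \<in> B" using Q U V g by (auto simp: B_def)
  then have Barr: "B \<subseteq> arr" using openin_subset by blast
  have bis: "bisection G B"
    using U(3) V(3) Barr unfolding bisection_def B_def by (auto intro: inj_on_subset)
  then have inj: "inj_on r B" by (simp add: bisection_def)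
  have rB: "openin (unit_space G) (r ` B)" using open_map_r B(1) by (simp add: open_map_def)
  then obtain K where K: "copen K" "r g \<in> K" "K \<subseteq> r ` B" "K \<subseteq> units G"
    using copen_basis_units[of "r ` B" "r g"] B(2) garr by (auto simp: openin_unit_space)
  obtain \<sigma> where \<sigma>: "continuous_map (subtopology (unit_space G) (r ` B)) (arrows G) \<sigma>"
      "\<And>g. g \<in> B \<Longrightarrow> \<sigma> (r g) = g"
    using bisection_section[OF B(1) inj continuous_r open_map_r] by blast
  let ?W = "{h \<in> B. r h \<in> K}"
  have "openin (arrows G) ?W"
    by (rule openin_continuous_map_preimage_gen[OF continuous_r B(1)]) (use K in \<open>simp add: openin_unit_space copenD\<close>)
  moreover have "compactin (arrows G) (\<sigma> ` K)"
    by (rule image_compactin[OF _ \<sigma>(1)]) (use K in \<open>simp add: compactin_subtopology compactin_unit_space copenD\<close>)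
  moreover have "\<sigma> ` K = ?W"
  proof (intro equalityI subsetI)
    fix h assume "h \<in> \<sigma> ` K"
    then obtain x where "x \<in> K" "h = \<sigma> x" by auto
    moreover then obtain b where "b \<in> B" "x = r b" using K(3) by auto
    ultimately show "h \<in> ?W" using \<sigma>(2) by auto
  next
    fix h assume "h \<in> ?W"
    then show "h \<in> \<sigma> ` K" using \<sigma>(2)[of h] by (intro image_eqI[of _ _ "r h"]) auto
  qed
  ultimately have "cobis ?W"
    using bisection_mono[OF bis, of ?W] by (auto simp: cobis_def copen_def)
  then show thesis using that[of ?W] B K(2) by (auto simp: B_def)
qed

lemma compact_cover:
  assumes C: "compactin (arrows G) C" and ex: "\<And>g. g \<in> C \<Longrightarrow> \<exists>W. cobis W \<and> g \<in> W \<and> P W"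
  obtains \<W> where "finite \<W>" "\<And>W. W \<in> \<W> \<Longrightarrow> cobis W \<and> P W" "C \<subseteq> \<Union>\<W>"
proof -
  let ?\<U> = "{W. cobis W \<and> P W}"
  have "(\<forall>U\<in>?\<U>. openin (arrows G) U) \<and> C \<subseteq> \<Union>?\<U>"
    using ex cobisD(3) by blast
  then obtain \<W> where "finite \<W>" "\<W> \<subseteq> ?\<U>" "C \<subseteq> \<Union>\<W>"
    using C unfolding compactin_def by (metis (no_types, lifting))
  then show thesis using that by blast
qed

end

section \<open>Functions supported on compact open bisections\<close>

lemma lin_span_base: "f \<in> S \<Longrightarrow> f \<in> lin_span S"
  and lin_span_zero: "0 \<in> lin_span S"
  and lin_span_add: "\<lbrakk>f \<in> lin_span S; g \<in> lin_span S\<rbrakk> \<Longrightarrow> f + g \<in> lin_span S"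
  and lin_span_scale: "f \<in> lin_span S \<Longrightarrow> fscale c f \<in> lin_span S"
  and lin_span_induct_alt [consumes 1]:
    "\<lbrakk>f \<in> lin_span S; P 0; \<And>c g h. \<lbrakk>g \<in> S; P h\<rbrakk> \<Longrightarrow> P (fscale c g + h)\<rbrakk> \<Longrightarrow> P f"
proof -
  interpret V: vector_space fscale by (rule vector_space_fscale)
  show "f \<in> S \<Longrightarrow> f \<in> lin_span S" "0 \<in> lin_span S"
    "\<lbrakk>f \<in> lin_span S; g \<in> lin_span S\<rbrakk> \<Longrightarrow> f + g \<in> lin_span S"
    "f \<in> lin_span S \<Longrightarrow> fscale c f \<in> lin_span S"
    by (simp_all add: lin_span_def V.span_base V.span_zero V.span_add V.span_scale)
  show "\<lbrakk>f \<in> lin_span S; P 0; \<And>c g h. \<lbrakk>g \<in> S; P h\<rbrakk> \<Longrightarrow> P (fscale c g + h)\<rbrakk> \<Longrightarrow> P f"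
    unfolding lin_span_def by (rule V.span_induct_alt)
qed

lemma lin_span_sum: "(\<And>i. i \<in> I \<Longrightarrow> f i \<in> lin_span S) \<Longrightarrow> sum f I \<in> lin_span S"
  by (induction I rule: infinite_finite_induct) (auto intro: lin_span_zero lin_span_add)

lemma sum_fun_apply: "(\<Sum>i\<in>I. f i) x = (\<Sum>i\<in>I. f i x)"
  for f :: "'i \<Rightarrow> 'g \<Rightarrow> complex"
  by (induction I rule: infinite_finite_induct) auto

lemma fscale_simps [simp]: "fscale 1 f = f" "fscale 0 f = 0" "fscale c 0 = 0"
  "fscale c (fscale d f) = fscale (c * d) f" "fscale c (f + g) = fscale c f + fscale c g"
  by (auto simp: fscale_def fun_eq_iff algebra_simps)

lemma continuous_map_binop:
  fixes h :: "'b::topological_space \<Rightarrow> 'c::topological_space \<Rightarrow> 'd::topological_space"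
  assumes "continuous_map X euclidean f" "continuous_map X euclidean g"
    and "continuous_on UNIV (\<lambda>(x, y). h x y)"
  shows "continuous_map X euclidean (\<lambda>x. h (f x) (g x))"
proof -
  have "continuous_map X euclidean (\<lambda>x. (f x, g x))"
    using assms(1,2) by (simp add: continuous_map_paired flip: prod_topology_euclidean)
  from continuous_map_compose[OF this, of euclidean "\<lambda>(x, y). h x y"] show ?thesis
    using assms(3) by (simp add: o_def)
qed

lemma continuous_map_clopen_cases:
  assumes A: "openin X A" "closedin X A" and f: "continuous_map X Y f" and g: "continuous_map X Y g"
  shows "continuous_map X Y (\<lambda>x. if x \<in> A then f x else g x)"
  unfolding continuous_map_def
proof (intro conjI allI impI)
  show "(\<lambda>x. if x \<in> A then f x else g x) \<in> topspace X \<rightarrow> topspace Y"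
    using f g by (auto simp: continuous_map_def)
  fix V assume V: "openin Y V"
  have "{x \<in> topspace X. (if x \<in> A then f x else g x) \<in> V} =
      (A \<inter> {x \<in> topspace X. f x \<in> V}) \<union> ((topspace X - A) \<inter> {x \<in> topspace X. g x \<in> V})"
    using openin_subset[OF A(1)] by auto
  also have "openin X \<dots>"
    using A V f g by (intro openin_Un openin_Int) (auto simp: continuous_map_def)
  finally show "openin X {x \<in> topspace X. (if x \<in> A then f x else g x) \<in> V}" .
qed

context ample_groupoid
begin

text \<open>On a compact open bisection \<open>W\<close> supports are automatically compact, so
  there this is \<open>Cc_open G W\<close>.\<close>

definition CB :: "'a set \<Rightarrow> ('a \<Rightarrow> complex) set" where
  "CB W = {f. continuous_map (subtopology (arrows G) W) euclidean f \<and> (\<forall>g. g \<notin> W \<longrightarrow> f g = 0)}"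

lemma CB_zero: "\<lbrakk>f \<in> CB W; g \<notin> W\<rbrakk> \<Longrightarrow> f g = 0"
  by (simp add: CB_def)

lemma CB_bounded:
  assumes W: "cobis W" and f: "f \<in> CB W"
  obtains c where "\<And>g. cmod (f g) \<le> c"
proof -
  have "compactin euclidean (f ` W)"
    by (rule image_compactin[of "subtopology (arrows G) W"])
      (use cobisD(4)[OF W] f in \<open>auto simp: compactin_subtopology CB_def\<close>)
  then have "bounded (f ` W)" by (simp add: compact_imp_bounded)
  then obtain c where c: "\<And>z. z \<in> f ` W \<Longrightarrow> cmod z \<le> c" unfolding bounded_iff by blast
  then have "cmod (f g) \<le> max c 0" for g
    using CB_zero[OF f, of g] by (cases "g \<in> W") (auto simp: le_max_iff_disj)
  then show thesis using that by blast
qed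

lemma fscale_CB: "f \<in> CB W \<Longrightarrow> fscale c f \<in> CB W"
  using continuous_map_binop[of _ "\<lambda>_. c" f "(*)"]
  by (simp add: CB_def fscale_def case_prod_unfold continuous_on_fst continuous_on_snd continuous_on_mult continuous_on_id)

lemma CB_subset_Cc:
  assumes W: "cobis W"
  shows "CB W \<subseteq> Cc G"
proof
  fix f assume f: "f \<in> CB W"
  let ?S = "subtopology (arrows G) W"
  have "compactin ?S (?S closure_of {g \<in> W. f g \<noteq> 0})"
    by (rule closedin_compact_space)
      (use cobisD(4)[OF W] in \<open>auto intro: compact_space_subtopology\<close>)
  then have "f \<in> Cc_open G W" using f by (simp add: Cc_open_def CB_def)
  then show "f \<in> Cc G"
    unfolding Cc_def using cobisD(3,8)[OF W] by (intro lin_span_base) auto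
qed

text \<open>
  The infimum of all \<open>c\<close> with \<open>bis_sum f c\<close> is a norm on \<open>C\<^sub>c(G)\<close> that dominates the I-norm. It replaces
  the I-norm in all density arguments because estimates involve only one bisection at a time.
\<close>

inductive bis_sum :: "('a \<Rightarrow> complex) \<Rightarrow> real \<Rightarrow> bool" where
  atom: "\<lbrakk>cobis W; f \<in> CB W; \<And>g. cmod (f g) \<le> c\<rbrakk> \<Longrightarrow> bis_sum f c"
| plus: "\<lbrakk>bis_sum f c; bis_sum g d\<rbrakk> \<Longrightarrow> bis_sum (f + g) (c + d)"

lemma bis_sum_nonneg: "bis_sum f c \<Longrightarrow> 0 \<le> c"
  by (induction rule: bis_sum.induct) (auto intro: order_trans[OF norm_ge_zero])

lemma bis_sum_zero: "bis_sum 0 0"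
  by (rule atom[of "{}"]) (auto simp: CB_def)

lemma bis_sum_Cc: "bis_sum f c \<Longrightarrow> f \<in> Cc G"
proof (induction rule: bis_sum.induct)
  case (atom W f c)
  then show ?case using CB_subset_Cc by blast
next
  case (plus f c g d)
  then show ?case unfolding Cc_def by (intro lin_span_add)
qed

lemma bis_sum_scale: "bis_sum f c \<Longrightarrow> bis_sum (fscale z f) (cmod z * c)"
proof (induction rule: bis_sum.induct)
  case (atom W f c)
  then show ?case
    by (intro bis_sum.atom[of W]) (auto simp: fscale_CB, auto simp: fscale_def norm_mult mult_left_mono)
next
  case (plus f c g d)
  then show ?case unfolding fscale_simps distrib_left by (intro bis_sum.plus)
qed

lemma bis_sum_diff: "\<lbrakk>bis_sum f c; bis_sum g d\<rbrakk> \<Longrightarrow> bis_sum (f - g) (c + d)"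
proof -
  assume "bis_sum f c" "bis_sum g d"
  then have "bis_sum (f + fscale (-1) g) (c + cmod (-1) * d)" by (intro plus bis_sum_scale)
  moreover have "f + fscale (-1) g = f - g" by (auto simp: fscale_def fun_eq_iff)
  ultimately show ?thesis by simp
qed

text \<open>\<open>W\<close> is compact and open in the Hausdorff set \<open>U\<close>, hence clopen
  there, so \<open>f\<close> may be cut along it without losing continuity. The part off
  \<open>W\<close> lives on the rest of the cover.\<close>

lemma bis_sum_of_cover:
  assumes U: "Hausdorff_space (subtopology (arrows G) U)"
    and "finite \<W>" "\<And>W. W \<in> \<W> \<Longrightarrow> cobis W \<and> W \<subseteq> U"
    and "continuous_map (subtopology (arrows G) U) euclidean f" "\<And>g. g \<notin> \<Union>\<W> \<Longrightarrow> f g = 0"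
  shows "\<exists>c. bis_sum f c"
  using assms(2-5)
proof (induction \<W> arbitrary: f rule: finite_induct)
  case empty
  then have "f = 0" by auto
  then show ?case using bis_sum_zero by blast
next
  case (insert W \<W>)
  let ?S = "subtopology (arrows G) U"
  have W: "cobis W" "W \<subseteq> U" using insert.prems(1) by auto
  have clopen: "openin ?S W" "closedin ?S W"
    using W cobisD[OF W(1)] copen_closedin[OF U] by (auto simp: openin_subset_topspace_eq openin_subtopology)
  let ?f1 = "\<lambda>g. if g \<in> W then f g else 0" and ?f2 = "\<lambda>g. if g \<in> W then 0 else f g"
  have "continuous_map (subtopology (arrows G) W) euclidean ?f1"
    using continuous_map_from_subtopology_mono[OF insert.prems(2) W(2)]
    by (rule continuous_map_eq) auto
  then have f1: "?f1 \<in> CB W" by (simp add: CB_def)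
  obtain c where "\<And>g. cmod (?f1 g) \<le> c" using CB_bounded[OF W(1) f1] by blast
  then have b1: "bis_sum ?f1 c" by (rule atom[OF W(1) f1])
  have "continuous_map ?S euclidean ?f2"
    by (rule continuous_map_clopen_cases[OF clopen _ insert.prems(2)]) simp
  then have "\<exists>d. bis_sum ?f2 d"
    by (rule insert.IH[rotated]) (use insert.prems in auto)
  then obtain d where "bis_sum ?f2 d" ..
  from plus[OF b1 this] have "bis_sum (?f1 + ?f2) (c + d)" .
  also have "?f1 + ?f2 = f" by auto
  finally show ?case by blast
qed

text \<open>The compact support of a function on an open Hausdorff set is covered by finitely many
  compact open bisections inside that set. Statements on \<open>Cc G\<close> thereby become
  inductions over bisections.\<close>

lemma Cc_iff: "f \<in> Cc G \<longleftrightarrow> (\<exists>c. bis_sum f c)"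
proof
  assume "f \<in> Cc G"
  then show "\<exists>c. bis_sum f c"
    unfolding Cc_def
  proof (induction rule: lin_span_induct_alt)
    show "\<exists>c. bis_sum 0 c" using bis_sum_zero by blast
    fix z g h assume "g \<in> (\<Union>U\<in>{U. openin (arrows G) U \<and> Hausdorff_space (subtopology (arrows G) U)}. Cc_open G U)"
      and h: "\<exists>c. bis_sum h c"
    then obtain U where U: "openin (arrows G) U" "Hausdorff_space (subtopology (arrows G) U)" "g \<in> Cc_open G U"
      by auto
    let ?S = "subtopology (arrows G) U"
    let ?K = "?S closure_of {x \<in> U. g x \<noteq> 0}"
    have K: "compactin (arrows G) ?K" "?K \<subseteq> U"
      using U(3) by (auto simp: Cc_open_def compactin_subtopology)
    have "\<exists>W. cobis W \<and> x \<in> W \<and> W \<subseteq> U" if "x \<in> ?K" for x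
      using cobis_basis[OF U(1)] that K(2) by blast
    then obtain \<W> where \<W>: "finite \<W>" "\<And>W. W \<in> \<W> \<Longrightarrow> cobis W \<and> W \<subseteq> U" "?K \<subseteq> \<Union>\<W>"
      using compact_cover[OF K(1), of "\<lambda>W. W \<subseteq> U"] by blast
    have "U \<subseteq> topspace ?S" using openin_subset[OF U(1)] by auto
    then have "{x \<in> U. g x \<noteq> 0} \<subseteq> ?K" by (intro closure_of_subset) auto
    moreover have "\<forall>x. x \<notin> U \<longrightarrow> g x = 0" using U(3) by (simp add: Cc_open_def)
    ultimately have "g x = 0" if "x \<notin> \<Union>\<W>" for x using \<W>(3) that by blast
    then obtain c where "bis_sum g c"
      using bis_sum_of_cover[OF U(2) \<W>(1,2), of g] U(3) by (auto simp: Cc_open_def)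
    then show "\<exists>c. bis_sum (fscale z g + h) c"
      using h plus bis_sum_scale by blast
  qed
qed (use bis_sum_Cc in blast)

section \<open>Convolution and adjoint on bisections\<close>

lemma conv_at:
  assumes V: "V \<subseteq> arr" "inj_on r V" and f: "\<And>g. g \<notin> V \<Longrightarrow> f g = 0"
    and g: "g \<in> V" "k \<in> arr" "r k = r g"
  shows "conv G f u k = f g * u (iv g \<cdot> k)"
proof -
  have "(\<Sum>\<^sub>\<infinity>h\<in>range_fibre G (r k). f h * u (iv h \<cdot> k)) = (\<Sum>\<^sub>\<infinity>h\<in>{g}. f h * u (iv h \<cdot> k))"
  proof (rule infsum_cong_neutral)
    fix h assume "h \<in> range_fibre G (r k) - {g}"
    then have "h \<notin> V" using V g inj_onD[OF V(2), of h g] by (auto simp: range_fibre_iff)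
    then show "f h * u (iv h \<cdot> k) = 0" using f by simp
  qed (use V g in \<open>auto simp: range_fibre_iff\<close>)
  then show ?thesis using g by (simp add: conv_def)
qed

lemma conv_outside:
  assumes "\<And>g. g \<notin> V \<Longrightarrow> f g = 0" "r k \<notin> r ` V"
  shows "conv G f u k = 0"
proof -
  have "f h * u (iv h \<cdot> k) = 0" if "h \<in> range_fibre G (r k)" for h
    using that assms by (metis image_eqI mult_zero_left range_fibre_iff)
  then show ?thesis by (simp add: conv_def infsum_0)
qed

lemma conv_support:
  assumes V: "V \<subseteq> arr" "inj_on r V" and f: "\<And>g. g \<notin> V \<Longrightarrow> f g = 0" and u: "\<And>g. g \<notin> W \<Longrightarrow> u g = 0"
    and k: "k \<notin> bprod V W"
  shows "conv G f u k = 0"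
proof (cases "k \<in> arr \<and> r k \<in> r ` V")
  case True
  then obtain g where g: "g \<in> V" "r k = r g" "k \<in> arr" by auto
  then have garr: "g \<in> arr" using V by auto
  have "iv g \<cdot> k \<notin> W"
  proof
    assume "iv g \<cdot> k \<in> W"
    moreover have "k = g \<cdot> (iv g \<cdot> k)" "s g = r (iv g \<cdot> k)" using g garr by simp_all
    ultimately show False using k g(1) unfolding bprod_def by blast
  qed
  then show ?thesis using conv_at[OF V f g(1,3,2)] u by simp
next
  case False
  then show ?thesis using conv_outside[of V f k u] f by (cases "k \<in> arr") (auto simp: conv_def)
qed

lemma conv_indicator:
  assumes V: "cobis V" and W: "cobis W"
  shows "conv G (indicator V) (indicator W) = indicator (bprod V W)"
proof
  fix k
  note cV = cobisD[OF V] and cW = cobisD[OF W]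
  show "conv G (indicator V) (indicator W) k = indicator (bprod V W) k"
  proof (cases "k \<in> bprod V W")
    case True
    then obtain g h where k: "k = g \<cdot> h" "g \<in> V" "h \<in> W" "s g = r h" by (auto simp: bprod_def)
    then have a: "g \<in> arr" "h \<in> arr" using cV(5) cW(5) by auto
    then have "conv G (indicator V) (indicator W) k = indicator V g * indicator W (iv g \<cdot> k)"
      using k by (intro conv_at[OF cV(5,6)]) auto
    then show ?thesis using k a True by simp
  next
    case False
    then show ?thesis
      using conv_support[OF cV(5,6), of "indicator V" W "indicator W" k] by simp
  qed
qed

text \<open>At each arrow at most one term of the convolution survives, so the sup bounds multiply.
  On \<open>bprod V W\<close> this term is the product of \<open>f\<close> and \<open>u\<close>
  composed with the two continuous maps of \<open>continuous_quotient\<close>.\<close>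

lemma conv_CB:
  assumes V: "cobis V" and W: "cobis W" and f: "f \<in> CB V" and u: "u \<in> CB W"
    and c: "\<And>g. cmod (f g) \<le> c" and d: "\<And>g. cmod (u g) \<le> d"
  shows "conv G f u \<in> CB (bprod V W)" "cmod (conv G f u k) \<le> c * d"
proof -
  note cV = cobisD[OF V] and cW = cobisD[OF W]
  note f0 = CB_zero[OF f] and u0 = CB_zero[OF u]
  have supp: "conv G f u k = 0" if "k \<notin> bprod V W" for k
    by (rule conv_support[OF cV(5,6) f0 u0 that])
  have decomp: "\<exists>g\<in>V. k \<in> arr \<and> g \<in> arr \<and> r k = r g \<and> iv g \<cdot> k \<in> W" if k0: "k \<in> bprod V W" for k
  proof -
    obtain g h where k: "k = g \<cdot> h" "g \<in> V" "h \<in> W" "s g = r h"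
      using k0 unfolding bprod_def by blast
    moreover then have "g \<in> arr" "h \<in> arr" using cV(5) cW(5) by auto
    ultimately show ?thesis by (intro bexI[of _ g]) simp_all
  qed
  \<comment> \<open>\<open>undefined\<close> stands for an arbitrary point; a bound on a norm there
    is nonnegative.\<close>
  have "0 \<le> c" "0 \<le> d" using c[of undefined] d[of undefined] norm_ge_zero order_trans by blast+
  then show "cmod (conv G f u k) \<le> c * d"
  proof (cases "k \<in> bprod V W")
    case True
    then obtain g where g: "g \<in> V" "k \<in> arr" "r k = r g" using decomp by blast
    have eq: "conv G f u k = f g * u (iv g \<cdot> k)"
      using conv_at[of V f g k u] cV(5,6) f0 g by blast
    show ?thesis
      unfolding eq norm_mult using c d \<open>0 \<le> c\<close> by (intro mult_mono) auto
  qed (simp add: supp)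
  obtain \<sigma> where \<sigma>:
    "openin (arrows G) {k \<in> arr. r k \<in> r ` V}"
    "continuous_map (subtopology (arrows G) {k \<in> arr. r k \<in> r ` V}) (arrows G) \<sigma>"
    "continuous_map (subtopology (arrows G) {k \<in> arr. r k \<in> r ` V}) (arrows G) (\<lambda>k. iv (\<sigma> k) \<cdot> k)"
    "\<And>g k. \<lbrakk>g \<in> V; r k = r g\<rbrakk> \<Longrightarrow> \<sigma> k = g"
    using continuous_quotient[OF cV(3,2)] by blast
  note \<sigma> = \<sigma>(2-4)
  let ?P = "bprod V W"
  have P: "?P \<subseteq> {k \<in> arr. r k \<in> r ` V}" using decomp by blast
  have \<sigma>P: "\<sigma> k \<in> V \<and> iv (\<sigma> k) \<cdot> k \<in> W \<and> conv G f u k = f (\<sigma> k) * u (iv (\<sigma> k) \<cdot> k)" if k: "k \<in> ?P" for k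
  proof -
    obtain g where g: "g \<in> V" "k \<in> arr" "r k = r g" "iv g \<cdot> k \<in> W" using decomp[OF k] by blast
    then show ?thesis using \<sigma>(3)[OF g(1,3)] conv_at[of V f g k u] cV(5,6) f0 g(1-3) by auto
  qed
  have "continuous_map (subtopology (arrows G) ?P) (subtopology (arrows G) V) \<sigma>"
    by (rule continuous_map_into_subtopology[OF continuous_map_from_subtopology_mono[OF \<sigma>(1) P]])
      (use \<sigma>P in auto)
  then have c1: "continuous_map (subtopology (arrows G) ?P) euclidean (\<lambda>k. f (\<sigma> k))"
    using f continuous_map_compose[of _ _ \<sigma> euclidean f] by (simp add: CB_def o_def)
  have "continuous_map (subtopology (arrows G) ?P) (subtopology (arrows G) W) (\<lambda>k. iv (\<sigma> k) \<cdot> k)"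
    by (rule continuous_map_into_subtopology[OF continuous_map_from_subtopology_mono[OF \<sigma>(2) P]])
      (use \<sigma>P in auto)
  then have c2: "continuous_map (subtopology (arrows G) ?P) euclidean (\<lambda>k. u (iv (\<sigma> k) \<cdot> k))"
    using u continuous_map_compose[of _ _ "\<lambda>k. iv (\<sigma> k) \<cdot> k" euclidean u] by (simp add: CB_def o_def)
  have "continuous_map (subtopology (arrows G) ?P) euclidean (\<lambda>k. f (\<sigma> k) * u (iv (\<sigma> k) \<cdot> k))"
    by (rule continuous_map_binop[OF c1 c2])
      (simp add: case_prod_unfold continuous_on_fst continuous_on_snd continuous_on_mult continuous_on_id)
  then have "continuous_map (subtopology (arrows G) ?P) euclidean (conv G f u)"
    by (rule continuous_map_eq) (use \<sigma>P in auto)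
  then show "conv G f u \<in> CB ?P" using supp by (simp add: CB_def)
qed

lemma fstar_CB:
  assumes W: "cobis W" and f: "f \<in> CB W"
  shows "fstar G f \<in> CB (iv ` W)"
proof -
  note c = cobisD[OF W]
  have "fstar G f g = 0" if "g \<notin> iv ` W" for g
  proof (cases "g \<in> arr")
    case True
    then have "iv g \<notin> W" using that by (metis image_eqI iv_iv)
    then show ?thesis using CB_zero[OF f] by (simp add: fstar_def)
  qed (simp add: fstar_def)
  moreover have "continuous_map (subtopology (arrows G) (iv ` W)) (subtopology (arrows G) W) iv"
    by (rule continuous_map_into_subtopology[OF continuous_map_from_subtopology[OF continuous_ginv]])
      (use c(5) in auto)
  then have c1: "continuous_map (subtopology (arrows G) (iv ` W)) euclidean (\<lambda>k. f (iv k))"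
    using f continuous_map_compose[of _ _ iv euclidean f] by (simp add: CB_def o_def)
  have "continuous_map (subtopology (arrows G) (iv ` W)) euclidean (\<lambda>k. cnj (f (iv k)))"
    using continuous_map_compose[OF c1, of euclidean cnj] by (simp add: o_def continuous_on_cnj continuous_on_id)
  then have "continuous_map (subtopology (arrows G) (iv ` W)) euclidean (fstar G f)"
    by (rule continuous_map_eq) (use c(5) in \<open>auto simp: fstar_def\<close>)
  ultimately show ?thesis by (simp add: CB_def)
qed

lemma fstar_add: "fstar G (f + g) = fstar G f + fstar G g"
  and fstar_fscale: "fstar G (fscale z f) = fscale (cnj z) (fstar G f)"
  and fstar_zero: "fstar G 0 = 0"
  by (auto simp: fstar_def fscale_def fun_eq_iff)

lemma fibre_finite_bisection:
  assumes "inj_on r W" "\<And>g. g \<notin> W \<Longrightarrow> f g = 0"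
  shows "fibre_finite f"
  unfolding fibre_finite_def
proof
  fix x
  have "inj_on r {g \<in> range_fibre G x. f g \<noteq> 0}"
    using assms by (auto intro: inj_on_subset)
  moreover have "r ` {g \<in> range_fibre G x. f g \<noteq> 0} \<subseteq> {x}" by (auto simp: range_fibre_iff)
  ultimately show "finite {g \<in> range_fibre G x. f g \<noteq> 0}" by (meson finite.emptyI finite_insert inj_on_finite)
qed

lemma bis_sum_fibre_finite: "bis_sum f c \<Longrightarrow> fibre_finite f"
proof (induction rule: bis_sum.induct)
  case (atom W f c)
  then show ?case using fibre_finite_bisection cobisD(6) CB_zero by blast
qed (rule fibre_finite_add)

lemma bis_sum_outside: "bis_sum f c \<Longrightarrow> g \<notin> arr \<Longrightarrow> f g = 0"
proof (induction rule: bis_sum.induct)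
  case (atom W f c)
  then show ?case using CB_zero[OF atom(2)] cobisD(5)[OF atom(1)] by blast
qed simp

lemma bis_sum_fstar: "bis_sum f c \<Longrightarrow> bis_sum (fstar G f) c"
proof (induction rule: bis_sum.induct)
  case (atom W f c)
  then have "cmod (fstar G f g) \<le> c" for g
    using atom(3)[of "iv g"] order_trans[OF norm_ge_zero atom(3)] by (simp add: fstar_def)
  then show ?case using bis_sum.atom[OF cobis_iv fstar_CB] atom by blast
next
  case (plus f c g d)
  then show ?case unfolding fstar_add by (intro bis_sum.plus)
qed

text \<open>Bilinearity reduces this to a pair of bisections. Submultiplicativity is what lets
  approximations be multiplied later.\<close>

lemma bis_sum_conv:
  assumes "bis_sum f c" "bis_sum u d"
  shows "bis_sum (conv G f u) (c * d)"
  using assms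
proof (induction arbitrary: u d rule: bis_sum.induct)
  case (atom V f c)
  note V = atom.hyps
  have ff: "fibre_finite f" using bis_sum_fibre_finite bis_sum.atom[OF V] by blast
  from atom.prems show ?case
  proof (induction rule: bis_sum.induct)
    case (atom W u d)
    show ?case
      by (rule bis_sum.atom[OF cobis_bprod[OF V(1) atom(1)]]) (use conv_CB[OF V(1) atom(1) V(2) atom(2) V(3) atom(3)] in auto)
  next
    case (plus u d u' d')
    then show ?case unfolding conv_add_right[OF ff] distrib_left by (intro bis_sum.plus)
  qed
next
  case (plus f c f' c')
  then show ?case
    unfolding conv_add_left[OF plus.hyps[THEN bis_sum_fibre_finite]] distrib_right
    by (intro bis_sum.plus)
qed

lemma star_algebra_Cc: "star_algebra (Cc_alg G)"
proof (rule star_algebra_function_alg; unfold Cc_iff)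
  show "\<exists>c. bis_sum 0 c" using bis_sum_zero by blast
  show "\<exists>c. bis_sum (f + g) c" if "\<exists>c. bis_sum f c" "\<exists>c. bis_sum g c" for f g
    using that plus by blast
  show "\<exists>c. bis_sum (fscale z f) c" if "\<exists>c. bis_sum f c" for z f
    using that bis_sum_scale by blast
  show "\<exists>c. bis_sum (conv G f g) c" if "\<exists>c. bis_sum f c" "\<exists>c. bis_sum g c" for f g
    using that bis_sum_conv by blast
  show "\<exists>c. bis_sum (fstar G f) c" if "\<exists>c. bis_sum f c" for f
    using that bis_sum_fstar by blast
  show "fibre_finite f" if "\<exists>c. bis_sum f c" for f
    using that bis_sum_fibre_finite by blast
  show "f g = 0" if "\<exists>c. bis_sum f c" "g \<notin> arr" for f g
    using that bis_sum_outside by blast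
qed

section \<open>The Steinberg algebra inside \<open>Cc G\<close>\<close>

lemma steinberg_eq: "steinberg G = lin_span {indicator W | W. cobis W}"
  unfolding steinberg_def cobis_def copen_def by (simp add: conj_assoc)

lemma steinberg_zero: "0 \<in> steinberg G"
  and steinberg_add: "\<lbrakk>f \<in> steinberg G; g \<in> steinberg G\<rbrakk> \<Longrightarrow> f + g \<in> steinberg G"
  and steinberg_scale: "f \<in> steinberg G \<Longrightarrow> fscale z f \<in> steinberg G"
  and steinberg_indicator: "cobis W \<Longrightarrow> indicator W \<in> steinberg G"
proof -
  show "0 \<in> steinberg G" unfolding steinberg_eq by (rule lin_span_zero)
  show "f + g \<in> steinberg G" if "f \<in> steinberg G" "g \<in> steinberg G"
    using that unfolding steinberg_eq by (rule lin_span_add)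
  show "fscale z f \<in> steinberg G" if "f \<in> steinberg G"
    using that unfolding steinberg_eq by (rule lin_span_scale)
  show "indicator W \<in> steinberg G" if "cobis W"
    unfolding steinberg_eq using that by (intro lin_span_base) blast
qed

lemma steinberg_sum: "(\<And>i. i \<in> I \<Longrightarrow> f i \<in> steinberg G) \<Longrightarrow> sum f I \<in> steinberg G"
  unfolding steinberg_eq by (rule lin_span_sum)

text \<open>Membership of the tail in \<open>steinberg G\<close> is carried along because additivity
  of the convolution is applied to it.\<close>

lemma steinberg_induct [consumes 1, case_names zero plus]:
  assumes "f \<in> steinberg G" "P 0"
    and "\<And>z W f. \<lbrakk>cobis W; f \<in> steinberg G; P f\<rbrakk> \<Longrightarrow> P (fscale z (indicator W) + f)"
  shows "P f"
proof -
  have "f \<in> steinberg G \<and> P f"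
    using assms(1) unfolding steinberg_eq
  proof (induction rule: lin_span_induct_alt)
    fix z and g h :: "'a \<Rightarrow> complex"
    assume g: "g \<in> {indicator W | W. cobis W}" and h: "h \<in> lin_span {indicator W | W. cobis W} \<and> P h"
    then obtain W where W: "cobis W" "g = indicator W" by blast
    have "fscale z g + h \<in> lin_span {indicator W | W. cobis W}"
      by (rule lin_span_add[OF lin_span_scale[OF lin_span_base[OF g]] conjunct1[OF h]])
    moreover have "P (fscale z g + h)"
      unfolding W(2) by (rule assms(3)[OF W(1)]) (use h steinberg_eq in auto)
    ultimately show "fscale z g + h \<in> lin_span {indicator W | W. cobis W} \<and> P (fscale z g + h)" ..
  qed (use assms(2) lin_span_zero in blast)
  then show ?thesis ..
qed

lemma steinberg_Cc: "f \<in> steinberg G \<Longrightarrow> f \<in> Cc G"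
  using steinberg_subset_Cc[OF lc_etale_groupoid_axioms] by blast

lemma fibre_finite_Cc: "f \<in> Cc G \<Longrightarrow> fibre_finite f"
  using bis_sum_fibre_finite by (auto simp: Cc_iff)

lemma fstar_indicator: "cobis W \<Longrightarrow> fstar G (indicator W) = indicator (iv ` W)"
proof
  fix g assume W: "cobis W"
  have "g \<in> arr \<Longrightarrow> iv g \<in> W \<longleftrightarrow> g \<in> iv ` W"
    using cobisD(5)[OF W] by (auto intro: rev_image_eqI[of "iv g"])
  then show "fstar G (indicator W) g = indicator (iv ` W) g"
    using cobisD(5)[OF W] by (auto simp: fstar_def indicator_def)
qed

lemma steinberg_fstar: "f \<in> steinberg G \<Longrightarrow> fstar G f \<in> steinberg G"
proof (induction rule: steinberg_induct)
  case zero
  show ?case unfolding fstar_zero by (rule steinberg_zero)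
next
  case (plus z W f)
  then show ?case
    unfolding fstar_add fstar_fscale fstar_indicator[OF plus(1)]
    by (intro steinberg_add steinberg_scale steinberg_indicator cobis_iv)
qed

lemma conv_zero: "conv G 0 u = 0" "conv G u 0 = 0"
  by (auto simp: conv_def fun_eq_iff)

lemma steinberg_conv:
  assumes "f \<in> steinberg G" "u \<in> steinberg G"
  shows "conv G f u \<in> steinberg G"
  using assms
proof (induction rule: steinberg_induct)
  case zero
  show ?case unfolding conv_zero by (rule steinberg_zero)
next
  case (plus z V f)
  have fV: "fibre_finite (indicator V)" "fibre_finite f"
    using fibre_finite_Cc steinberg_Cc steinberg_indicator plus.hyps by blast+
  have "conv G (indicator V) u \<in> steinberg G"
    using plus.prems
  proof (induction rule: steinberg_induct)
    case zero
    show ?case unfolding conv_zero by (rule steinberg_zero)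
  next
    case (plus y W u)
    then show ?case
      unfolding conv_add_right[OF fV(1)] conv_fscale_right conv_indicator[OF \<open>cobis V\<close> \<open>cobis W\<close>]
      by (intro steinberg_add steinberg_scale steinberg_indicator cobis_bprod[OF \<open>cobis V\<close>])
  qed
  moreover have fz: "fibre_finite (fscale z (indicator V))"
    using fibre_finite_Cc steinberg_Cc steinberg_scale steinberg_indicator plus.hyps by blast
  ultimately show ?case
    unfolding conv_add_left[OF fz fV(2)] conv_fscale_left
    using plus.IH[OF plus.prems] by (intro steinberg_add steinberg_scale)
qed

lemma star_algebra_steinberg: "star_algebra (steinberg_alg G)"
proof (rule star_algebra_function_alg)
  show "f g = 0" if "f \<in> steinberg G" "g \<notin> arr" for f g
    using steinberg_Cc[OF that(1)] that(2) bis_sum_outside by (auto simp: Cc_iff)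
qed (use fibre_finite_Cc steinberg_Cc in \<open>auto intro: steinberg_zero steinberg_add steinberg_scale steinberg_conv steinberg_fstar\<close>)

text \<open>Compactness of \<open>C\<close> leaves finitely many values. A nonzero level set is
  closed in \<open>B\<close>, as the complement of the union of the others, and lies in
  \<open>C\<close>; hence it is compact. \<open>B\<close> may be noncompact, for instance the whole
  unit space.\<close>

lemma steinberg_locally_constant:
  assumes B: "openin (arrows G) B" "bisection G B"
    and f: "\<And>v. openin (arrows G) {g \<in> B. f g = v}"
    and C: "compactin (arrows G) C" "C \<subseteq> B" "\<And>g. g \<notin> C \<Longrightarrow> f g = 0"
  shows "f \<in> steinberg G"
proof -
  let ?L = "\<lambda>v. {g \<in> B. f g = v}"
  obtain F where F: "finite F" "F \<subseteq> range ?L" "C \<subseteq> \<Union>F"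
  proof -
    have "(\<forall>U\<in>range ?L. openin (arrows G) U) \<and> C \<subseteq> \<Union>(range ?L)"
      using f C(2) by blast
    then show thesis using that C(1) unfolding compactin_def by (metis (no_types, lifting))
  qed
  have fin: "finite (f ` C)"
  proof -
    have "f ` C \<subseteq> (\<Union>A\<in>F. f ` A)" using F(3) by blast
    moreover have "finite (f ` A)" if "A \<in> F" for A
      using F(2) that by (auto intro: finite_subset[of _ "{_}"])
    ultimately show ?thesis using F(1) by (meson finite_UN finite_subset)
  qed
  have H: "Hausdorff_space (subtopology (arrows G) B)" by (rule Hausdorff_bisection[OF B(2)])
  have cob: "cobis (?L v)" if "v \<noteq> 0" for v
  proof -
    have "openin (subtopology (arrows G) B) (\<Union>w\<in>-{v}. ?L w)"
      using f B(1) by (auto simp: openin_open_subtopology)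
    then have "closedin (subtopology (arrows G) B) (topspace (subtopology (arrows G) B) - (\<Union>w\<in>-{v}. ?L w))"
      by blast
    moreover have "topspace (subtopology (arrows G) B) - (\<Union>w\<in>-{v}. ?L w) = ?L v"
      using openin_subset[OF B(1)] by auto
    moreover have "?L v \<subseteq> C" using C(3) that by force
    moreover have "compactin (subtopology (arrows G) B) C" using C by (simp add: compactin_subtopology)
    ultimately have "compactin (subtopology (arrows G) B) (?L v)" by (metis closed_compactin)
    then have "compactin (arrows G) (?L v)" by (simp add: compactin_subtopology)
    then show ?thesis using f bisection_mono[OF B(2), of "?L v"] by (auto simp: cobis_def copen_def)
  qed
  \<comment> \<open>The value 0 is left out because its level set in \<open>B\<close> may fail to be
    compact.\<close>
  have "f = (\<Sum>v\<in>f ` C - {0}. fscale v (indicator (?L v)))"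
  proof
    fix g
    have "(\<Sum>v\<in>f ` C - {0}. fscale v (indicator (?L v))) g = (\<Sum>v\<in>f ` C - {0}. if f g = v then (if g \<in> B then v else 0) else 0)"
      unfolding sum_fun_apply by (rule sum.cong) (auto simp: fscale_def indicator_def)
    also have "\<dots> = (if f g \<in> f ` C - {0} then (if g \<in> B then f g else 0) else 0)"
      using fin by (simp add: sum.delta)
    also have "\<dots> = f g" using C(2,3) by auto
    finally show "f g = (\<Sum>v\<in>f ` C - {0}. fscale v (indicator (?L v))) g" by simp
  qed
  also have "\<dots> \<in> steinberg G"
    using cob by (intro steinberg_sum steinberg_scale steinberg_indicator) auto
  finally show ?thesis .
qed

text \<open>Each new set \<open>V\<close> overwrites the earlier values by one constant. Level sets
  stay open because \<open>V\<close> is clopen in the Hausdorff set \<open>W\<close>.\<close>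

lemma approx_on_cover:
  assumes W: "cobis W" and "finite \<V>" 
    and "\<And>V. V \<in> \<V> \<Longrightarrow> copen V \<and> V \<subseteq> W \<and> (\<exists>v. \<forall>g\<in>V. cmod (f g - v) \<le> e)"
  shows "\<exists>d. (\<forall>v. openin (arrows G) {g \<in> W. d g = v}) \<and> (\<forall>g\<in>\<Union>\<V>. cmod (f g - d g) \<le> e)"
  using assms(2,3)
proof (induction \<V> rule: finite_induct)
  case empty
  have "openin (arrows G) {g \<in> W. (0 :: complex) = v}" for v
    using cobisD(3)[OF W] by (cases "v = 0") auto
  then show ?case by (intro exI[of _ "\<lambda>_. 0"]) auto
next
  case (insert V \<V>)
  have "\<exists>d. (\<forall>v. openin (arrows G) {g \<in> W. d g = v}) \<and> (\<forall>g\<in>\<Union>\<V>. cmod (f g - d g) \<le> e)"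
    by (rule insert.IH) (use insert.prems in blast)
  then obtain d where d: "\<And>v. openin (arrows G) {g \<in> W. d g = v}" "\<And>g. g \<in> \<Union>\<V> \<Longrightarrow> cmod (f g - d g) \<le> e"
    by blast
  obtain c where V: "copen V" "V \<subseteq> W" "\<And>g. g \<in> V \<Longrightarrow> cmod (f g - c) \<le> e"
    using insert.prems[of V] by auto
  have "openin (arrows G) {g \<in> W. (if g \<in> V then c else d g) = v}" for v
  proof -
    have "{g \<in> W. (if g \<in> V then c else d g) = v} = (if c = v then V else {}) \<union> ({g \<in> W. d g = v} \<inter> (W - V))"
      using V(2) by auto
    moreover have "openin (arrows G) ({g \<in> W. d g = v} \<inter> (W - V))"
      using d(1)[of v] cobisD(3)[OF cobis_Diff[OF W V(1,2)]] by (rule openin_Int)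
    ultimately show ?thesis using V(1) copenD(1) by (auto intro: openin_Un)
  qed
  then show ?case using d(2) V(3)
    by (intro exI[of _ "\<lambda>g. if g \<in> V then c else d g"]) auto
qed

text \<open>On small pieces of \<open>W\<close> the function is nearly constant, and finitely many
  pieces suffice. The error \<open>f - a\<close> is again continuous on the same bisection
  \<open>W\<close>, so it is a single atom of \<open>bis_sum\<close>, whatever the number of
  pieces.\<close>

lemma steinberg_dense_CB:
  assumes W: "cobis W" and f: "f \<in> CB W" and e: "e > 0"
  shows "\<exists>a\<in>steinberg G. bis_sum (f - a) e"
proof -
  note c = cobisD[OF W]
  define Q where "Q V \<longleftrightarrow> V \<subseteq> W \<and> (\<exists>v. \<forall>g\<in>V. cmod (f g - v) \<le> e)" for V
  have ex: "\<exists>V. cobis V \<and> g \<in> V \<and> Q V" if g: "g \<in> W" for g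
  proof -
    have "openin (subtopology (arrows G) W) {h \<in> topspace (subtopology (arrows G) W). f h \<in> ball (f g) e}"
      using f unfolding CB_def by (intro openin_continuous_map_preimage) auto
    then have "openin (arrows G) {h \<in> topspace (subtopology (arrows G) W). f h \<in> ball (f g) e}"
      using c(3) by (rule openin_trans_full)
    moreover have "g \<in> {h \<in> topspace (subtopology (arrows G) W). f h \<in> ball (f g) e}"
      using g e c(5) by auto
    ultimately obtain V where "cobis V" "g \<in> V" "V \<subseteq> {h \<in> topspace (subtopology (arrows G) W). f h \<in> ball (f g) e}"
      by (rule cobis_basis)
    then show ?thesis unfolding Q_def
      by (intro exI[of _ V] conjI exI[of _ "f g"]) (auto simp: dist_norm norm_minus_commute subset_iff less_imp_le)
  qed
  obtain \<V> where \<V>: "finite \<V>" "\<And>V. V \<in> \<V> \<Longrightarrow> cobis V \<and> Q V" "W \<subseteq> \<Union>\<V>"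
    using compact_cover[OF c(4) ex] by blast
  obtain d where d: "\<And>v. openin (arrows G) {g \<in> W. d g = v}" "\<And>g. g \<in> \<Union>\<V> \<Longrightarrow> cmod (f g - d g) \<le> e"
  proof -
    have "\<exists>d. (\<forall>v. openin (arrows G) {g \<in> W. d g = v}) \<and> (\<forall>g\<in>\<Union>\<V>. cmod (f g - d g) \<le> e)"
      by (rule approx_on_cover[OF W \<V>(1)]) (use \<V>(2) cobisD(1) in \<open>simp add: Q_def\<close>)
    with that show thesis by blast
  qed
  define a where "a g = (if g \<in> W then d g else 0)" for g
  have a: "openin (arrows G) {g \<in> W. a g = v}" for v
    using d(1)[of v] by (simp add: a_def cong: conj_cong)
  have "a \<in> steinberg G"
    by (rule steinberg_locally_constant[OF c(3,2) a c(4)]) (auto simp: a_def)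
  moreover have "bis_sum (f - a) e"
  proof (rule atom[OF W])
    show "cmod ((f - a) g) \<le> e" for g
      using d(2)[of g] \<V>(3) CB_zero[OF f, of g] e by (cases "g \<in> W") (auto simp: a_def subset_iff)
    have "continuous_map (subtopology (arrows G) W) euclidean a"
      unfolding continuous_map_def
    proof (intro conjI allI impI)
      fix S :: "complex set"
      have "{x \<in> topspace (subtopology (arrows G) W). a x \<in> S} = (\<Union>v\<in>S. {g \<in> W. a g = v})"
        using c(5) by auto
      moreover have "openin (subtopology (arrows G) W) {g \<in> W. a g = v}" for v
        using a c(3) by (simp add: openin_open_subtopology)
      ultimately show "openin (subtopology (arrows G) W) {x \<in> topspace (subtopology (arrows G) W). a x \<in> S}"
        by auto
    qed auto
    moreover have "continuous_map (subtopology (arrows G) W) euclidean f" using f by (simp add: CB_def)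
    ultimately have "continuous_map (subtopology (arrows G) W) euclidean (\<lambda>g. f g - a g)"
      by (intro continuous_map_binop[where h = "(-)"])
        (simp_all add: case_prod_unfold continuous_on_fst continuous_on_snd continuous_on_diff continuous_on_id)
    then show "f - a \<in> CB W" using CB_zero[OF f] by (simp add: CB_def a_def fun_diff_def)
  qed
  ultimately show ?thesis by blast
qed

lemma steinberg_dense:
  assumes "f \<in> Cc G" "e > 0"
  shows "\<exists>a\<in>steinberg G. bis_sum (f - a) e"
proof -
  obtain c where "bis_sum f c" using assms(1) by (auto simp: Cc_iff)
  then show ?thesis using assms(2)
  proof (induction arbitrary: e rule: bis_sum.induct)
    case (atom W f c)
    then show ?case by (intro steinberg_dense_CB)
  next
    case (plus f c g d)
    have e: "e / 2 > 0" using plus.prems by simp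
    obtain a where a: "a \<in> steinberg G" "bis_sum (f - a) (e/2)" using plus.IH(1)[OF e] by blast
    obtain b where b: "b \<in> steinberg G" "bis_sum (g - b) (e/2)" using plus.IH(2)[OF e] by blast
    have eq: "f + g - (a + b) = (f - a) + (g - b)" by (simp add: fun_eq_iff)
    have "bis_sum (f + g - (a + b)) e" unfolding eq using bis_sum.plus[OF a(2) b(2)] by simp
    then show ?case using steinberg_add[OF a(1) b(1)] by blast
  qed
qed

end

section \<open>Representations of the Steinberg algebra\<close>

context ample_groupoid
begin

text \<open>Meant for \<open>t\<close> equal to \<open>s\<close> or \<open>r\<close>: a bisection
  meets a fibre of \<open>t\<close> at most once, so an atom contributes at most its sup bound to
  the fibre sum.\<close>

lemma bis_sum_fibre_le:
  assumes "bis_sum f c" and F: "\<And>W. cobis W \<Longrightarrow> inj_on t W" "\<And>g. g \<in> F \<Longrightarrow> t g = x"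
  shows "(\<Sum>\<^sub>\<infinity>g\<in>F. ennreal (cmod (f g))) \<le> ennreal c"
  using assms(1)
proof (induction rule: bis_sum.induct)
  case (atom W f c)
  show ?case
  proof (cases "F \<inter> W = {}")
    case True
    then have "(\<Sum>\<^sub>\<infinity>g\<in>F. ennreal (cmod (f g))) = 0"
      by (intro infsum_0) (use CB_zero[OF atom(2)] in auto)
    then show ?thesis by simp
  next
    case False
    then obtain g where g: "g \<in> F" "g \<in> W" by auto
    have "(\<Sum>\<^sub>\<infinity>g\<in>F. ennreal (cmod (f g))) = (\<Sum>\<^sub>\<infinity>g\<in>{g}. ennreal (cmod (f g)))"
    proof (rule infsum_cong_neutral)
      fix h assume "h \<in> F - {g}"
      then have "h \<notin> W" using g F(2) inj_onD[OF F(1)[OF atom(1)], of h g] by auto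
      then show "ennreal (cmod (f h)) = 0" using CB_zero[OF atom(2)] by simp
    qed (use g in auto)
    then show ?thesis using atom(3)[of g] by (simp add: ennreal_leI)
  qed
next
  case (plus f c g d)
  have "(\<Sum>\<^sub>\<infinity>h\<in>F. ennreal (cmod ((f + g) h))) \<le> (\<Sum>\<^sub>\<infinity>h\<in>F. ennreal (cmod (f h)) + ennreal (cmod (g h)))"
    by (intro infsum_mono nonneg_summable_on_complete)
      (auto simp flip: ennreal_plus intro: ennreal_leI norm_triangle_ineq)
  also have "\<dots> = (\<Sum>\<^sub>\<infinity>h\<in>F. ennreal (cmod (f h))) + (\<Sum>\<^sub>\<infinity>h\<in>F. ennreal (cmod (g h)))"
    by (intro infsum_add nonneg_summable_on_complete) auto
  also have "\<dots> \<le> ennreal c + ennreal d" using plus.IH by (intro add_mono)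
  also have "\<dots> = ennreal (c + d)" using plus.hyps[THEN bis_sum_nonneg] by simp
  finally show ?case .
qed

lemma I_norm_le_bis_sum:
  assumes "bis_sum f c"
  shows "I_norm G f \<le> ennreal c"
proof -
  have "(\<Sum>\<^sub>\<infinity>g\<in>source_fibre G x. ennreal (cmod (f g))) \<le> ennreal c"
    "(\<Sum>\<^sub>\<infinity>g\<in>range_fibre G x. ennreal (cmod (f g))) \<le> ennreal c" for x
    by (rule bis_sum_fibre_le[OF assms, of s _ x], auto simp: cobisD source_fibre_def)
      (rule bis_sum_fibre_le[OF assms, of r _ x], auto simp: cobisD range_fibre_def)
  then show ?thesis unfolding I_norm_def by (intro max.boundedI SUP_least)
qed

section \<open>Locally constant functions on the unit space\<close>

lemma conv_units:
  assumes f: "\<And>g. g \<notin> units G \<Longrightarrow> f g = 0" and k: "k \<in> arr"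
  shows "conv G f u k = f (r k) * u k"
proof -
  have "conv G f u k = f (r k) * u (iv (r k) \<cdot> k)"
    by (rule conv_at[of "units G"])
      (use f k unitsD in \<open>auto simp: inj_on_def\<close>)
  then show ?thesis using k unitsD(4)[of "r k"] by simp
qed

lemma fstar_units:
  assumes f: "\<And>g. g \<notin> units G \<Longrightarrow> f g = 0"
  shows "fstar G f = (\<lambda>g. cnj (f g))"
proof
  fix g
  show "fstar G f g = cnj (f g)"
  proof (cases "g \<in> units G")
    case True
    then show ?thesis using unitsD[OF True] by (simp add: fstar_def)
  next
    case False
    have "g \<in> arr \<Longrightarrow> iv g \<notin> units G" using False unitsD(4)[of "iv g"] by fastforce
    then show ?thesis using f False by (auto simp: fstar_def)
  qed
qed

lemma conv_units_units:
  assumes f: "\<And>g. g \<notin> units G \<Longrightarrow> f g = 0" and u: "\<And>g. g \<notin> units G \<Longrightarrow> u g = 0"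
  shows "conv G f u = (\<lambda>g. f g * u g)"
proof
  fix g
  show "conv G f u g = f g * u g"
  proof (cases "g \<in> units G")
    case True
    then show ?thesis using conv_units[of f g u] f unitsD[OF True] by simp
  next
    case False
    then show ?thesis using conv_units[of f g u] f u by (cases "g \<in> arr") (auto simp: conv_def)
  qed
qed

text \<open>Local constancy with compact support, expressed by open level sets. The value type is
  arbitrary because real weights and complex algebra elements both occur.\<close>

definition unit_simple :: "('a \<Rightarrow> 'b::zero) \<Rightarrow> bool" where
  "unit_simple f \<longleftrightarrow> (\<forall>v. openin (arrows G) {g \<in> units G. f g = v}) \<and>
     (\<exists>C. compactin (arrows G) C \<and> C \<subseteq> units G \<and> (\<forall>g. g \<notin> C \<longrightarrow> f g = 0))"

lemma unit_simple_zero_off: "\<lbrakk>unit_simple f; g \<notin> units G\<rbrakk> \<Longrightarrow> f g = 0"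
  by (auto simp: unit_simple_def)

lemma unit_simple_steinberg: "unit_simple f \<Longrightarrow> f \<in> steinberg G"
  using steinberg_locally_constant[OF openin_units bisection_units, of f] by (auto simp: unit_simple_def)

text \<open>Values are treated as discrete: a level set of the result is a union over pairs of
  values, for any operation \<open>h\<close> that preserves 0. Pointwise square roots are covered in
  this way.\<close>

lemma unit_simple_binop:
  assumes f: "unit_simple f" and g: "unit_simple g" and h: "h 0 0 = 0"
  shows "unit_simple (\<lambda>x. h (f x) (g x))"
  unfolding unit_simple_def
proof (intro conjI allI)
  fix v
  have "{x \<in> units G. h (f x) (g x) = v} =
      (\<Union>(a, b)\<in>{(a, b). h a b = v}. {x \<in> units G. f x = a} \<inter> {x \<in> units G. g x = b})"
    by auto
  also have "openin (arrows G) \<dots>"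
    using f g by (auto simp: unit_simple_def intro!: openin_Union openin_Int)
  finally show "openin (arrows G) {x \<in> units G. h (f x) (g x) = v}" .
  obtain C D where C: "compactin (arrows G) C" "C \<subseteq> units G" "\<forall>g. g \<notin> C \<longrightarrow> f g = 0"
    and D: "compactin (arrows G) D" "D \<subseteq> units G" "\<forall>x. x \<notin> D \<longrightarrow> g x = 0"
    using f g unfolding unit_simple_def by blast
  show "\<exists>C. compactin (arrows G) C \<and> C \<subseteq> units G \<and> (\<forall>x. x \<notin> C \<longrightarrow> h (f x) (g x) = 0)"
    by (rule exI[of _ "C \<union> D"]) (use C D h in \<open>auto simp: compactin_Un\<close>)
qed

lemma unit_simple_comp: "\<lbrakk>unit_simple f; h 0 = 0\<rbrakk> \<Longrightarrow> unit_simple (\<lambda>x. h (f x))"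
  using unit_simple_binop[of f f "\<lambda>a _. h a"] by simp

lemma unit_simple_zero: "unit_simple (\<lambda>x. 0)"
proof -
  have "openin (arrows G) {g \<in> units G. 0 = v}" for v :: 'b
    using openin_units by (cases "v = 0") auto
  then show ?thesis unfolding unit_simple_def by (auto intro!: exI[of _ "{}"])
qed

lemma unit_simple_sum:
  fixes f :: "'i \<Rightarrow> 'a \<Rightarrow> 'b::comm_monoid_add"
  shows "(\<And>i. i \<in> I \<Longrightarrow> unit_simple (f i)) \<Longrightarrow> unit_simple (\<lambda>x. \<Sum>i\<in>I. f i x)"
  by (induction I rule: infinite_finite_induct)
    (auto intro: unit_simple_zero unit_simple_binop[of _ _ "(+)"])

lemma unit_simple_indicator:
  assumes K: "copen K" "K \<subseteq> units G"
  shows "unit_simple (indicator K :: 'a \<Rightarrow> 'b::zero_neq_one)"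
  unfolding unit_simple_def
proof (intro conjI allI)
  have "closedin (unit_space G) K"
    using Hausdorff_unit_space K by (intro compactin_imp_closedin) (auto simp: compactin_unit_space copenD)
  then have o: "openin (arrows G) (units G - K)"
    by (auto simp: closedin_def openin_unit_space)
  fix v :: 'b
  have "{g \<in> units G. indicator K g = v} = (if v = 1 then K else if v = 0 then units G - K else {})"
    using K(2) by (auto simp: indicator_def split: if_splits)
  then show "openin (arrows G) {g \<in> units G. indicator K g = v}"
    using o copenD(1)[OF K(1)] by simp
  show "\<exists>C. compactin (arrows G) C \<and> C \<subseteq> units G \<and> (\<forall>g. g \<notin> C \<longrightarrow> indicator K g = (0 :: 'b))"
    using K by (intro exI[of _ K]) (auto simp: copenD)
qed

text \<open>The set and its complement are unions of level sets, so the set is clopen in the unit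
  space; \<open>\<not> P 0\<close> places it inside the compact support.\<close>

lemma copen_unit_simple:
  assumes f: "unit_simple f" and "\<not> P 0"
  shows "copen {x \<in> units G. P (f x)}"
proof -
  let ?E = "{x \<in> units G. P (f x)}"
  obtain C where C: "compactin (arrows G) C" "C \<subseteq> units G" "\<forall>g. g \<notin> C \<longrightarrow> f g = 0"
    using f unfolding unit_simple_def by blast
  have o: "openin (arrows G) {x \<in> units G. Q (f x)}" for Q
  proof -
    have "{x \<in> units G. Q (f x)} = (\<Union>v\<in>Collect Q. {x \<in> units G. f x = v})" by auto
    then show ?thesis using f by (auto simp: unit_simple_def)
  qed
  have "units G - ?E = {x \<in> units G. \<not> P (f x)}" by auto
  then have "closedin (unit_space G) ?E"
    using o[of "\<lambda>v. \<not> P v"] by (simp add: closedin_def openin_unit_space)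
  moreover have "?E \<subseteq> C"
  proof
    fix x assume "x \<in> ?E"
    then show "x \<in> C" using C(3) assms(2) by (metis (mono_tags, lifting) mem_Collect_eq)
  qed
  moreover have "compactin (unit_space G) C" using C by (simp add: compactin_unit_space)
  ultimately have "compactin (unit_space G) ?E" by (metis closed_compactin)
  then show ?thesis using o[of P] by (simp add: copen_def compactin_unit_space)
qed

lemma copen_UN: "\<lbrakk>finite I; \<And>i. i \<in> I \<Longrightarrow> copen (K i)\<rbrakk> \<Longrightarrow> copen (\<Union>i\<in>I. K i)"
  by (induction I rule: finite_induct) (auto intro: copen_Un)

text \<open>Through \<open>conv_indicator\<close> these identities make the indicator of
  \<open>W\<close> behave as a partial isometry, with initial projection at the sources of
  \<open>W\<close> and final projection at its ranges.\<close>

lemma bprod_iv: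
  assumes W: "cobis W"
  shows "bprod (iv ` W) W = s ` W" "bprod (r ` W) W = W"
proof -
  note c = cobisD[OF W]
  show "bprod (iv ` W) W = s ` W"
  proof (intro equalityI subsetI)
    fix k assume "k \<in> bprod (iv ` W) W"
    then obtain g h where k: "k = iv g \<cdot> h" "g \<in> W" "h \<in> W" "s (iv g) = r h"
      unfolding bprod_def by blast
    then have "r g = r h" using c(5) by auto
    then have "g = h" by (rule inj_onD[OF c(6) _ k(2,3)])
    then show "k \<in> s ` W" using k(1,2) by (simp flip: s_eq)
  next
    fix k assume "k \<in> s ` W"
    then obtain g where "g \<in> W" "k = iv g \<cdot> g" by (auto simp: s_eq)
    moreover from this have "s (iv g) = r g" using c(5) by auto
    ultimately show "k \<in> bprod (iv ` W) W" unfolding bprod_def by blast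
  qed
  show "bprod (r ` W) W = W"
  proof (intro equalityI subsetI)
    fix k assume "k \<in> bprod (r ` W) W"
    then obtain g h where k: "k = r g \<cdot> h" "g \<in> W" "h \<in> W" "s (r g) = r h"
      unfolding bprod_def by blast
    then have "r g = r h" using c(5) by auto
    then show "k \<in> W" using k(1,3) c(5) r_left[of h] by auto
  next
    fix k assume "k \<in> W"
    then have "k = r k \<cdot> k" "k \<in> W" "s (r k) = r k" using c(5) by auto
    then show "k \<in> bprod (r ` W) W" unfolding bprod_def by blast
  qed
qed

end

section \<open>The positive functional of a vector\<close>

locale steinberg_representation = ample_groupoid G + representation "steinberg_alg G" H \<pi>
  for G :: "'g groupoid_data" and H :: "'h inner_space" (structure) and \<pi>
begin

lemma pi_linear: "a \<in> steinberg G \<Longrightarrow> linear_operator H (\<pi> a)"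
  using rep_linear_operator by simp

lemma pi_closed [simp]: "\<lbrakk>a \<in> steinberg G; \<xi> \<in> carrier H\<rbrakk> \<Longrightarrow> \<pi> a \<xi> \<in> carrier H"
  using pi_linear[of a] by (auto simp: linear_operator_def)

lemma pi_simps:
  "\<lbrakk>a \<in> steinberg G; b \<in> steinberg G; \<xi> \<in> carrier H\<rbrakk> \<Longrightarrow> \<pi> (a + b) \<xi> = \<pi> a \<xi> \<oplus> \<pi> b \<xi>"
  "\<lbrakk>a \<in> steinberg G; \<xi> \<in> carrier H\<rbrakk> \<Longrightarrow> \<pi> (fscale c a) \<xi> = c \<odot> \<pi> a \<xi>"
  "\<lbrakk>a \<in> steinberg G; b \<in> steinberg G; \<xi> \<in> carrier H\<rbrakk> \<Longrightarrow> \<pi> (conv G a b) \<xi> = \<pi> a (\<pi> b \<xi>)"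
  "\<lbrakk>a \<in> steinberg G; \<xi> \<in> carrier H; \<zeta> \<in> carrier H\<rbrakk> \<Longrightarrow> ip H (\<pi> a \<xi>) \<zeta> = ip H \<xi> (\<pi> (fstar G a) \<zeta>)"
  using rep_add[of a b \<xi>] rep_smult[of a \<xi> c] rep_mult[of a b \<xi>] rep_star[of a \<xi> \<zeta>] by simp_all

lemma pi_zero: "\<xi> \<in> carrier H \<Longrightarrow> \<pi> 0 \<xi> = \<zero>"
  using pi_simps(2)[of 0 \<xi> 0] steinberg_zero smult_l_null[of "\<pi> 0 \<xi>"] by simp

lemma pi_norm_sq:
  "\<lbrakk>a \<in> steinberg G; \<xi> \<in> carrier H\<rbrakk> \<Longrightarrow> (ip_norm H (\<pi> a \<xi>))\<^sup>2 = Re (ip H (\<pi> (conv G (fstar G a) a) \<xi>) \<xi>)"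
  using rep_norm_sq[OF star_algebra_steinberg, of a \<xi>] by simp

definition \<phi> :: "'h \<Rightarrow> ('g \<Rightarrow> real) \<Rightarrow> real" where
  "\<phi> \<xi> f = Re (ip H (\<pi> (\<lambda>g. complex_of_real (f g)) \<xi>) \<xi>)"

lemma unit_simple_of_real: "unit_simple f \<Longrightarrow> unit_simple (\<lambda>g. complex_of_real (f g))"
  by (rule unit_simple_comp) auto

lemma \<phi>_nonneg:
  assumes f: "unit_simple f" and nn: "\<And>g. 0 \<le> f g" and \<xi>: "\<xi> \<in> carrier H"
  shows "0 \<le> \<phi> \<xi> f"
proof -
  define h where "h g = complex_of_real (sqrt (f g))" for g
  have us: "unit_simple h" unfolding h_def by (rule unit_simple_comp[OF f]) simp
  then have h: "h \<in> steinberg G" by (rule unit_simple_steinberg)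
  note z = unit_simple_zero_off[OF us]
  have "fstar G h = h" using fstar_units[of h] z by (simp add: h_def fun_eq_iff)
  moreover have "conv G h h = (\<lambda>g. complex_of_real (f g))"
    using conv_units_units[of h h] z nn by (simp add: h_def fun_eq_iff flip: of_real_mult)
  ultimately have "\<phi> \<xi> f = (ip_norm H (\<pi> h \<xi>))\<^sup>2"
    using pi_norm_sq[OF h \<xi>] by (simp add: \<phi>_def)
  then show ?thesis by simp
qed

lemma \<phi>_add:
  assumes "unit_simple f" "unit_simple g" "\<xi> \<in> carrier H"
  shows "\<phi> \<xi> (\<lambda>x. f x + g x) = \<phi> \<xi> f + \<phi> \<xi> g"
proof -
  have "(\<lambda>x. complex_of_real (f x + g x)) = (\<lambda>x. complex_of_real (f x)) + (\<lambda>x. complex_of_real (g x))"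
    by (simp add: fun_eq_iff)
  then show ?thesis
    using assms unit_simple_of_real[THEN unit_simple_steinberg]
    by (simp only: \<phi>_def pi_simps ip_add pi_closed) simp
qed

lemma \<phi>_scale:
  assumes "unit_simple f" "\<xi> \<in> carrier H"
  shows "\<phi> \<xi> (\<lambda>x. c * f x) = c * \<phi> \<xi> f"
proof -
  have "(\<lambda>x. complex_of_real (c * f x)) = fscale (complex_of_real c) (\<lambda>x. complex_of_real (f x))"
    by (simp add: fun_eq_iff fscale_def)
  then show ?thesis
    using assms unit_simple_of_real[THEN unit_simple_steinberg]
    by (simp only: \<phi>_def pi_simps ip_smult pi_closed) simp
qed

lemma \<phi>_zero: "\<xi> \<in> carrier H \<Longrightarrow> \<phi> \<xi> (\<lambda>x. 0) = 0"
  using \<phi>_scale[OF unit_simple_zero, of \<xi> 0] by simp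

lemma \<phi>_sum:
  assumes "\<And>i. i \<in> I \<Longrightarrow> unit_simple (f i)" "\<xi> \<in> carrier H"
  shows "\<phi> \<xi> (\<lambda>x. \<Sum>i\<in>I. f i x) = (\<Sum>i\<in>I. \<phi> \<xi> (f i))"
  using assms
  by (induction I rule: infinite_finite_induct) (auto simp: \<phi>_zero \<phi>_add unit_simple_sum)

lemma \<phi>_mono:
  assumes f: "unit_simple f" and g: "unit_simple g" and le: "\<And>x. f x \<le> g x" and \<xi>: "\<xi> \<in> carrier H"
  shows "\<phi> \<xi> f \<le> \<phi> \<xi> g"
proof -
  have d: "unit_simple (\<lambda>x. g x + (-1) * f x)"
    by (rule unit_simple_binop[OF g f]) simp
  have "0 \<le> \<phi> \<xi> (\<lambda>x. g x + (-1) * f x)" by (rule \<phi>_nonneg[OF d _ \<xi>]) (simp add: le)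
  also have "\<dots> = \<phi> \<xi> g + \<phi> \<xi> (\<lambda>x. (-1) * f x)"
    by (rule \<phi>_add[OF g unit_simple_comp[OF f] \<xi>]) simp
  also have "\<dots> = \<phi> \<xi> g - \<phi> \<xi> f" unfolding \<phi>_scale[OF f \<xi>] by simp
  finally show ?thesis by simp
qed

abbreviation \<mu> :: "'h \<Rightarrow> 'g set \<Rightarrow> real" where "\<mu> \<xi> K \<equiv> \<phi> \<xi> (indicator K)"

lemma norm_indicator_sq:
  assumes W: "cobis W" and \<xi>: "\<xi> \<in> carrier H"
  shows "(ip_norm H (\<pi> (indicator W) \<xi>))\<^sup>2 = \<mu> \<xi> (s ` W)"
proof -
  have "conv G (fstar G (indicator W)) (indicator W) = indicator (s ` W)"
    using W by (simp add: fstar_indicator conv_indicator cobis_iv bprod_iv)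
  moreover have "(\<lambda>g. complex_of_real (indicator (s ` W) g)) = indicator (s ` W)"
    by (auto simp: indicator_def)
  ultimately show ?thesis
    using pi_norm_sq[OF steinberg_indicator[OF W] \<xi>] by (simp only: \<phi>_def)
qed

lemma s_image_units: "K \<subseteq> units G \<Longrightarrow> s ` K = K"
  using unitsD(3) by (force simp: image_iff subset_iff)

lemma \<mu>_bounds:
  assumes K: "copen K" "K \<subseteq> units G" and \<xi>: "\<xi> \<in> carrier H"
  shows "0 \<le> \<mu> \<xi> K" "\<mu> \<xi> K \<le> (ip_norm H \<xi>)\<^sup>2"
proof -
  have st: "indicator K \<in> steinberg G" by (rule steinberg_indicator[OF cobis_units[OF K]])
  let ?n = "ip_norm H (\<pi> (indicator K) \<xi>)"
  have n: "?n\<^sup>2 = \<mu> \<xi> K" using norm_indicator_sq[OF cobis_units[OF K] \<xi>] s_image_units[OF K(2)] by simp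
  then show "0 \<le> \<mu> \<xi> K" by (metis zero_le_power2)
  have "(\<lambda>g. complex_of_real (indicator K g)) = indicator K" by (auto simp: indicator_def)
  \<comment> \<open>\<open>\<mu> \<xi> K\<close> is the square of \<open>?n\<close>, so cancelling
    one \<open>?n\<close> shows that the projection \<pi>(1_K) does not increase norms.\<close>
  then have "\<mu> \<xi> K \<le> ?n * ip_norm H \<xi>"
    using Re_ip_le[of "\<pi> (indicator K) \<xi>" \<xi>] st \<xi> by (simp only: \<phi>_def pi_closed)
  then have "?n * ?n \<le> ?n * ip_norm H \<xi>" using n by (simp add: power2_eq_square)
  then have "?n \<le> ip_norm H \<xi>"
    using ip_norm_nonneg[of "\<pi> (indicator K) \<xi>"] ip_norm_nonneg[OF \<xi>] st \<xi>
    by (cases "?n = 0") (auto simp: mult_le_cancel_left)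
  then show "\<mu> \<xi> K \<le> (ip_norm H \<xi>)\<^sup>2"
    using n ip_norm_nonneg[of "\<pi> (indicator K) \<xi>"] st \<xi> by (metis pi_closed power_mono)
qed

text \<open>The projection at the ranges of \<open>W\<close> fixes \<pi>(1_W)\<xi>, so it may be
  applied to \<zeta> as well. Cauchy-Schwarz and 2xy \<le> x^2 + y^2 then leave one content at the
  sources and one at the ranges, to match the two halves of the I-norm.\<close>

lemma ip_indicator_le:
  assumes W: "cobis W" and \<xi>: "\<xi> \<in> carrier H" and \<zeta>: "\<zeta> \<in> carrier H"
  shows "Re (ip H (\<pi> (fscale z (indicator W)) \<xi>) \<zeta>) \<le> cmod z * (\<mu> \<xi> (s ` W) + \<mu> \<zeta> (r ` W)) / 2"
proof -
  note img = copen_image[OF cobisD(1)[OF W]]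
  have rW: "cobis (r ` W)" by (rule cobis_units[OF img(1,3)])
  note st = steinberg_indicator[OF W] steinberg_indicator[OF rW]
  let ?x = "\<pi> (indicator W) \<xi>" and ?y = "\<pi> (indicator (r ` W)) \<zeta>"
  have c: "?x \<in> carrier H" "?y \<in> carrier H" "z \<odot> ?x \<in> carrier H" using st \<xi> \<zeta> by simp_all
  have "fstar G (indicator (r ` W)) = indicator (r ` W)"
  proof -
    have "iv ` r ` W = r ` W" using unitsD(4) img(3) by (force simp: image_iff subset_iff)
    then show ?thesis by (simp add: fstar_indicator[OF rW])
  qed
  moreover have "?x = \<pi> (indicator (r ` W)) ?x"
    using pi_simps(3)[OF st(2,1) \<xi>] conv_indicator[OF rW W] bprod_iv(2)[OF W] by simp
  ultimately have "ip H ?x \<zeta> = ip H ?x ?y"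
    using pi_simps(4)[OF st(2) c(1) \<zeta>] by simp
  then have "ip H (\<pi> (fscale z (indicator W)) \<xi>) \<zeta> = ip H (z \<odot> ?x) ?y"
    using st \<xi> \<zeta> c by (simp add: pi_simps ip_smult)
  then have "Re (ip H (\<pi> (fscale z (indicator W)) \<xi>) \<zeta>) \<le> cmod z * (ip_norm H ?x * ip_norm H ?y)"
    using Re_ip_le[OF c(3,2)] c by (simp add: ip_norm_smult mult.assoc)
  also have "\<dots> \<le> cmod z * (((ip_norm H ?x)\<^sup>2 + (ip_norm H ?y)\<^sup>2) / 2)"
    using sum_squares_bound[of "ip_norm H ?x" "ip_norm H ?y"] by (intro mult_left_mono) auto
  also have "(ip_norm H ?x)\<^sup>2 = \<mu> \<xi> (s ` W)" by (rule norm_indicator_sq[OF W \<xi>])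
  also have "(ip_norm H ?y)\<^sup>2 = \<mu> \<zeta> (r ` W)"
    using norm_indicator_sq[OF rW \<zeta>] s_image_units[OF img(3)] by simp
  finally show ?thesis by simp
qed

end

subsection \<open>Combinations of compact open bisections\<close>

context ample_groupoid
begin

definition combo :: "(complex \<times> 'a set) list \<Rightarrow> 'a \<Rightarrow> complex" where
  "combo ys = (\<Sum>(d, L)\<leftarrow>ys. fscale d (indicator L))"

text \<open>For disjoint bisections and \<open>t\<close> equal to \<open>s\<close> or
  \<open>r\<close>, this is the sum of \<open>cmod (combo ys g)\<close> over the fibre of
  \<open>t\<close> at \<open>x\<close>, the quantity of which \<open>I_norm\<close> takes the
  supremum. For overlapping ones it ignores cancellation.\<close>

definition weight :: "('a \<Rightarrow> 'a) \<Rightarrow> (complex \<times> 'a set) list \<Rightarrow> 'a \<Rightarrow> real" where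
  "weight t ys x = (\<Sum>(d, L)\<leftarrow>ys. cmod d * indicator (t ` L) x)"

lemma combo_Nil [simp]: "combo [] = 0"
  and combo_Cons [simp]: "combo ((d, L) # ys) = fscale d (indicator L) + combo ys"
  by (simp_all add: combo_def)

lemma weight_Nil [simp]: "weight t [] x = 0"
  and weight_Cons [simp]: "weight t ((d, L) # ys) x = cmod d * indicator (t ` L) x + weight t ys x"
  by (simp_all add: weight_def)

lemma weight_nonneg: "0 \<le> weight t ys x"
  by (induction ys) auto

text \<open>The crude bound that serves on the exceptional set where the weight exceeds the
  I-norm.\<close>

lemma weight_le:
  fixes B :: real
  shows "(\<And>y. y \<in> set ys \<Longrightarrow> cmod (fst y) \<le> B) \<Longrightarrow> 0 \<le> B \<Longrightarrow> weight t ys x \<le> length ys * B"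
proof (induction ys)
  case (Cons y ys)
  obtain d L where y: "y = (d, L)" by fastforce
  have "cmod d * indicator (t ` L) x \<le> B"
    using Cons.prems(1)[of y] Cons.prems(2) y by (auto simp: indicator_def)
  then show ?case using Cons y by (simp add: algebra_simps)
qed simp

lemma combo_steinberg: "(\<And>y. y \<in> set ys \<Longrightarrow> cobis (snd y)) \<Longrightarrow> combo ys \<in> steinberg G"
proof (induction ys)
  case (Cons y ys)
  obtain d L where y: "y = (d, L)" by fastforce
  have "cobis L" using Cons.prems[of y] y by simp
  moreover have "combo ys \<in> steinberg G" using Cons by auto
  ultimately
  show ?case unfolding y combo_Cons
    by (intro steinberg_add steinberg_scale steinberg_indicator)
qed (use steinberg_zero in simp)

lemma combo_eq_0: "(\<And>y. y \<in> set ys \<Longrightarrow> g \<notin> snd y) \<Longrightarrow> combo ys g = 0"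
proof (induction ys)
  case (Cons y ys)
  obtain d L where y: "y = (d, L)" by fastforce
  show ?case using Cons Cons.prems[of y] y by (simp add: fscale_def)
qed simp

text \<open>If no two bisections meet over \<open>u\<close>, each one that reaches \<open>u\<close>
  does so at an arrow of its own, and coefficients cannot cancel.\<close>

lemma weight_le_fibre:
  assumes inj: "\<And>W. cobis W \<Longrightarrow> inj_on t W"
    and "\<And>y. y \<in> set ys \<Longrightarrow> cobis (snd y)"
    and "sorted_wrt (\<lambda>x y. u \<notin> t ` (snd x \<inter> snd y)) ys"
  shows "ennreal (weight t ys u) \<le> (\<Sum>\<^sub>\<infinity>g\<in>{g \<in> arr. t g = u}. ennreal (cmod (combo ys g)))"
  using assms(2,3)
proof (induction ys)
  case (Cons y ys)
  obtain d L where y: "y = (d, L)" by fastforce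
  let ?F = "{g \<in> arr. t g = u}"
  have IH: "ennreal (weight t ys u) \<le> (\<Sum>\<^sub>\<infinity>g\<in>?F. ennreal (cmod (combo ys g)))"
    using Cons by auto
  have L: "cobis L" using Cons.prems(1)[of y] y by simp
  show ?case
  proof (cases "u \<in> t ` L")
    case False
    then have "combo (y # ys) g = combo ys g" if "g \<in> ?F" for g
      using that y by (auto simp: fscale_def indicator_def)
    then have "(\<Sum>\<^sub>\<infinity>g\<in>?F. ennreal (cmod (combo (y # ys) g))) = (\<Sum>\<^sub>\<infinity>g\<in>?F. ennreal (cmod (combo ys g)))"
      by (intro infsum_cong) simp
    then show ?thesis using IH False y by simp
  next
    case True
    then obtain k where k: "k \<in> L" "t k = u" by auto
    then have kF: "k \<in> ?F" using cobisD(5)[OF L] by auto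
    \<comment> \<open>No later bisection contains \<open>k\<close>, so the head alone determines the
      value at \<open>k\<close>, while at the other arrows of the fibre the head vanishes.\<close>
    have k0: "combo ys k = 0"
    proof (rule combo_eq_0)
      fix z assume "z \<in> set ys"
      then show "k \<notin> snd z" using Cons.prems(2) k y by auto
    qed
    have eq: "ennreal (cmod (combo (y # ys) g)) =
        ennreal (if g = k then cmod d else 0) + ennreal (cmod (combo ys g))" if "g \<in> ?F" for g
    proof (cases "g = k")
      case True
      then show ?thesis using k(1) k0 y by (simp add: fscale_def)
    next
      case False
      then have "g \<notin> L" using that k inj_onD[OF inj[OF L], of g k] by auto
      then show ?thesis using False y by (simp add: fscale_def)
    qed
    have "(\<Sum>\<^sub>\<infinity>g\<in>?F. ennreal (if g = k then cmod d else 0)) = (\<Sum>\<^sub>\<infinity>g\<in>{k}. ennreal (cmod d))"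
      by (rule infsum_cong_neutral) (use kF in auto)
    then have single: "(\<Sum>\<^sub>\<infinity>g\<in>?F. ennreal (if g = k then cmod d else 0)) = ennreal (cmod d)" by simp
    have "ennreal (weight t (y # ys) u) = ennreal (cmod d) + ennreal (weight t ys u)"
      using True y weight_nonneg by simp
    also have "\<dots> \<le> ennreal (cmod d) + (\<Sum>\<^sub>\<infinity>g\<in>?F. ennreal (cmod (combo ys g)))"
      using IH by (rule add_left_mono)
    also have "\<dots> = (\<Sum>\<^sub>\<infinity>g\<in>?F. ennreal (if g = k then cmod d else 0) + ennreal (cmod (combo ys g)))"
      unfolding single[symmetric] by (intro infsum_add[symmetric] nonneg_summable_on_complete) auto
    also have "\<dots> = (\<Sum>\<^sub>\<infinity>g\<in>?F. ennreal (cmod (combo (y # ys) g)))"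
      by (rule infsum_cong) (simp only: eq)
    finally show ?thesis .
  qed
qed simp

lemma unit_simple_weight:
  assumes t: "\<And>V. copen V \<Longrightarrow> copen (t ` V) \<and> t ` V \<subseteq> units G"
    and "\<And>y. y \<in> set ys \<Longrightarrow> cobis (snd y)"
  shows "unit_simple (weight t ys)"
  using assms(2)
proof (induction ys)
  case Nil
  then show ?case using unit_simple_zero by (simp add: weight_def)
next
  case (Cons y ys)
  obtain d L where y: "y = (d, L)" by fastforce
  have "unit_simple (indicator (t ` L) :: 'a \<Rightarrow> real)"
    using Cons.prems[of y] y t[OF cobisD(1)] by (intro unit_simple_indicator) auto
  moreover have "unit_simple (weight t ys)" using Cons by auto
  ultimately have "unit_simple (\<lambda>x. cmod d * indicator (t ` L) x + weight t ys x)"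
    by (rule unit_simple_binop[where h = "\<lambda>a b. cmod d * a + b"]) simp
  then show ?case unfolding y weight_Cons .
qed

end

section \<open>Almost disjoint decompositions\<close>

context steinberg_representation
begin

text \<open>The estimate for one bisection, summed up: by linearity the contents with their
  coefficients collect to \<phi> of the weight functions.\<close>

lemma combo_rep_le:
  assumes \<xi>: "\<xi> \<in> carrier H" and \<zeta>: "\<zeta> \<in> carrier H"
    and "\<And>y. y \<in> set ys \<Longrightarrow> cobis (snd y)"
  shows "Re (ip H (\<pi> (combo ys) \<xi>) \<zeta>) \<le> (\<phi> \<xi> (weight s ys) + \<phi> \<zeta> (weight r ys)) / 2"
  using assms(3)
proof (induction ys)
  case Nil
  have "weight s [] = (\<lambda>_. 0)" "weight r [] = (\<lambda>_. 0)" by auto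
  then show ?case unfolding combo_Nil pi_zero[OF \<xi>] using \<xi> \<zeta> by (simp add: ip_zero \<phi>_zero)
next
  case (Cons y ys)
  obtain d L where y: "y = (d, L)" by fastforce
  have L: "cobis L" and ys: "\<And>y. y \<in> set ys \<Longrightarrow> cobis (snd y)"
    using Cons.prems[of y] Cons.prems y by auto
  have weight: "\<phi> X (weight t (y # ys)) = cmod d * \<mu> X (t ` L) + \<phi> X (weight t ys)"
    if X: "X \<in> carrier H" and t: "\<And>V. copen V \<Longrightarrow> copen (t ` V) \<and> t ` V \<subseteq> units G" for X t
  proof -
    have u: "unit_simple (indicator (t ` L) :: 'g \<Rightarrow> real)"
      using t[OF cobisD(1)[OF L]] by (intro unit_simple_indicator) auto
    have u': "unit_simple (\<lambda>x. cmod d * indicator (t ` L) x)" by (rule unit_simple_comp[OF u]) simp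
    have "weight t (y # ys) = (\<lambda>x. cmod d * indicator (t ` L) x + weight t ys x)"
      unfolding y by (rule ext) (rule weight_Cons)
    then show ?thesis
      using \<phi>_add[OF u' unit_simple_weight[OF t ys] X] \<phi>_scale[OF u X] by simp
  qed
  note ws = weight[OF \<xi>, of s] and wr = weight[OF \<zeta>, of r]
  have st: "fscale d (indicator L) \<in> steinberg G" "combo ys \<in> steinberg G"
    using L ys steinberg_scale steinberg_indicator combo_steinberg by blast+
  have "Re (ip H (\<pi> (combo (y # ys)) \<xi>) \<zeta>) =
      Re (ip H (\<pi> (fscale d (indicator L)) \<xi>) \<zeta>) + Re (ip H (\<pi> (combo ys) \<xi>) \<zeta>)"
    unfolding y combo_Cons pi_simps(1)[OF st \<xi>] using st \<xi> \<zeta> by (simp add: ip_add)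
  also have "\<dots> \<le> cmod d * (\<mu> \<xi> (s ` L) + \<mu> \<zeta> (r ` L)) / 2 +
      (\<phi> \<xi> (weight s ys) + \<phi> \<zeta> (weight r ys)) / 2"
    using ip_indicator_le[OF L \<xi> \<zeta>, of d] Cons.IH[OF ys] by (rule add_mono)
  also have "\<dots> = (\<phi> \<xi> (weight s (y # ys)) + \<phi> \<zeta> (weight r (y # ys))) / 2"
    using ws wr copen_image by (simp add: algebra_simps add_divide_distrib)
  finally show ?case .
qed

text \<open>\<open>U\<close> will be an overlap, open but perhaps not compact, whereas \<mu> is
  meaningful on compact open sets; hence the test from inside. \<xi> is measured at sources and
  \<zeta> at ranges, as in \<open>ip_indicator_le\<close>.\<close>

definition small :: "'h \<Rightarrow> 'h \<Rightarrow> real \<Rightarrow> 'g set \<Rightarrow> bool" where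
  "small \<xi> \<zeta> e U \<longleftrightarrow> (\<forall>K. cobis K \<longrightarrow> K \<subseteq> U \<longrightarrow> \<mu> \<xi> (s ` K) + \<mu> \<zeta> (r ` K) \<le> e)"

text \<open>Pairs of list positions are compared, so a bisection that is listed twice overlaps
  itself.\<close>

abbreviation almost_disjoint :: "'h \<Rightarrow> 'h \<Rightarrow> real \<Rightarrow> (complex \<times> 'g set) list \<Rightarrow> bool" where
  "almost_disjoint \<xi> \<zeta> e \<equiv> sorted_wrt (\<lambda>x y. small \<xi> \<zeta> e (snd x \<inter> snd y))"

lemma small_mono: "\<lbrakk>small \<xi> \<zeta> e U; V \<subseteq> U\<rbrakk> \<Longrightarrow> small \<xi> \<zeta> e V"
  by (auto simp: small_def)

lemma small_empty: "\<lbrakk>\<xi> \<in> carrier H; \<zeta> \<in> carrier H; 0 \<le> e\<rbrakk> \<Longrightarrow> small \<xi> \<zeta> e {}"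
proof -
  assume *: "\<xi> \<in> carrier H" "\<zeta> \<in> carrier H" "0 \<le> e"
  have "indicator {} = (\<lambda>x :: 'g. 0 :: real)" by (simp add: fun_eq_iff)
  then show ?thesis using * by (simp add: small_def \<phi>_zero)
qed

lemma \<mu>_Un:
  assumes L: "inj_on t L" and t: "\<And>V. copen V \<Longrightarrow> copen (t ` V) \<and> t ` V \<subseteq> units G"
    and K: "copen K" "K \<subseteq> L" and K': "copen K'" "K' \<subseteq> L" and disj: "K \<inter> K' = {}" and X: "X \<in> carrier H"
  shows "\<mu> X (t ` (K \<union> K')) = \<mu> X (t ` K) + \<mu> X (t ` K')"
proof -
  have "t ` K \<inter> t ` K' = {}" using inj_on_image_Int[OF L K(2) K'(2)] disj by simp
  then have "(indicator (t ` (K \<union> K')) :: 'g \<Rightarrow> real) = (\<lambda>x. indicator (t ` K) x + indicator (t ` K') x)"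
    by (auto simp: fun_eq_iff indicator_def)
  moreover have "unit_simple (indicator (t ` K) :: 'g \<Rightarrow> real)" "unit_simple (indicator (t ` K') :: 'g \<Rightarrow> real)"
    using t[OF K(1)] t[OF K'(1)] unit_simple_indicator by blast+
  ultimately show ?thesis using \<phi>_add X by simp
qed

text \<open>
  The intersection of two compact open bisections is open, but in the absence of the Hausdorff
  property it need not be compact. It can be exhausted by compact open sets up to a set on
  which \<open>\<mu>\<^sub>\<xi>\<close> and \<open>\<mu>\<^sub>\<zeta>\<close> are at most \<open>e\<close>.
\<close>

lemma exhaust_Int:
  assumes L: "cobis L" and \<xi>: "\<xi> \<in> carrier H" and \<zeta>: "\<zeta> \<in> carrier H" and e: "e > 0"
  obtains K where "copen K" "K \<subseteq> L \<inter> W" "small \<xi> \<zeta> e ((L \<inter> W) - K)"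
proof -
  let ?\<K> = "{K. copen K \<and> K \<subseteq> L \<inter> W}"
  define \<nu> where "\<nu> K = \<mu> \<xi> (s ` K) + \<mu> \<zeta> (r ` K)" for K
  have bound: "\<nu> K \<le> (ip_norm H \<xi>)\<^sup>2 + (ip_norm H \<zeta>)\<^sup>2" if "K \<in> ?\<K>" for K
    using that \<mu>_bounds(2) copen_image \<xi> \<zeta> unfolding \<nu>_def by (intro add_mono) auto
  then have bdd: "bdd_above (\<nu> ` ?\<K>)" by (auto intro!: bdd_aboveI)
  have ne: "\<nu> ` ?\<K> \<noteq> {}" by (auto intro: exI[of _ "{}"])
  \<comment> \<open>A \<open>K\<close> whose value is within \<open>e\<close> of the supremum works:
    joining a leftover \<open>K'\<close> to it cannot exceed the supremum, and \<nu> is additive on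
    the disjoint union.\<close>
  have "Sup (\<nu> ` ?\<K>) - e < Sup (\<nu> ` ?\<K>)" using e by simp
  then obtain K where K: "K \<in> ?\<K>" "Sup (\<nu> ` ?\<K>) - e < \<nu> K"
    unfolding less_cSup_iff[OF ne bdd] by blast
  have "small \<xi> \<zeta> e ((L \<inter> W) - K)"
    unfolding small_def
  proof (intro allI impI)
    fix K' assume K': "cobis K'" "K' \<subseteq> (L \<inter> W) - K"
    have KK: "K' \<subseteq> L" "K \<inter> K' = {}" using K'(2) by auto
    have "\<nu> (K \<union> K') = \<nu> K + \<nu> K'"
      unfolding \<nu>_def
      using \<mu>_Un[OF cobisD(7)[OF L], of K K' \<xi>] \<mu>_Un[OF cobisD(6)[OF L], of K K' \<zeta>]
        K(1) KK cobisD(1)[OF K'(1)] copen_image \<xi> \<zeta> by (auto simp: algebra_simps)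
    moreover have "\<nu> (K \<union> K') \<le> Sup (\<nu> ` ?\<K>)"
      using K(1) K' cobisD(1)[OF K'(1)] by (intro cSup_upper bdd imageI) (auto intro: copen_Un)
    ultimately show "\<mu> \<xi> (s ` K') + \<mu> \<zeta> (r ` K') \<le> e" using K(2) by (simp add: \<nu>_def)
  qed
  then show thesis using that K(1) by blast
qed

text \<open>The head \<open>(d, L)\<close> is cut along a \<open>K\<close> that nearly exhausts
  \<open>L \<inter> W\<close>: \<open>L - K\<close> keeps \<open>d\<close>, \<open>K\<close>
  receives \<open>d + c\<close>, and only \<open>W - K\<close> is passed on to the tail. Two pieces
  per old entry and one remainder give the length; each piece receives \<open>c\<close> at most
  once, whence \<open>B + cmod c\<close>. The last clause, on where the new sets lie, carries the
  smallness of overlaps through the induction.\<close>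

lemma insert_bisection:
  assumes \<xi>: "\<xi> \<in> carrier H" and \<zeta>: "\<zeta> \<in> carrier H" and e: "e > 0" and B: "0 \<le> B"
  shows "\<lbrakk>\<And>x. x \<in> set xs \<Longrightarrow> cobis (snd x) \<and> cmod (fst x) \<le> B;
      almost_disjoint \<xi> \<zeta> e xs; cobis W\<rbrakk> \<Longrightarrow>
    \<exists>ys. combo ys = combo xs + fscale c (indicator W) \<and>
      (\<forall>y\<in>set ys. cobis (snd y) \<and> cmod (fst y) \<le> B + cmod c) \<and>
      almost_disjoint \<xi> \<zeta> e ys \<and> length ys = 2 * length xs + 1 \<and>
      (\<forall>y\<in>set ys. snd y \<subseteq> W \<or> (\<exists>x\<in>set xs. snd y \<subseteq> snd x))"
proof (induction xs arbitrary: W)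
  case Nil
  then show ?case using B by (intro exI[of _ "[(c, W)]"]) auto
next
  case (Cons x xs)
  obtain d L where x: "x = (d, L)" by fastforce
  have L: "cobis L" and d: "cmod d \<le> B" using Cons.prems(1)[of x] x by auto
  obtain K where K: "copen K" "K \<subseteq> L \<inter> W" "small \<xi> \<zeta> e ((L \<inter> W) - K)"
    by (rule exhaust_Int[OF L \<xi> \<zeta> e])
  then have KL: "K \<subseteq> L" and KW: "K \<subseteq> W" by auto
  have small_L: "small \<xi> \<zeta> e (L \<inter> snd z)" if "z \<in> set xs" for z
    using Cons.prems(2) that x by simp
  have WK: "cobis (W - K)" by (rule cobis_Diff[OF Cons.prems(3) K(1) KW])
  have prems: "\<And>x. x \<in> set xs \<Longrightarrow> cobis (snd x) \<and> cmod (fst x) \<le> B"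
      "almost_disjoint \<xi> \<zeta> e xs"
    using Cons.prems(1,2) by simp_all
  obtain ys where ys: "combo ys = combo xs + fscale c (indicator (W - K))"
      "\<forall>y\<in>set ys. cobis (snd y) \<and> cmod (fst y) \<le> B + cmod c"
      "almost_disjoint \<xi> \<zeta> e ys" "length ys = 2 * length xs + 1"
      "\<forall>y\<in>set ys. snd y \<subseteq> W - K \<or> (\<exists>x\<in>set xs. snd y \<subseteq> snd x)"
    using Cons.IH[OF prems WK] by blast
  let ?ys = "(d, L - K) # (d + c, K) # ys"
  have "combo ?ys = combo (x # xs) + fscale c (indicator W)"
  proof
    fix g
    have "indicator K g = (1 :: complex) \<Longrightarrow> g \<in> L \<and> g \<in> W"
      using K(2) by (auto simp: indicator_def split: if_splits)
    then show "combo ?ys g = (combo (x # xs) + fscale c (indicator W)) g"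
      using K(2) x ys(1) by (auto simp: fscale_def indicator_def)
  qed
  moreover have "\<forall>y\<in>set ?ys. cobis (snd y) \<and> cmod (fst y) \<le> B + cmod c"
  proof -
    have "cmod (d + c) \<le> B + cmod c" using norm_triangle_ineq[of d c] d by simp
    moreover have "cmod d \<le> B + cmod c" using d by (simp add: add_increasing2)
    ultimately show ?thesis using ys(2) cobis_Diff[OF L K(1) KL] cobis_subset[OF L K(1) KL] by simp
  qed
  moreover have "almost_disjoint \<xi> \<zeta> e ?ys"
  proof -
    have e0: "small \<xi> \<zeta> e {}" using small_empty[OF \<xi> \<zeta>] e by simp
    moreover have "(L - K) \<inter> K = {}" by auto
    ultimately have "small \<xi> \<zeta> e ((L - K) \<inter> K)" by (simp only:)
    moreover have "small \<xi> \<zeta> e ((L - K) \<inter> snd y) \<and> small \<xi> \<zeta> e (K \<inter> snd y)" if y: "y \<in> set ys" for y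
    proof (cases "snd y \<subseteq> W - K")
      \<comment> \<open>A piece of the remainder \<open>W - K\<close> meets \<open>L - K\<close>
        only inside the small set \<open>(L \<inter> W) - K\<close>, and it does not meet
        \<open>K\<close>.\<close>
      case True
      then have "(L - K) \<inter> snd y \<subseteq> (L \<inter> W) - K" "K \<inter> snd y \<subseteq> {}" by auto
      then show ?thesis using small_mono K(3) e0 by metis
    next
      \<comment> \<open>A piece of an old set inherits smallness from the overlap of
        \<open>L\<close> with that set.\<close>
      case False
      then obtain z where z: "z \<in> set xs" "snd y \<subseteq> snd z" using ys(5) y by blast
      then have "(L - K) \<inter> snd y \<subseteq> L \<inter> snd z" "K \<inter> snd y \<subseteq> L \<inter> snd z" using KL by auto
      then show ?thesis using small_mono small_L[OF z(1)] by metis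
    qed
    ultimately show ?thesis using ys(3) by simp
  qed
  moreover have "length ?ys = 2 * length (x # xs) + 1" using ys(4) by simp
  moreover have "\<forall>y\<in>set ?ys. snd y \<subseteq> W \<or> (\<exists>z\<in>set (x # xs). snd y \<subseteq> snd z)"
    using ys(5) KW x by auto
  ultimately show ?case by blast
qed

text \<open>\<open>N\<close> and \<open>B\<close> come before \<xi>, \<zeta> and \<open>e\<close>:
  they obey the recursions \<open>2 * N + 1\<close> and \<open>B + cmod z\<close> along one fixed
  expression of \<open>a\<close> by indicators, and only the list \<open>ys\<close> depends on the
  rest.\<close>

lemma steinberg_decompose:
  assumes "a \<in> steinberg G"
  shows "\<exists>N B. 0 \<le> B \<and> (\<forall>\<xi>\<in>carrier H. \<forall>\<zeta>\<in>carrier H. \<forall>e>0. \<exists>ys. combo ys = a \<and> length ys \<le> N \<and>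
      (\<forall>y\<in>set ys. cobis (snd y) \<and> cmod (fst y) \<le> B) \<and>
      almost_disjoint \<xi> \<zeta> e ys)"
  using assms
proof (induction rule: steinberg_induct)
  case zero
  show ?case by (rule exI[of _ 0], rule exI[of _ 0]) (auto intro!: exI[of _ "[]"] simp: combo_def)
next
  case (plus z W a)
  then obtain N B where B: "0 \<le> B" and NB: "\<And>\<xi> \<zeta> e. \<lbrakk>\<xi> \<in> carrier H; \<zeta> \<in> carrier H; e > 0\<rbrakk> \<Longrightarrow>
      \<exists>ys. combo ys = a \<and> length ys \<le> N \<and> (\<forall>y\<in>set ys. cobis (snd y) \<and> cmod (fst y) \<le> B) \<and>
        almost_disjoint \<xi> \<zeta> e ys" by blast
  show ?case
  proof (rule exI[of _ "2 * N + 1"], rule exI[of _ "B + cmod z"], intro conjI ballI allI impI)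
    show "0 \<le> B + cmod z" using B by simp
    fix \<xi> \<zeta> and e :: real assume *: "\<xi> \<in> carrier H" "\<zeta> \<in> carrier H" "e > 0"
    obtain xs where xs: "combo xs = a" "length xs \<le> N" "\<And>y. y \<in> set xs \<Longrightarrow> cobis (snd y) \<and> cmod (fst y) \<le> B"
        "almost_disjoint \<xi> \<zeta> e xs"
      using NB[OF *] by blast
    obtain ys where ys: "combo ys = combo xs + fscale z (indicator W)"
      "\<forall>y\<in>set ys. cobis (snd y) \<and> cmod (fst y) \<le> B + cmod z"
      "almost_disjoint \<xi> \<zeta> e ys" "length ys = 2 * length xs + 1"
      using insert_bisection[OF * B xs(3,4) plus(1), of z] by blast
    have "combo ys = fscale z (indicator W) + a" unfolding ys(1) xs(1) by (rule add.commute)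
    then show "\<exists>ys. combo ys = fscale z (indicator W) + a \<and> length ys \<le> 2 * N + 1 \<and>
        (\<forall>y\<in>set ys. cobis (snd y) \<and> cmod (fst y) \<le> B + cmod z) \<and>
        almost_disjoint \<xi> \<zeta> e ys"
      using ys xs(2) by (intro exI[of _ ys]) auto
  qed
qed

text \<open>The sets \<open>U i\<close> may be noncompact, so compactness of \<open>E\<close> is
  used to shrink them to compact open \<open>K i\<close> that still cover. Subadditivity is then a
  comparison of indicator functions under \<phi>.\<close>

lemma \<mu>_cover:
  fixes e :: real
  assumes E: "copen E" "E \<subseteq> units G" and I: "finite I"
    and U: "\<And>i. i \<in> I \<Longrightarrow> openin (arrows G) (U i) \<and> bisection G (U i)"
    and cover: "E \<subseteq> (\<Union>i\<in>I. t ` U i)"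
    and t: "\<And>V. copen V \<Longrightarrow> copen (t ` V) \<and> t ` V \<subseteq> units G" and X: "X \<in> carrier H"
    and le: "\<And>i K. \<lbrakk>i \<in> I; cobis K; K \<subseteq> U i\<rbrakk> \<Longrightarrow> \<mu> X (t ` K) \<le> e"
  shows "\<mu> X E \<le> card I * e"
proof -
  define Q where "Q K \<longleftrightarrow> (\<exists>i\<in>I. \<exists>V. cobis V \<and> V \<subseteq> U i \<and> K = t ` V)" for K
  have ex: "\<exists>K. cobis K \<and> x \<in> K \<and> Q K" if x: "x \<in> E" for x
  proof -
    obtain i g where g: "i \<in> I" "g \<in> U i" "x = t g" using cover x by blast
    obtain V where V: "cobis V" "g \<in> V" "V \<subseteq> U i" using cobis_basis U g by metis
    have "cobis (t ` V)" using t[OF cobisD(1)[OF V(1)]] cobis_units by blast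
    then show ?thesis using V g unfolding Q_def by blast
  qed
  obtain \<W> where \<W>: "finite \<W>" "\<And>W. W \<in> \<W> \<Longrightarrow> cobis W \<and> Q W" "E \<subseteq> \<Union>\<W>"
    using compact_cover[OF copenD(2)[OF E(1)] ex] by blast
  then have "\<forall>W\<in>\<W>. \<exists>i V. i \<in> I \<and> cobis V \<and> V \<subseteq> U i \<and> W = t ` V" unfolding Q_def by blast
  then obtain idx V where iV: "\<And>W. W \<in> \<W> \<Longrightarrow> idx W \<in> I \<and> cobis (V W) \<and> V W \<subseteq> U (idx W) \<and> W = t ` V W"
    by metis
  \<comment> \<open>The covering sets are regrouped by the index they came from, since the bound
    must count \<open>I\<close> and not the uncontrolled number of covering sets. The union stays
    inside \<open>U i\<close> and is therefore a bisection again.\<close>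
  define K where "K i = (\<Union>W\<in>{W \<in> \<W>. idx W = i}. V W)" for i
  have KU: "K i \<subseteq> U i" for i using iV by (auto simp: K_def)
  have Kc: "copen (K i)" for i
    unfolding K_def using \<W>(1) iV cobisD(1) by (intro copen_UN) auto
  have Kb: "cobis (K i)" if "i \<in> I" for i
    using Kc U[OF that] KU bisection_mono by (auto simp: cobis_def)
  have EK: "E \<subseteq> (\<Union>i\<in>I. t ` K i)"
  proof
    fix x assume "x \<in> E"
    then obtain W where W: "W \<in> \<W>" "x \<in> W" using \<W>(3) by blast
    then have "V W \<subseteq> K (idx W)" by (auto simp: K_def)
    then show "x \<in> (\<Union>i\<in>I. t ` K i)" using iV[OF W(1)] W(2) by blast
  qed
  have us: "unit_simple (indicator (t ` K i) :: 'g \<Rightarrow> real)" for i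
    using t[OF Kc] by (intro unit_simple_indicator) auto
  have "\<mu> X E \<le> \<phi> X (\<lambda>x. \<Sum>i\<in>I. indicator (t ` K i) x)"
  proof (rule \<phi>_mono[OF unit_simple_indicator[OF E] unit_simple_sum[OF us] _ X])
    fix x
    show "indicator E x \<le> (\<Sum>i\<in>I. indicator (t ` K i) x :: real)"
    proof (cases "x \<in> E")
      case True
      then obtain i where i: "i \<in> I" "x \<in> t ` K i" using EK by blast
      have "(1 :: real) = indicator (t ` K i) x" using i by simp
      also have "\<dots> \<le> (\<Sum>i\<in>I. indicator (t ` K i) x)"
        by (rule member_le_sum[OF i(1) _ I]) simp
      finally show ?thesis using True by simp
    qed (simp add: sum_nonneg)
  qed
  also have "\<dots> = (\<Sum>i\<in>I. \<mu> X (t ` K i))" by (rule \<phi>_sum[OF us X])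
  also have "\<dots> \<le> (\<Sum>i\<in>I. e)" using le Kb KU by (intro sum_mono) auto
  finally show ?thesis by simp
qed

text \<open>On \<open>E\<close>, where the weight exceeds \<open>M\<close>,
  \<open>weight_le_fibre\<close> forces two of the bisections to meet over the point. There are at
  most \<open>N * N\<close> pairs, each of content at most \<open>e\<close>, and the weight never
  exceeds \<open>N * B\<close>; off \<open>E\<close> it is at most \<open>M\<close>.\<close>

lemma \<phi>_weight_le:
  assumes t: "\<And>V. copen V \<Longrightarrow> copen (t ` V) \<and> t ` V \<subseteq> units G" and inj: "\<And>W. cobis W \<Longrightarrow> inj_on t W"
    and X: "X \<in> carrier H"
    and ys: "\<And>y. y \<in> set ys \<Longrightarrow> cobis (snd y)" "\<And>y. y \<in> set ys \<Longrightarrow> cmod (fst y) \<le> B" "0 \<le> B" "length ys \<le> N"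
    and M: "0 \<le> M" "\<And>u. u \<in> units G \<Longrightarrow> (\<Sum>\<^sub>\<infinity>g\<in>{g \<in> arr. t g = u}. ennreal (cmod (combo ys g))) \<le> ennreal M"
    and e: "0 \<le> e" and small: "sorted_wrt (\<lambda>x y. \<forall>K. cobis K \<longrightarrow> K \<subseteq> snd x \<inter> snd y \<longrightarrow> \<mu> X (t ` K) \<le> e) ys"
  shows "\<phi> X (weight t ys) \<le> M * (ip_norm H X)\<^sup>2 + N * B * (real (N * N) * e)"
proof -
  let ?F = "weight t ys"
  have us: "unit_simple ?F" by (rule unit_simple_weight[OF t ys(1)])
  define E where "E = {x \<in> units G. ?F x > M}"
  \<comment> \<open>The constant \<open>M\<close> may lack compact support; cut down to
    \<open>S\<close> it becomes an admissible argument of \<phi>.\<close>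
  define S where "S = {x \<in> units G. ?F x \<noteq> 0}"
  have E: "copen E" "E \<subseteq> units G" and S: "copen S" "S \<subseteq> units G"
    using copen_unit_simple[OF us, of "\<lambda>v. v > M"] copen_unit_simple[OF us, of "\<lambda>v. v \<noteq> 0"] M(1)
    by (auto simp: E_def S_def)
  let ?n = "length ys"
  define I where "I = {(i, j). i < j \<and> j < ?n}"
  have Isub: "I \<subseteq> {..<?n} \<times> {..<?n}" by (auto simp: I_def)
  then have I: "finite I" using finite_subset by blast
  have "card I \<le> ?n * ?n" using card_mono[OF _ Isub] by (simp add: card_cartesian_product)
  also have "\<dots> \<le> N * N" using ys(4) by (intro mult_le_mono)
  finally have cardI: "real (card I) \<le> real (N * N)" by (simp only: of_nat_le_iff)
  have ml: "\<mu> X E \<le> card I * e"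
  proof (rule \<mu>_cover[OF E I _ _ t X, where U = "\<lambda>(i, j). snd (ys ! i) \<inter> snd (ys ! j)"])
    fix p assume p: "p \<in> I"
    obtain i j where ij: "p = (i, j)" "i < j" "j < ?n" using p by (auto simp: I_def)
    then have c: "cobis (snd (ys ! i))" "cobis (snd (ys ! j))" using ys(1) by auto
    show "openin (arrows G) (case p of (i, j) \<Rightarrow> snd (ys ! i) \<inter> snd (ys ! j)) \<and>
        bisection G (case p of (i, j) \<Rightarrow> snd (ys ! i) \<inter> snd (ys ! j))"
      using c ij cobisD(3) bisection_mono[OF cobisD(2)[OF c(1)]] by (auto intro: openin_Int)
    fix K assume K: "cobis K" "K \<subseteq> (case p of (i, j) \<Rightarrow> snd (ys ! i) \<inter> snd (ys ! j))"
    show "\<mu> X (t ` K) \<le> e"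
      using sorted_wrt_nth_less[OF small ij(2,3)] K ij(1) by simp
  next
    show "E \<subseteq> (\<Union>p\<in>I. t ` (case p of (i, j) \<Rightarrow> snd (ys ! i) \<inter> snd (ys ! j)))"
    proof
      fix u assume u: "u \<in> E"
      have "\<not> sorted_wrt (\<lambda>x y. u \<notin> t ` (snd x \<inter> snd y)) ys"
      proof
        assume "sorted_wrt (\<lambda>x y. u \<notin> t ` (snd x \<inter> snd y)) ys"
        from order_trans[OF weight_le_fibre[OF inj ys(1) this] M(2)]
        have "ennreal (?F u) \<le> ennreal M" using u by (simp add: E_def)
        then show False using u M(1) by (simp add: E_def)
      qed
      then obtain i j where "i < j" "j < ?n" "u \<in> t ` (snd (ys ! i) \<inter> snd (ys ! j))"
        by (auto simp: sorted_wrt_iff_nth_less)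
      then show "u \<in> (\<Union>p\<in>I. t ` (case p of (i, j) \<Rightarrow> snd (ys ! i) \<inter> snd (ys ! j)))"
        by (intro UN_I[of "(i, j)"]) (auto simp: I_def)
    qed
  qed
  have iS: "unit_simple (indicator S :: 'g \<Rightarrow> real)" and iE: "unit_simple (indicator E :: 'g \<Rightarrow> real)"
    using S E unit_simple_indicator by blast+
  have uM: "unit_simple (\<lambda>x. M * indicator S x)" by (rule unit_simple_comp[OF iS]) simp
  have uN: "unit_simple (\<lambda>x. (N * B) * indicator E x)" by (rule unit_simple_comp[OF iE]) simp
  have "\<phi> X ?F \<le> \<phi> X (\<lambda>x. M * indicator S x + (N * B) * indicator E x)"
  proof (rule \<phi>_mono[OF us unit_simple_binop[OF uM uN, where h = "(+)"] _ X])
    fix x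
    have "?F x \<le> ?n * B" by (rule weight_le[OF ys(2,3)])
    also have "\<dots> \<le> N * B" using ys(3,4) by (intro mult_right_mono) auto
    finally have FN: "?F x \<le> N * B" .
    show "?F x \<le> M * indicator S x + (N * B) * indicator E x"
    proof (cases "x \<in> units G")
      case True
      then show ?thesis
        using FN M(1) ys(3) by (cases "x \<in> E"; cases "x \<in> S") (auto simp: E_def S_def intro: add_increasing)
    next
      case False
      then show ?thesis using unit_simple_zero_off[OF us False] M(1) ys(3) by simp
    qed
  qed simp
  also have "\<dots> = M * \<mu> X S + (N * B) * \<mu> X E"
    using \<phi>_add[OF uM uN X] \<phi>_scale[OF iS X] \<phi>_scale[OF iE X] by simp
  also have "\<dots> \<le> M * (ip_norm H X)\<^sup>2 + N * B * (real (N * N) * e)"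
  proof (intro add_mono mult_left_mono)
    show "\<mu> X S \<le> (ip_norm H X)\<^sup>2" by (rule \<mu>_bounds(2)[OF S X])
    have "card I * e \<le> real (N * N) * e" using cardI e by (rule mult_right_mono)
    then show "\<mu> X E \<le> real (N * N) * e" using ml by linarith
  qed (use M(1) ys(3) in auto)
  finally show ?thesis .
qed

text \<open>The bound is kept as a sum of squares because this form is additive in the contents and
  can be summed over bisections; the product form is recovered afterwards by normalising
  vectors.\<close>

lemma Re_ip_le_I_norm:
  assumes a: "a \<in> steinberg G" and M: "0 \<le> M" "I_norm G a \<le> ennreal M"
    and \<xi>: "\<xi> \<in> carrier H" and \<zeta>: "\<zeta> \<in> carrier H"
  shows "Re (ip H (\<pi> a \<xi>) \<zeta>) \<le> M * ((ip_norm H \<xi>)\<^sup>2 + (ip_norm H \<zeta>)\<^sup>2) / 2"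
proof -
  obtain N B where B: "0 \<le> B" and NB: "\<And>e. e > 0 \<Longrightarrow>
      \<exists>ys. combo ys = a \<and> length ys \<le> N \<and> (\<forall>y\<in>set ys. cobis (snd y) \<and> cmod (fst y) \<le> B) \<and>
        almost_disjoint \<xi> \<zeta> e ys"
    using steinberg_decompose[OF a] \<xi> \<zeta> by blast
  \<comment> \<open>The error factor of \<open>\<phi>_weight_le\<close>, fixed before
    \<open>e\<close>; the two halves for \<xi> and \<zeta> add up to it.\<close>
  define C where "C = real N * B * real (N * N)"
  have C: "C \<ge> 0" using B by (simp add: C_def)
  have main: "Re (ip H (\<pi> a \<xi>) \<zeta>) \<le> M * ((ip_norm H \<xi>)\<^sup>2 + (ip_norm H \<zeta>)\<^sup>2) / 2 + C * e" if e: "e > 0" for e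
  proof -
    obtain ys where ys: "combo ys = a" "length ys \<le> N" "\<And>y. y \<in> set ys \<Longrightarrow> cobis (snd y)"
        "\<And>y. y \<in> set ys \<Longrightarrow> cmod (fst y) \<le> B" and sm: "almost_disjoint \<xi> \<zeta> e ys"
      using NB[OF e] by blast
    have nn: "0 \<le> \<mu> \<xi> (s ` K)" "0 \<le> \<mu> \<zeta> (r ` K)" if "cobis K" for K
      using copen_image[OF cobisD(1)[OF that]] \<mu>_bounds(1) \<xi> \<zeta> by blast+
    have sm_s: "sorted_wrt (\<lambda>x y. \<forall>K. cobis K \<longrightarrow> K \<subseteq> snd x \<inter> snd y \<longrightarrow> \<mu> \<xi> (s ` K) \<le> e) ys"
      and sm_r: "sorted_wrt (\<lambda>x y. \<forall>K. cobis K \<longrightarrow> K \<subseteq> snd x \<inter> snd y \<longrightarrow> \<mu> \<zeta> (r ` K) \<le> e) ys"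
      by (rule sorted_wrt_mono_rel[OF _ sm], use nn in \<open>force simp: small_def\<close>)+
    have Is: "(\<Sum>\<^sub>\<infinity>g\<in>{g \<in> arr. s g = u}. ennreal (cmod (combo ys g))) \<le> ennreal M"
      and Ir: "(\<Sum>\<^sub>\<infinity>g\<in>{g \<in> arr. r g = u}. ennreal (cmod (combo ys g))) \<le> ennreal M"
      if "u \<in> units G" for u
    proof -
      have "(\<Sum>\<^sub>\<infinity>g\<in>source_fibre G u. ennreal (cmod (a g))) \<le> I_norm G a"
        unfolding I_norm_def using that by (intro max.coboundedI1 SUP_upper)
      then show "(\<Sum>\<^sub>\<infinity>g\<in>{g \<in> arr. s g = u}. ennreal (cmod (combo ys g))) \<le> ennreal M"
        using M(2) ys(1) by (simp add: source_fibre_def)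
      have "(\<Sum>\<^sub>\<infinity>g\<in>range_fibre G u. ennreal (cmod (a g))) \<le> I_norm G a"
        unfolding I_norm_def using that by (intro max.coboundedI2 SUP_upper)
      then show "(\<Sum>\<^sub>\<infinity>g\<in>{g \<in> arr. r g = u}. ennreal (cmod (combo ys g))) \<le> ennreal M"
        using M(2) ys(1) by (simp add: range_fibre_def)
    qed
    have "\<phi> \<xi> (weight s ys) \<le> M * (ip_norm H \<xi>)\<^sup>2 + N * B * ((N * N) * e)"
      using \<phi>_weight_le[of s \<xi> ys B N M e, OF _ cobisD(7) \<xi> ys(3,4) B ys(2) M(1) Is _ sm_s] copen_image e
      by simp
    moreover have "\<phi> \<zeta> (weight r ys) \<le> M * (ip_norm H \<zeta>)\<^sup>2 + N * B * ((N * N) * e)"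
      using \<phi>_weight_le[of r \<zeta> ys B N M e, OF _ cobisD(6) \<zeta> ys(3,4) B ys(2) M(1) Ir _ sm_r] copen_image e
      by simp
    moreover have "Re (ip H (\<pi> a \<xi>) \<zeta>) \<le> (\<phi> \<xi> (weight s ys) + \<phi> \<zeta> (weight r ys)) / 2"
      using combo_rep_le[OF \<xi> \<zeta>, of ys] ys(1,3) by simp
    ultimately show ?thesis by (simp add: C_def field_simps)
  qed
  show ?thesis
  proof (rule field_le_epsilon)
    fix \<delta> :: real assume \<delta>: "\<delta> > 0"
    \<comment> \<open>The summand 1 covers the case \<open>C = 0\<close>.\<close>
    have "C * (\<delta> / (C + 1)) \<le> \<delta>" using C \<delta> by (simp add: field_simps)
    then show "Re (ip H (\<pi> a \<xi>) \<zeta>) \<le> M * ((ip_norm H \<xi>)\<^sup>2 + (ip_norm H \<zeta>)\<^sup>2) / 2 + \<delta>"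
      using main[of "\<delta> / (C + 1)"] C \<delta> by simp
  qed
qed

text \<open>Take \<zeta> to be the unit vector in the direction of \<pi>(a)\<xi>: the inner product
  becomes the norm, and for \<xi> in the unit ball the bound by squares is at most
  \<open>M\<close>.\<close>

lemma norm_le_I_norm:
  assumes a: "a \<in> steinberg G" and M: "0 \<le> M" "I_norm G a \<le> ennreal M" and \<xi>: "\<xi> \<in> carrier H"
  shows "ip_norm H (\<pi> a \<xi>) \<le> M * ip_norm H \<xi>"
proof -
  have "ip_norm H (\<pi> a \<xi>) \<le> M" if \<xi>: "\<xi> \<in> carrier H" and le: "ip_norm H \<xi> \<le> 1" for \<xi>
  proof (cases "\<pi> a \<xi> = \<zero>")
    case True
    then show ?thesis using M ip_norm_eq_0[of \<zero>] by simp
  next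
    case False
    let ?x = "\<pi> a \<xi>"
    have x: "?x \<in> carrier H" using a \<xi> by simp
    let ?n = "ip_norm H ?x"
    have n: "?n > 0" using False ip_norm_eq_0[OF x] ip_norm_nonneg[OF x] by linarith
    let ?\<zeta> = "complex_of_real (1 / ?n) \<odot> ?x"
    have \<zeta>: "?\<zeta> \<in> carrier H" "ip_norm H ?\<zeta> = 1"
      using x n by (simp_all add: ip_norm_smult del: of_real_divide)
    have "Re (ip H ?x ?\<zeta>) = (1 / ?n) * Re (ip H ?x ?x)"
      using x by (simp add: ip_smult2 del: of_real_divide)
    also have "\<dots> = ?n" using n by (simp flip: ip_norm_sq[OF x] add: power2_eq_square)
    finally have "?n = Re (ip H ?x ?\<zeta>)" ..
    also have "\<dots> \<le> M * ((ip_norm H \<xi>)\<^sup>2 + (ip_norm H ?\<zeta>)\<^sup>2) / 2"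
      by (rule Re_ip_le_I_norm[OF a M \<xi> \<zeta>(1)])
    also have "\<dots> \<le> M * (1 + 1) / 2"
      using M(1) le \<zeta>(2) ip_norm_nonneg[OF \<xi>] by (intro divide_right_mono mult_left_mono add_mono) (auto simp: power_le_one)
    finally show ?thesis by simp
  qed
  then have "op_norm H (\<pi> a) \<le> ennreal M"
    unfolding op_norm_def by (intro SUP_least ennreal_leI) auto
  then show ?thesis using op_norm_le_ennreal_iff[OF pi_linear[OF a] M(1)] \<xi> by blast
qed

lemma op_norm_le_I_norm:
  assumes a: "a \<in> steinberg G"
  shows "op_norm H (\<pi> a) \<le> I_norm G a"
proof (cases "I_norm G a")
  case (real M)
  then show ?thesis
    using op_norm_le_ennreal_iff[OF pi_linear[OF a], of M] norm_le_I_norm[OF a, of M] by simp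
qed simp

end

section \<open>Representations of \<open>C\<^sub>c(G)\<close>\<close>

text \<open>Multiplying \<open>x\<close> by a phase makes the inner product real and nonnegative,
  which reduces this to the bound on real parts.\<close>

lemma (in pre_hilbert_space) cmod_ip_le:
  assumes x: "x \<in> carrier H" and y: "y \<in> carrier H"
  shows "cmod (ip H x y) \<le> ip_norm H x * ip_norm H y"
proof (cases "ip H x y = 0")
  case False
  define u where "u = cnj (ip H x y) / cmod (ip H x y)"
  have u: "cmod u = 1" using False by (simp add: u_def norm_divide)
  have "u * ip H x y = cmod (ip H x y)"
    using False complex_norm_square[of "ip H x y"]
    by (simp add: u_def divide_eq_eq mult.commute power2_eq_square)
  then have "cmod (ip H x y) = Re (ip H (u \<odot> x) y)" using x y by (simp add: ip_smult)
  also have "\<dots> \<le> ip_norm H (u \<odot> x) * ip_norm H y" using x y by (intro Re_ip_le) auto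
  finally show ?thesis using x u by (simp add: ip_norm_smult)
qed (use x y in simp)

context ample_groupoid
begin

text \<open>
  This bounds \<open>\<pi>(f)\<close> by \<open>c\<close> in every representation, bounded or not, because \<open>\<pi>(h\<^sup>* h)\<close> is positive.
\<close>

lemma CB_complement:
  assumes W: "cobis W" and f: "f \<in> CB W" and c: "\<And>g. cmod (f g) \<le> c"
  obtains h where "h \<in> CB (s ` W)"
    "conv G (fstar G f) f + conv G (fstar G h) h = fscale (complex_of_real (c\<^sup>2)) (indicator (s ` W))"
proof -
  note cW = cobisD[OF W]
  note img = copen_image[OF cW(1)]
  have arrW: "g \<in> arr" if "g \<in> W" for g using cW(5) that by auto
  obtain \<tau> where \<tau>: "continuous_map (subtopology (unit_space G) (s ` W)) (arrows G) \<tau>"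
      "\<And>g. g \<in> W \<Longrightarrow> \<tau> (s g) = g"
    using bisection_section[OF cW(3,7) continuous_s open_map_s] by blast
  \<comment> \<open>\<open>conv G (fstar G f) f\<close> lives on the units and takes at
    \<open>s g\<close> the square of \<open>cmod (f g)\<close>. \<open>h\<close> is the square root
    of what is missing to the square of \<open>c\<close>, where \<open>\<tau>\<close> recovers
    \<open>g\<close> from its source.\<close>
  define h where "h x = (if x \<in> s ` W then complex_of_real (sqrt (c\<^sup>2 - (cmod (f (\<tau> x)))\<^sup>2)) else 0)" for x
  have sub: "subtopology (unit_space G) (s ` W) = subtopology (arrows G) (s ` W)"
    using img(4) by (simp add: unit_space_def subtopology_subtopology Int_absorb1)
  have "continuous_map (subtopology (arrows G) (s ` W)) (subtopology (arrows G) W) \<tau>"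
    using \<tau> by (intro continuous_map_into_subtopology) (auto simp: sub)
  then have "continuous_map (subtopology (arrows G) (s ` W)) euclidean (\<lambda>x. f (\<tau> x))"
    using f continuous_map_compose[of _ _ \<tau> euclidean f] by (simp add: CB_def o_def)
  from continuous_map_compose[OF this, of euclidean "\<lambda>z. complex_of_real (sqrt (c\<^sup>2 - (cmod z)\<^sup>2))"]
  have "continuous_map (subtopology (arrows G) (s ` W)) euclidean
      (\<lambda>x. complex_of_real (sqrt (c\<^sup>2 - (cmod (f (\<tau> x)))\<^sup>2)))"
    by (simp add: o_def continuous_intros)
  then have "continuous_map (subtopology (arrows G) (s ` W)) euclidean h"
    by (rule continuous_map_eq) (auto simp: h_def)
  then have hCB: "h \<in> CB (s ` W)" by (simp add: CB_def h_def)
  have h0: "g \<notin> units G \<Longrightarrow> h g = 0" for g using img(4) by (auto simp: h_def)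
  have hh: "conv G (fstar G h) h = (\<lambda>g. cnj (h g) * h g)"
    using fstar_units[of h] conv_units_units[of "\<lambda>g. cnj (h g)" h] h0 by simp
  note cI = cobisD[OF cobis_iv[OF W]]
  have ff0: "conv G (fstar G f) f x = 0" if "x \<notin> s ` W" for x
    using conv_support[of "iv ` W" "fstar G f" W f x] cI(5,6) CB_zero[OF fstar_CB[OF W f]] CB_zero[OF f] that
    by (simp add: bprod_iv(1)[OF W])
  have ff: "conv G (fstar G f) f (s g) = cnj (f g) * f g" if g: "g \<in> W" for g
  proof -
    have "conv G (fstar G f) f (s g) = fstar G f (iv g) * f (iv (iv g) \<cdot> s g)"
      by (rule conv_at[of "iv ` W"])
        (use cI(5,6) CB_zero[OF fstar_CB[OF W f]] g arrW[OF g] in auto)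
    then show ?thesis using arrW[OF g] by (simp add: fstar_def)
  qed
  have "(conv G (fstar G f) f + conv G (fstar G h) h) x = fscale (complex_of_real (c\<^sup>2)) (indicator (s ` W)) x" for x
  proof (cases "x \<in> s ` W")
    case True
    then obtain g where g: "g \<in> W" "x = s g" by auto
    have "(cmod (f g))\<^sup>2 \<le> c\<^sup>2" using c[of g] by (intro power_mono) auto
    then have "cnj (h x) * h x = complex_of_real (c\<^sup>2 - (cmod (f g))\<^sup>2)"
      using True g \<tau>(2)[OF g(1)] by (simp add: h_def flip: of_real_mult)
    moreover have "cnj (f g) * f g = complex_of_real ((cmod (f g))\<^sup>2)"
      using complex_norm_square[of "f g"] by (simp add: mult.commute)
    ultimately show ?thesis using True ff[OF g(1)] g(2) hh by (simp add: fscale_def flip: of_real_add)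
  next
    case False
    then show ?thesis using ff0 hh by (simp add: fscale_def h_def)
  qed
  then show thesis using that[OF hCB] by blast
qed

end

locale Cc_representation = ample_groupoid G + representation "Cc_alg G" H \<pi>
  for G :: "'g groupoid_data" and H :: "'h inner_space" (structure) and \<pi>
begin

text \<open>Restriction to the Steinberg algebra, which makes the bound on \<mu> available for
  indicators of sets of units.\<close>

sublocale steinberg: steinberg_representation G H \<pi>
proof (unfold_locales, goal_cases)
  case (1 a) then show ?case using rep_linear_operator steinberg_Cc by simp
next
  case (2 a b \<xi>) then show ?case using rep_add[of a b \<xi>] steinberg_Cc by simp
next
  case (3 a \<xi> c) then show ?case using rep_smult[of a \<xi> c] steinberg_Cc by simp
next
  case (4 a b \<xi>) then show ?case using rep_mult[of a b \<xi>] steinberg_Cc by simp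
next
  case (5 a \<xi> \<zeta>) then show ?case using rep_star[of a \<xi> \<zeta>] steinberg_Cc by simp
qed

lemma CB_norm_le:
  assumes W: "cobis W" and f: "f \<in> CB W" and c: "\<And>g. cmod (f g) \<le> c" and \<xi>: "\<xi> \<in> carrier H"
  shows "ip_norm H (\<pi> f \<xi>) \<le> c * ip_norm H \<xi>"
proof -
  obtain h where h: "h \<in> CB (s ` W)"
      "conv G (fstar G f) f + conv G (fstar G h) h = fscale (complex_of_real (c\<^sup>2)) (indicator (s ` W))"
    using CB_complement[OF W f c] by blast
  note img = copen_image[OF cobisD(1)[OF W]]
  have sW: "cobis (s ` W)" by (rule cobis_units[OF img(2,4)])
  have Cc: "f \<in> Cc G" "h \<in> Cc G" "indicator (s ` W) \<in> Cc G"
    using CB_subset_Cc[OF W] CB_subset_Cc[OF sW] f h(1) steinberg_Cc[OF steinberg_indicator[OF sW]] by auto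
  interpret A: star_algebra "Cc_alg G" by (rule star_algebra_Cc)
  have cc: "conv G (fstar G f) f \<in> Cc G" "conv G (fstar G h) h \<in> Cc G"
    using A.mult_closed A.star_closed Cc by simp_all
  have cl: "\<pi> a \<xi> \<in> carrier H" if "a \<in> Cc G" for a
    using rep_linear_operator[of a] that \<xi> by (auto simp: linear_operator_def)
  have c0: "0 \<le> c" using c order_trans norm_ge_zero by blast
  have "(ip_norm H (\<pi> f \<xi>))\<^sup>2 \<le> (ip_norm H (\<pi> f \<xi>))\<^sup>2 + (ip_norm H (\<pi> h \<xi>))\<^sup>2" by simp
  also have "\<dots> = Re (ip H (\<pi> (conv G (fstar G f) f) \<xi>) \<xi>) + Re (ip H (\<pi> (conv G (fstar G h) h) \<xi>) \<xi>)"
    using rep_norm_sq[OF star_algebra_Cc, of f \<xi>] rep_norm_sq[OF star_algebra_Cc, of h \<xi>] Cc \<xi> by simp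
  also have "\<dots> = Re (ip H (\<pi> (conv G (fstar G f) f + conv G (fstar G h) h) \<xi>) \<xi>)"
    using rep_add[of "conv G (fstar G f) f" "conv G (fstar G h) h" \<xi>] cc cl \<xi> by (simp add: ip_add)
  also have "\<dots> = c\<^sup>2 * Re (ip H (\<pi> (indicator (s ` W)) \<xi>) \<xi>)"
    unfolding h(2) using rep_smult[of "indicator (s ` W)" \<xi> "complex_of_real (c\<^sup>2)"] Cc(3) cl \<xi>
    by (simp add: ip_smult del: of_real_power)
  also have "Re (ip H (\<pi> (indicator (s ` W)) \<xi>) \<xi>) = steinberg.\<mu> \<xi> (s ` W)"
  proof -
    have "(\<lambda>g. complex_of_real (indicator (s ` W) g)) = indicator (s ` W)" by (auto simp: indicator_def)
    then show ?thesis by (simp add: steinberg.\<phi>_def)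
  qed
  also have "c\<^sup>2 * \<dots> \<le> c\<^sup>2 * (ip_norm H \<xi>)\<^sup>2"
    by (intro mult_left_mono steinberg.\<mu>_bounds(2)[OF img(2,4) \<xi>]) simp
  finally have "(ip_norm H (\<pi> f \<xi>))\<^sup>2 \<le> (c * ip_norm H \<xi>)\<^sup>2" by (simp add: power_mult_distrib)
  then show ?thesis using c0 \<xi> by (meson ip_norm_nonneg mult_nonneg_nonneg power2_le_imp_le)
qed

lemma bis_sum_norm_le:
  assumes "bis_sum f c" and \<xi>: "\<xi> \<in> carrier H"
  shows "ip_norm H (\<pi> f \<xi>) \<le> c * ip_norm H \<xi>"
  using assms(1)
proof (induction rule: bis_sum.induct)
  case (atom W f c)
  then show ?case by (rule CB_norm_le[OF _ _ _ \<xi>])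
next
  case (plus f c g d)
  then have Cc: "f \<in> Cc G" "g \<in> Cc G" using bis_sum_Cc by blast+
  then have cl: "\<pi> f \<xi> \<in> carrier H" "\<pi> g \<xi> \<in> carrier H"
    using rep_linear_operator[of f] rep_linear_operator[of g] \<xi> by (auto simp: linear_operator_def)
  have "\<pi> (f + g) \<xi> = \<pi> f \<xi> \<oplus> \<pi> g \<xi>" using rep_add[of f g \<xi>] Cc \<xi> by simp
  then show ?case using plus.IH ip_norm_triangle[OF cl] by (simp only: distrib_right)
qed

end

section \<open>Extension of representations by continuity\<close>

locale bounded_steinberg_representation = steinberg_representation G H \<pi> + hilbert_space H
  for G :: "'g groupoid_data" and H :: "'h inner_space" (structure) and \<pi>
begin

lemma norm_le_bis_sum:
  assumes "a \<in> steinberg G" "bis_sum a c" "\<xi> \<in> carrier H"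
  shows "ip_norm H (\<pi> a \<xi>) \<le> c * ip_norm H \<xi>"
  by (rule norm_le_I_norm[OF assms(1) bis_sum_nonneg I_norm_le_bis_sum]) (use assms in auto)

text \<open>The I-norm estimate makes every operator of the representation bounded.\<close>

sublocale bounded_representation "steinberg_alg G" H \<pi>
proof
  fix a assume "a \<in> carrier (steinberg_alg G)"
  then have a: "a \<in> steinberg G" by simp
  then obtain c where c: "bis_sum a c" using steinberg_Cc Cc_iff by blast
  have "op_norm H (\<pi> a) \<le> ennreal c"
    using order_trans[OF op_norm_le_I_norm[OF a] I_norm_le_bis_sum[OF c]] .
  then show "op_norm H (\<pi> a) < \<infinity>" by (simp add: le_less_trans)
qed

text \<open>Convergence in the norm that \<open>bis_sum\<close> defines, witnessed by explicit
  bounds \<open>e n\<close> in place of the infimum so that the rules for \<open>bis_sum\<close>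
  apply directly.\<close>

definition approx :: "('g \<Rightarrow> complex) \<Rightarrow> (nat \<Rightarrow> 'g \<Rightarrow> complex) \<Rightarrow> bool" where
  "approx f a \<longleftrightarrow> (\<forall>n. a n \<in> steinberg G) \<and> (\<exists>e. e \<longlonglongrightarrow> 0 \<and> (\<forall>n. bis_sum (f - a n) (e n)))"

definition lim_to :: "(nat \<Rightarrow> 'h) \<Rightarrow> 'h \<Rightarrow> bool" where
  "lim_to x \<eta> \<longleftrightarrow> (\<forall>n. x n \<in> carrier H) \<and> \<eta> \<in> carrier H \<and> (\<lambda>n. ip_norm H (x n \<ominus> \<eta>)) \<longlonglongrightarrow> 0"

lemma approxD: "approx f a \<Longrightarrow> a n \<in> steinberg G"
  by (simp add: approx_def)

lemma approx_exists:
  assumes f: "f \<in> Cc G"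
  shows "\<exists>a. approx f a"
proof -
  have "\<forall>n. \<exists>a\<in>steinberg G. bis_sum (f - a) (inverse (real (Suc n)))"
    using steinberg_dense[OF f] by simp
  then obtain a where "\<And>n. a n \<in> steinberg G \<and> bis_sum (f - a n) (inverse (real (Suc n)))" by metis
  then show ?thesis unfolding approx_def using LIMSEQ_inverse_real_of_nat by blast
qed

lemma approx_const: "a \<in> steinberg G \<Longrightarrow> approx a (\<lambda>_. a)"
  unfolding approx_def by (intro conjI exI[of _ "\<lambda>_. 0"]) (auto simp: bis_sum_zero)

lemma approx_bis_sum: "\<lbrakk>bis_sum f c; bis_sum (f - a) e\<rbrakk> \<Longrightarrow> bis_sum a (c + e)"
  using bis_sum_diff[of f c "f - a" e] by simp

lemma approx_add:
  assumes "approx f a" "approx g b"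
  shows "approx (f + g) (\<lambda>n. a n + b n)"
proof -
  obtain e d where e: "e \<longlonglongrightarrow> 0" "\<And>n. bis_sum (f - a n) (e n)" and d: "d \<longlonglongrightarrow> 0" "\<And>n. bis_sum (g - b n) (d n)"
    using assms unfolding approx_def by blast
  have eq: "f + g - (a n + b n) = (f - a n) + (g - b n)" for n by (simp add: fun_eq_iff)
  have "bis_sum (f + g - (a n + b n)) (e n + d n)" for n unfolding eq by (rule plus[OF e(2) d(2)])
  moreover have "(\<lambda>n. e n + d n) \<longlonglongrightarrow> 0" using tendsto_add[OF e(1) d(1)] by simp
  ultimately show ?thesis using approxD assms steinberg_add unfolding approx_def by blast
qed

lemma approx_scale:
  assumes "approx f a"
  shows "approx (fscale z f) (\<lambda>n. fscale z (a n))"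
proof -
  obtain e where e: "e \<longlonglongrightarrow> 0" "\<And>n. bis_sum (f - a n) (e n)"
    using assms unfolding approx_def by blast
  have eq: "fscale z f - fscale z (a n) = fscale z (f - a n)" for n
    by (simp add: fun_eq_iff fscale_def algebra_simps)
  have "bis_sum (fscale z f - fscale z (a n)) (cmod z * e n)" for n
    unfolding eq by (rule bis_sum_scale[OF e(2)])
  moreover have "(\<lambda>n. cmod z * e n) \<longlonglongrightarrow> 0" using tendsto_mult_left[OF e(1), of "cmod z"] by simp
  ultimately show ?thesis using approxD assms steinberg_scale unfolding approx_def by blast
qed

lemma approx_star:
  assumes "approx f a"
  shows "approx (fstar G f) (\<lambda>n. fstar G (a n))"
proof -
  obtain e where e: "e \<longlonglongrightarrow> 0" "\<And>n. bis_sum (f - a n) (e n)"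
    using assms unfolding approx_def by blast
  have eq: "fstar G f - fstar G (a n) = fstar G (f - a n)" for n
    by (simp add: fun_eq_iff fstar_def)
  have "bis_sum (fstar G f - fstar G (a n)) (e n)" for n
    unfolding eq by (rule bis_sum_fstar[OF e(2)])
  then show ?thesis using e(1) approxD assms steinberg_fstar unfolding approx_def by blast
qed

text \<open>f g - a b = f (g - b) + (f - a) b, where b is bounded by \<open>d + e' n\<close> because
  it is close to g.\<close>

lemma approx_conv:
  assumes f: "f \<in> Cc G" "approx f a" and g: "g \<in> Cc G" "approx g b"
  shows "approx (conv G f g) (\<lambda>n. conv G (a n) (b n))"
proof -
  obtain c d where c: "bis_sum f c" and d: "bis_sum g d" using f g by (auto simp: Cc_iff)
  obtain e e' where e: "e \<longlonglongrightarrow> 0" "\<And>n. bis_sum (f - a n) (e n)" and e': "e' \<longlonglongrightarrow> 0" "\<And>n. bis_sum (g - b n) (e' n)"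
    using f g unfolding approx_def by blast
  have "bis_sum (conv G f g - conv G (a n) (b n)) (c * e' n + e n * (d + e' n))" for n
  proof -
    have ff: "fibre_finite f" "fibre_finite (f - a n)" "fibre_finite (a n)"
      using bis_sum_fibre_finite c e(2) approxD[OF f(2)] fibre_finite_Cc steinberg_Cc by blast+
    have "conv G f g = conv G f (g - b n) + conv G f (b n)"
      using conv_add_right[OF ff(1), of "g - b n" "b n"] by simp
    moreover have "conv G f (b n) = conv G (f - a n) (b n) + conv G (a n) (b n)"
      using conv_add_left[OF ff(2,3), of "b n"] by simp
    ultimately have eq: "conv G f g - conv G (a n) (b n) = conv G f (g - b n) + conv G (f - a n) (b n)"
      by (simp add: fun_eq_iff)
    show ?thesis unfolding eq
      by (intro plus bis_sum_conv c e(2) e'(2) approx_bis_sum[OF d])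
  qed
  moreover have "(\<lambda>n. c * e' n + e n * (d + e' n)) \<longlonglongrightarrow> c * 0 + 0 * (d + 0)"
    by (intro tendsto_intros e e')
  ultimately show ?thesis using approxD f g steinberg_conv unfolding approx_def by auto
qed

section \<open>Limits of vectors\<close>

lemma lim_toD: "lim_to x \<eta> \<Longrightarrow> x n \<in> carrier H" "lim_to x \<eta> \<Longrightarrow> \<eta> \<in> carrier H"
    "lim_to x \<eta> \<Longrightarrow> (\<lambda>n. ip_norm H (x n \<ominus> \<eta>)) \<longlonglongrightarrow> 0"
  by (auto simp: lim_to_def)

lemma lim_toI:
  assumes "\<And>n. x n \<in> carrier H" "\<eta> \<in> carrier H" "\<And>n. ip_norm H (x n \<ominus> \<eta>) \<le> f n" "f \<longlonglongrightarrow> 0"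
  shows "lim_to x \<eta>"
  unfolding lim_to_def
proof (intro conjI allI)
  show "(\<lambda>n. ip_norm H (x n \<ominus> \<eta>)) \<longlonglongrightarrow> 0"
    by (rule tendsto_sandwich[OF _ _ tendsto_const assms(4)]) (use assms in auto)
qed (use assms in auto)

lemma diff_triangle:
  "\<lbrakk>x \<in> carrier H; y \<in> carrier H; z \<in> carrier H\<rbrakk> \<Longrightarrow>
    ip_norm H (x \<ominus> z) \<le> ip_norm H (x \<ominus> y) + ip_norm H (y \<ominus> z)"
  using Metric_space.triangle[OF Metric_space_ip_dist, of x y z] by (simp add: ip_dist_eq)

lemma diff_commute: "\<lbrakk>x \<in> carrier H; y \<in> carrier H\<rbrakk> \<Longrightarrow> ip_norm H (x \<ominus> y) = ip_norm H (y \<ominus> x)"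
  using Metric_space.commute[OF Metric_space_ip_dist, of x y] by (simp add: ip_dist_eq)

lemma lim_to_unique:
  assumes "lim_to x \<eta>" "lim_to y \<theta>" "\<And>n. ip_norm H (x n \<ominus> y n) \<le> f n" "f \<longlonglongrightarrow> 0"
  shows "\<eta> = \<theta>"
proof -
  note c = lim_toD[OF assms(1)] lim_toD[OF assms(2)]
  have "ip_norm H (\<eta> \<ominus> \<theta>) \<le> ip_norm H (x n \<ominus> \<eta>) + f n + ip_norm H (y n \<ominus> \<theta>)" for n
    using diff_triangle[of \<eta> "x n" \<theta>] diff_triangle[of "x n" "y n" \<theta>] diff_commute[of \<eta> "x n"] assms(3)[of n] c
    by simp
  moreover have "(\<lambda>n. ip_norm H (x n \<ominus> \<eta>) + f n + ip_norm H (y n \<ominus> \<theta>)) \<longlonglongrightarrow> 0 + 0 + 0"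
    using c assms(4) by (intro tendsto_add)
  ultimately have "ip_norm H (\<eta> \<ominus> \<theta>) \<le> 0" by (intro LIMSEQ_le_const[of _ 0]) auto
  then have "ip_norm H (\<eta> \<ominus> \<theta>) = 0" by (intro antisym) (use c in auto)
  then show ?thesis using c by (simp add: ip_norm_eq_0 diff_eq_0)
qed

lemma norm_diff_self: "x \<in> carrier H \<Longrightarrow> ip_norm H (x \<ominus> x) = 0"
  by (simp add: ip_norm_eq_0 diff_eq_0)

lemma diff_zero: "x \<in> carrier H \<Longrightarrow> x \<ominus> \<zero> = x"
  using M.minus_equality[of \<zero> \<zero>] by (simp add: a_minus_def)

lemma lim_to_add:
  assumes "lim_to x \<eta>" "lim_to y \<theta>"
  shows "lim_to (\<lambda>n. x n \<oplus> y n) (\<eta> \<oplus> \<theta>)"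
proof (rule lim_toI)
  note c = lim_toD[OF assms(1)] lim_toD[OF assms(2)]
  show "(\<lambda>n. ip_norm H (x n \<ominus> \<eta>) + ip_norm H (y n \<ominus> \<theta>)) \<longlonglongrightarrow> 0"
    using tendsto_add[OF c(3,6)] by simp
  show "ip_norm H ((x n \<oplus> y n) \<ominus> (\<eta> \<oplus> \<theta>)) \<le> ip_norm H (x n \<ominus> \<eta>) + ip_norm H (y n \<ominus> \<theta>)" for n
    using c by (simp add: diff_add_add ip_norm_triangle)
qed (use assms lim_toD in auto)

lemma lim_to_smult:
  assumes "lim_to x \<eta>"
  shows "lim_to (\<lambda>n. z \<odot> x n) (z \<odot> \<eta>)"
proof (rule lim_toI)
  note c = lim_toD[OF assms]
  show "(\<lambda>n. cmod z * ip_norm H (x n \<ominus> \<eta>)) \<longlonglongrightarrow> 0"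
    using tendsto_mult_left[OF c(3), of "cmod z"] by simp
  show "ip_norm H (z \<odot> x n \<ominus> z \<odot> \<eta>) \<le> cmod z * ip_norm H (x n \<ominus> \<eta>)" for n
  proof -
    have "linear_operator H ((\<odot>) z)"
      by (auto simp: linear_operator_def smult_add' smult_smult'[symmetric] mult.commute)
    then show ?thesis using c linear_diff[of "(\<odot>) z" "x n" \<eta>] by (simp add: ip_norm_smult flip: linear_diff)
  qed
qed (use assms lim_toD in auto)

lemma lim_to_ip:
  assumes "lim_to x \<eta>" and \<zeta>: "\<zeta> \<in> carrier H"
  shows "(\<lambda>n. ip H (x n) \<zeta>) \<longlonglongrightarrow> ip H \<eta> \<zeta>" "(\<lambda>n. ip H \<zeta> (x n)) \<longlonglongrightarrow> ip H \<zeta> \<eta>"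
proof -
  note c = lim_toD[OF assms(1)]
  have "(\<lambda>n. ip H (x n) \<zeta> - ip H \<eta> \<zeta>) \<longlonglongrightarrow> 0"
  proof (rule Lim_null_comparison)
    show "(\<lambda>n. ip_norm H (x n \<ominus> \<eta>) * ip_norm H \<zeta>) \<longlonglongrightarrow> 0"
      using tendsto_mult_right[OF c(3), of "ip_norm H \<zeta>"] by simp
    show "\<forall>\<^sub>F n in sequentially. norm (ip H (x n) \<zeta> - ip H \<eta> \<zeta>) \<le> ip_norm H (x n \<ominus> \<eta>) * ip_norm H \<zeta>"
      using cmod_ip_le[of "x _ \<ominus> \<eta>" \<zeta>] c \<zeta> by (auto simp: ip_diff)
  qed
  then show l: "(\<lambda>n. ip H (x n) \<zeta>) \<longlonglongrightarrow> ip H \<eta> \<zeta>" by (rule LIM_zero_cancel)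
  have "(\<lambda>n. cnj (ip H (x n) \<zeta>)) \<longlonglongrightarrow> cnj (ip H \<eta> \<zeta>)" using l by (rule tendsto_cnj)
  then show "(\<lambda>n. ip H \<zeta> (x n)) \<longlonglongrightarrow> ip H \<zeta> \<eta>" using c \<zeta> ip_cnj[of _ \<zeta>] by simp
qed

text \<open>\<open>f\<close> may lie outside the Steinberg algebra, but \<open>a - b\<close> belongs
  to it and equals \<open>(f - b) - (f - a)\<close>, which has a small bisection sum.\<close>

lemma pi_diff_le:
  assumes a: "a \<in> steinberg G" "bis_sum (f - a) e" and b: "b \<in> steinberg G" "bis_sum (f - b) d"
    and \<xi>: "\<xi> \<in> carrier H"
  shows "ip_norm H (\<pi> a \<xi> \<ominus> \<pi> b \<xi>) \<le> (d + e) * ip_norm H \<xi>"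
proof -
  have m: "fscale (-1) b \<in> steinberg G" using b(1) by (rule steinberg_scale)
  have eq: "a + fscale (-1) b = (f - b) - (f - a)" by (simp add: fun_eq_iff fscale_def)
  have bs: "bis_sum (a + fscale (-1) b) (d + e)" unfolding eq by (rule bis_sum_diff[OF b(2) a(2)])
  have "\<pi> (a + fscale (-1) b) \<xi> = \<pi> a \<xi> \<ominus> \<pi> b \<xi>"
    unfolding pi_simps(1)[OF a(1) m \<xi>] pi_simps(2)[OF b(1) \<xi>]
    using a(1) b(1) \<xi> by (simp add: smult_minus_one a_minus_def)
  then show ?thesis
    using norm_le_bis_sum[OF steinberg_add[OF a(1) m] bs \<xi>] by simp
qed

text \<open>Completeness of \<open>H\<close> enters here.\<close>

lemma approx_lim_exists:
  assumes "approx f a" and \<xi>: "\<xi> \<in> carrier H"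
  shows "\<exists>\<eta>. lim_to (\<lambda>n. \<pi> (a n) \<xi>) \<eta>"
proof -
  interpret D: Metric_space "carrier H" "ip_dist H" by (rule Metric_space_ip_dist)
  obtain e where e: "e \<longlonglongrightarrow> 0" "\<And>n. bis_sum (f - a n) (e n)" and a: "\<And>n. a n \<in> steinberg G"
    using assms(1) unfolding approx_def by blast
  have "D.MCauchy (\<lambda>n. \<pi> (a n) \<xi>)"
    unfolding D.MCauchy_def
  proof (intro conjI allI impI)
    show "range (\<lambda>n. \<pi> (a n) \<xi>) \<subseteq> carrier H" using a \<xi> by auto
    fix \<epsilon> :: real assume \<epsilon>: "\<epsilon> > 0"
    let ?x = "ip_norm H \<xi>"
    \<comment> \<open>The summand 1 covers a zero vector \<xi>, the factor 2 the sum
      \<open>e n + e m\<close>.\<close>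
    have pos: "\<epsilon> / (2 * (?x + 1)) > 0" using \<epsilon> \<xi> by (simp add: add_nonneg_pos)
    then obtain N where N: "\<And>n. n \<ge> N \<Longrightarrow> e n < \<epsilon> / (2 * (?x + 1))"
      using order_tendstoD(2)[OF e(1) pos] by (auto simp: eventually_sequentially)
    show "\<exists>N. \<forall>m n. N \<le> m \<longrightarrow> N \<le> n \<longrightarrow> ip_dist H (\<pi> (a m) \<xi>) (\<pi> (a n) \<xi>) < \<epsilon>"
    proof (intro exI allI impI)
      fix m n assume "N \<le> m" "N \<le> n"
      then have "e n + e m < 2 * (\<epsilon> / (2 * (?x + 1)))" using N[of m] N[of n] by linarith
      also have "\<dots> = \<epsilon> / (?x + 1)"
        by (subst times_divide_eq_right, rule mult_divide_mult_cancel_left) simp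
      finally have "(e n + e m) * (?x + 1) < \<epsilon>"
        using \<xi> by (simp only: pos_less_divide_eq add_nonneg_pos ip_norm_nonneg zero_less_one)
      moreover have "ip_dist H (\<pi> (a m) \<xi>) (\<pi> (a n) \<xi>) \<le> (e n + e m) * ?x"
        using pi_diff_le[OF a e(2) a e(2) \<xi>, of m n] a \<xi> by (simp add: ip_dist_eq)
      moreover have "(e n + e m) * ?x \<le> (e n + e m) * (?x + 1)"
        using bis_sum_nonneg[OF e(2)] by (intro mult_left_mono add_nonneg_nonneg) auto
      ultimately show "ip_dist H (\<pi> (a m) \<xi>) (\<pi> (a n) \<xi>) < \<epsilon>" by linarith
    qed
  qed
  then obtain \<eta> where "limitin D.mtopology (\<lambda>n. \<pi> (a n) \<xi>) \<eta> sequentially"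
    using complete unfolding D.mcomplete_def by blast
  then have "\<eta> \<in> carrier H" "(\<lambda>n. ip_dist H (\<pi> (a n) \<xi>) \<eta>) \<longlonglongrightarrow> 0"
    by (auto simp: D.limitin_metric_dist_null)
  then have "lim_to (\<lambda>n. \<pi> (a n) \<xi>) \<eta>" using a \<xi> by (simp add: lim_to_def ip_dist_eq)
  then show ?thesis ..
qed

lemma approx_lim_unique:
  assumes "approx f a" "approx f b" "lim_to (\<lambda>n. \<pi> (a n) \<xi>) \<eta>" "lim_to (\<lambda>n. \<pi> (b n) \<xi>) \<theta>" "\<xi> \<in> carrier H"
  shows "\<eta> = \<theta>"
proof -
  obtain e d where e: "e \<longlonglongrightarrow> 0" "\<And>n. bis_sum (f - a n) (e n)" and d: "d \<longlonglongrightarrow> 0" "\<And>n. bis_sum (f - b n) (d n)"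
    using assms unfolding approx_def by blast
  show ?thesis
  proof (rule lim_to_unique[OF assms(3,4)])
    show "ip_norm H (\<pi> (a n) \<xi> \<ominus> \<pi> (b n) \<xi>) \<le> (d n + e n) * ip_norm H \<xi>" for n
      by (rule pi_diff_le[OF approxD[OF assms(1)] e(2) approxD[OF assms(2)] d(2) assms(5)])
    show "(\<lambda>n. (d n + e n) * ip_norm H \<xi>) \<longlonglongrightarrow> 0"
      using tendsto_mult_right[OF tendsto_add[OF d(1) e(1)], of "ip_norm H \<xi>"] by simp
  qed
qed

definition extension :: "('g \<Rightarrow> complex) \<Rightarrow> 'h \<Rightarrow> 'h" where
  "extension f \<xi> = (SOME \<eta>. \<exists>a. approx f a \<and> lim_to (\<lambda>n. \<pi> (a n) \<xi>) \<eta>)"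

text \<open>The choice in \<open>extension\<close> is harmless, since \<open>pi_diff_le\<close>
  forces any two approximations of \<open>f\<close> to give the same limit.\<close>

lemma extension_eqI:
  assumes "approx f a" "lim_to (\<lambda>n. \<pi> (a n) \<xi>) \<eta>" "\<xi> \<in> carrier H"
  shows "extension f \<xi> = \<eta>"
proof -
  have "\<exists>\<eta> a. approx f a \<and> lim_to (\<lambda>n. \<pi> (a n) \<xi>) \<eta>" using assms by blast
  from someI_ex[OF this] obtain b where "approx f b" "lim_to (\<lambda>n. \<pi> (b n) \<xi>) (extension f \<xi>)"
    unfolding extension_def by blast
  then show ?thesis using approx_lim_unique assms by blast
qed

lemma extension_lim:
  assumes "approx f a" "\<xi> \<in> carrier H"
  shows "lim_to (\<lambda>n. \<pi> (a n) \<xi>) (extension f \<xi>)"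
  using approx_lim_exists[OF assms] extension_eqI[OF assms(1) _ assms(2)] by blast

lemma extension_steinberg: "\<lbrakk>a \<in> steinberg G; \<xi> \<in> carrier H\<rbrakk> \<Longrightarrow> extension a \<xi> = \<pi> a \<xi>"
  by (rule extension_eqI[OF approx_const], assumption)
    (auto intro!: lim_toI[where f = "\<lambda>_. 0"] simp: norm_diff_self)

lemma extension_norm_le:
  assumes f: "bis_sum f c" and \<xi>: "\<xi> \<in> carrier H"
  shows "ip_norm H (extension f \<xi>) \<le> c * ip_norm H \<xi>"
proof -
  obtain a where a: "approx f a" using approx_exists[OF bis_sum_Cc[OF f]] by blast
  then obtain e where e: "e \<longlonglongrightarrow> 0" "\<And>n. bis_sum (f - a n) (e n)" unfolding approx_def by blast
  note l = lim_toD[OF extension_lim[OF a \<xi>]]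
  have "ip_norm H (extension f \<xi>) \<le> ip_norm H (\<pi> (a n) \<xi> \<ominus> extension f \<xi>) + (c + e n) * ip_norm H \<xi>" for n
  proof -
    have "ip_norm H (extension f \<xi>) \<le> ip_norm H (extension f \<xi> \<ominus> \<pi> (a n) \<xi>) + ip_norm H (\<pi> (a n) \<xi>)"
      using diff_triangle[of "extension f \<xi>" "\<pi> (a n) \<xi>" \<zero>] l by (simp add: diff_zero)
    moreover have "ip_norm H (\<pi> (a n) \<xi>) \<le> (c + e n) * ip_norm H \<xi>"
      by (rule norm_le_bis_sum[OF approxD[OF a] approx_bis_sum[OF f e(2)] \<xi>])
    ultimately show ?thesis using diff_commute[of "extension f \<xi>" "\<pi> (a n) \<xi>"] l by simp
  qed
  moreover have "(\<lambda>n. ip_norm H (\<pi> (a n) \<xi> \<ominus> extension f \<xi>) + (c + e n) * ip_norm H \<xi>) \<longlonglongrightarrow>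
      0 + (c + 0) * ip_norm H \<xi>"
    by (intro tendsto_intros l e)
  ultimately show ?thesis by (intro LIMSEQ_le_const[of _ "c * ip_norm H \<xi>"]) auto
qed

lemma linear_operator_extension:
  assumes "f \<in> Cc G"
  shows "linear_operator H (extension f)"
proof -
  obtain a where a: "approx f a" using approx_exists[OF assms] by blast
  note lin = pi_linear[OF approxD[OF a]]
  show ?thesis
    unfolding linear_operator_def
  proof (intro conjI ballI allI)
    show "extension f \<in> carrier H \<rightarrow> carrier H" using lim_toD(2)[OF extension_lim[OF a]] by blast
    fix \<xi> assume \<xi>: "\<xi> \<in> carrier H"
    note l = extension_lim[OF a \<xi>]
    show "extension f (z \<odot> \<xi>) = z \<odot> extension f \<xi>" for z
      using lim_to_smult[OF l, of z] lin \<xi> by (intro extension_eqI[OF a]) (auto simp: linear_operator_def)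
    fix \<zeta> assume \<zeta>: "\<zeta> \<in> carrier H"
    show "extension f (\<xi> \<oplus> \<zeta>) = extension f \<xi> \<oplus> extension f \<zeta>"
      using lim_to_add[OF l extension_lim[OF a \<zeta>]] lin \<xi> \<zeta>
      by (intro extension_eqI[OF a]) (auto simp: linear_operator_def)
  qed
qed

text \<open>Each law holds for the approximants and passes to the limit; multiplicativity is the one
  case in which operators and vectors vary together.\<close>

lemma bounded_representation_extension: "bounded_representation (Cc_alg G) H extension"
proof (unfold_locales, goal_cases)
  case (1 f)
  then show ?case using linear_operator_extension by simp
next
  case (2 f g \<xi>)
  then have "f \<in> Cc G" "g \<in> Cc G" by simp_all
  then obtain a b where ab: "approx f a" "approx g b" using approx_exists by blast
  have "lim_to (\<lambda>n. \<pi> (a n + b n) \<xi>) (extension f \<xi> \<oplus> extension g \<xi>)"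
    using lim_to_add[OF extension_lim[OF ab(1) 2(3)] extension_lim[OF ab(2) 2(3)]]
    by (simp only: pi_simps(1)[OF approxD[OF ab(1)] approxD[OF ab(2)] 2(3)])
  then show ?case using extension_eqI[OF approx_add[OF ab] _ 2(3)] by simp
next
  case (3 f \<xi> c)
  then obtain a where a: "approx f a" using approx_exists by auto
  have "lim_to (\<lambda>n. \<pi> (fscale c (a n)) \<xi>) (c \<odot> extension f \<xi>)"
    using lim_to_smult[OF extension_lim[OF a 3(2)]] by (simp only: pi_simps(2)[OF approxD[OF a] 3(2)])
  then show ?case using extension_eqI[OF approx_scale[OF a] _ 3(2)] by simp
next
  case (4 f g \<xi>)
  then have Cc: "f \<in> Cc G" "g \<in> Cc G" and \<xi>: "\<xi> \<in> carrier H" by simp_all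
  then obtain a b where a: "approx f a" and b: "approx g b" using approx_exists by blast
  obtain c where c: "bis_sum f c" using Cc(1) by (auto simp: Cc_iff)
  obtain e where e: "e \<longlonglongrightarrow> 0" "\<And>n. bis_sum (f - a n) (e n)" using a unfolding approx_def by blast
  let ?g = "extension g \<xi>"
  note lb = extension_lim[OF b \<xi>]
  note cb = lim_toD[OF lb]
  note la = extension_lim[OF a cb(2)]
  note ca = lim_toD[OF la]
  \<comment> \<open>The bound \<open>c + e n\<close> on \<open>\<pi> (a n)\<close> controls the
    change of the vector from \<open>\<pi> (b n) \<xi>\<close> to \<open>?g\<close>; what remains is
    the convergence of \<open>\<pi> (a n)\<close> at the fixed vector \<open>?g\<close>.\<close>
  have "lim_to (\<lambda>n. \<pi> (conv G (a n) (b n)) \<xi>) (extension f ?g)"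
  proof (rule lim_toI)
    fix n
    have ab: "a n \<in> steinberg G" "b n \<in> steinberg G" using approxD a b by blast+
    then show "\<pi> (conv G (a n) (b n)) \<xi> \<in> carrier H" using \<xi> steinberg_conv by simp
    have "ip_norm H (\<pi> (a n) (\<pi> (b n) \<xi>) \<ominus> \<pi> (a n) ?g) \<le> (c + e n) * ip_norm H (\<pi> (b n) \<xi> \<ominus> ?g)"
      using norm_le_bis_sum[OF ab(1) approx_bis_sum[OF c e(2)], of "\<pi> (b n) \<xi> \<ominus> ?g"]
        linear_diff[OF pi_linear[OF ab(1)], of "\<pi> (b n) \<xi>" ?g] cb by simp
    then show "ip_norm H (\<pi> (conv G (a n) (b n)) \<xi> \<ominus> extension f ?g) \<le>
        (c + e n) * ip_norm H (\<pi> (b n) \<xi> \<ominus> ?g) + ip_norm H (\<pi> (a n) ?g \<ominus> extension f ?g)"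
      using diff_triangle[of "\<pi> (a n) (\<pi> (b n) \<xi>)" "\<pi> (a n) ?g" "extension f ?g"] ab cb ca \<xi>
      by (simp add: pi_simps(3))
  next
    have "(\<lambda>n. (c + e n) * ip_norm H (\<pi> (b n) \<xi> \<ominus> ?g) + ip_norm H (\<pi> (a n) ?g \<ominus> extension f ?g)) \<longlonglongrightarrow>
        (c + 0) * 0 + 0"
      by (intro tendsto_intros e ca cb)
    then show "(\<lambda>n. (c + e n) * ip_norm H (\<pi> (b n) \<xi> \<ominus> ?g) + ip_norm H (\<pi> (a n) ?g \<ominus> extension f ?g)) \<longlonglongrightarrow> 0"
      by simp
  qed (use ca in auto)
  then show ?case using extension_eqI[OF approx_conv[OF Cc(1) a Cc(2) b] _ \<xi>] by simp
next
  case (5 f \<xi> \<zeta>)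
  then obtain a where a: "approx f a" using approx_exists by auto
  have "(\<lambda>n. ip H (\<pi> (a n) \<xi>) \<zeta>) \<longlonglongrightarrow> ip H (extension f \<xi>) \<zeta>"
    by (rule lim_to_ip(1)[OF extension_lim[OF a 5(2)] 5(3)])
  moreover have "(\<lambda>n. ip H (\<pi> (a n) \<xi>) \<zeta>) \<longlonglongrightarrow> ip H \<xi> (extension (fstar G f) \<zeta>)"
    unfolding pi_simps(4)[OF approxD[OF a] 5(2,3)]
    by (rule lim_to_ip(2)[OF extension_lim[OF approx_star[OF a] 5(3)] 5(2)])
  ultimately have "ip H (extension f \<xi>) \<zeta> = ip H \<xi> (extension (fstar G f) \<zeta>)"
    by (rule LIMSEQ_unique)
  then show ?case by simp
next
  case (6 f)
  then obtain c where c: "bis_sum f c" using Cc_iff by auto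
  have "linear_operator H (extension f)" using linear_operator_extension 6 by simp
  then have "op_norm H (extension f) \<le> ennreal c"
    using op_norm_le_ennreal_iff[OF _ bis_sum_nonneg[OF c]] extension_norm_le[OF c] by blast
  then show ?case by (simp add: le_less_trans)
qed

end

section \<open>The universal completions\<close>

context ample_groupoid
begin

text \<open>Approximation in \<open>bis_sum\<close> is hence approximation in the C*-seminorm, which
  yields density of the Steinberg algebra.\<close>

lemma Cc_seminorm_le: "bis_sum f c \<Longrightarrow> cstar_seminorm (Cc_alg G) f \<le> ennreal c"
proof (rule cstar_seminorm_leI)
  assume f: "bis_sum f c"
  show "0 \<le> c" "f \<in> carrier (Cc_alg G)" using bis_sum_nonneg[OF f] bis_sum_Cc[OF f] by simp_all
  fix H :: "(nat \<Rightarrow> complex \<times> ('a \<Rightarrow> complex)) inner_space" and \<pi> \<xi>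
  assume rep: "bounded_representation (Cc_alg G) H \<pi>" and \<xi>: "\<xi> \<in> carrier H"
  interpret bounded_representation "Cc_alg G" H \<pi> by fact
  interpret Cc_representation G H \<pi> by unfold_locales
  show "ip_norm H (\<pi> f \<xi>) \<le> c * ip_norm H \<xi>" by (rule bis_sum_norm_le[OF f \<xi>])
qed

lemma steinberg_seminorm_le:
  assumes a: "a \<in> steinberg G" "bis_sum a c"
  shows "cstar_seminorm (steinberg_alg G) a \<le> ennreal c"
proof (rule cstar_seminorm_leI)
  show "0 \<le> c" "a \<in> carrier (steinberg_alg G)" using bis_sum_nonneg[OF a(2)] a(1) by simp_all
  fix H :: "(nat \<Rightarrow> complex \<times> ('a \<Rightarrow> complex)) inner_space" and \<pi> \<xi>
  assume rep: "bounded_representation (steinberg_alg G) H \<pi>" and \<xi>: "\<xi> \<in> carrier H"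
  interpret bounded_representation "steinberg_alg G" H \<pi> by fact
  interpret bounded_steinberg_representation G H \<pi> by unfold_locales
  show "ip_norm H (\<pi> a \<xi>) \<le> c * ip_norm H \<xi>" by (rule norm_le_bis_sum[OF a \<xi>])
qed

lemma well_defined_Cc: "cstar_completion_well_defined (Cc_alg G)"
  unfolding cstar_completion_well_defined_def
proof
  fix f assume "f \<in> carrier (Cc_alg G)"
  then obtain c where "bis_sum f c" using Cc_iff by auto
  from le_less_trans[OF Cc_seminorm_le[OF this] ennreal_less_top]
  show "cstar_seminorm (Cc_alg G) f < \<infinity>" by simp
qed

lemma well_defined_steinberg: "cstar_completion_well_defined (steinberg_alg G)"
  unfolding cstar_completion_well_defined_def
proof
  fix a assume "a \<in> carrier (steinberg_alg G)"
  then have a: "a \<in> steinberg G" by simp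
  then obtain c where "bis_sum a c" using steinberg_Cc Cc_iff by blast
  from le_less_trans[OF steinberg_seminorm_le[OF a this] ennreal_less_top]
  show "cstar_seminorm (steinberg_alg G) a < \<infinity>" by simp
qed

text \<open>One inequality extends representations to \<open>Cc G\<close>, the other restricts them,
  in both cases on the same Hilbert space. The elements of the two algebras have the same type, so
  both suprema run over Hilbert spaces of one type.\<close>

lemma cstar_norm_steinberg:
  assumes a: "a \<in> steinberg G"
  shows "cstar_norm (steinberg_alg G) a = cstar_norm (Cc_alg G) a"
proof (rule antisym)
  show "cstar_norm (steinberg_alg G) a \<le> cstar_norm (Cc_alg G) a"
  proof (rule cstar_norm_leI)
    fix H :: "(nat \<Rightarrow> complex \<times> ('a \<Rightarrow> complex)) inner_space" and \<pi> \<xi>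
    assume rep: "bounded_representation (steinberg_alg G) H \<pi>" and \<xi>: "\<xi> \<in> carrier H"
    interpret bounded_representation "steinberg_alg G" H \<pi> by fact
    interpret bounded_steinberg_representation G H \<pi> by unfold_locales
    show "ip_norm H (\<pi> a \<xi>) \<le> cstar_norm (Cc_alg G) a * ip_norm H \<xi>"
      using cstar_norm_bound[OF well_defined_Cc bounded_representation_extension, of a \<xi>]
        extension_steinberg[OF a \<xi>] steinberg_Cc[OF a] \<xi> by simp
  qed (use a in \<open>simp_all add: cstar_norm_def\<close>)
  show "cstar_norm (Cc_alg G) a \<le> cstar_norm (steinberg_alg G) a"
  proof (rule cstar_norm_leI)
    fix H :: "(nat \<Rightarrow> complex \<times> ('a \<Rightarrow> complex)) inner_space" and \<pi> \<xi>
    assume rep: "bounded_representation (Cc_alg G) H \<pi>" and \<xi>: "\<xi> \<in> carrier H"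
    interpret bounded_representation "Cc_alg G" H \<pi> by fact
    interpret Cc_representation G H \<pi> by unfold_locales
    have "bounded_representation (steinberg_alg G) H \<pi>"
      by unfold_locales (use rep_bounded steinberg_Cc in simp)
    then show "ip_norm H (\<pi> a \<xi>) \<le> cstar_norm (steinberg_alg G) a * ip_norm H \<xi>"
      using cstar_norm_bound[OF well_defined_steinberg, of H \<pi> a \<xi>] a \<xi> by simp
  qed (use steinberg_Cc[OF a] in \<open>simp_all add: cstar_norm_def\<close>)
qed

lemma cstar_isomorphism_steinberg:
  "\<exists>\<Phi>. cstar_isomorphism (cstar_completion (steinberg_alg G)) (groupoid_cstar G) \<Phi> \<and>
    (\<forall>a\<in>steinberg G. \<Phi> (cstar_embed (steinberg_alg G) a) = cstar_embed (Cc_alg G) a)"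
proof -
  let ?A = "steinberg_alg G" and ?B = "Cc_alg G"
  have A: "seminormed_star_algebra ?A (cstar_norm ?A)"
    by (rule seminormed_cstar_norm[OF star_algebra_steinberg well_defined_steinberg])
  have B: "seminormed_star_algebra ?B (cstar_norm ?B)"
    by (rule seminormed_cstar_norm[OF star_algebra_Cc well_defined_Cc])
  interpret B: seminormed_star_algebra ?B "cstar_norm ?B" by (rule B)
  have dense: "\<exists>a\<in>carrier ?A. cstar_norm ?B (f \<ominus>\<^bsub>?B\<^esub> a) < e"
    if f: "f \<in> carrier ?B" and e: "e > 0" for f e
  proof -
    \<comment> \<open>Halving \<open>e\<close> turns the weak bound on the seminorm into a strict
      one.\<close>
    obtain a where a: "a \<in> steinberg G" "bis_sum (f - a) (e / 2)"
      using steinberg_dense[of f "e / 2"] f e by auto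
    have "f \<ominus>\<^bsub>?B\<^esub> a = f + fscale (-1) a"
      using B.alg_smult_minus_one[of a] steinberg_Cc[OF a(1)] by (simp add: a_minus_def)
    also have "\<dots> = f - a" by (simp add: fun_eq_iff fscale_def)
    finally have diff: "f \<ominus>\<^bsub>?B\<^esub> a = f - a" .
    have "cstar_norm ?B (f \<ominus>\<^bsub>?B\<^esub> a) \<le> e / 2"
      unfolding diff cstar_norm_def by (rule enn2real_leI[OF _ Cc_seminorm_le[OF a(2)]]) (use e in simp)
    then show ?thesis using a(1) e by (intro bexI[of _ a]) auto
  qed
  have sub: "carrier ?A \<subseteq> carrier ?B" using steinberg_Cc by auto
  have eq: "cstar_norm ?A a = cstar_norm ?B a" if "a \<in> carrier ?A" for a
    using cstar_norm_steinberg that by simp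
  have ops: "add ?A = add ?B" "mult ?A = mult ?B" "smult ?A = smult ?B" "star ?A = star ?B"
    by simp_all
  note iso = completion_dense_subalgebra_iso[OF A B sub ops eq dense]
  have cn: "cstar_norm X = (\<lambda>a. enn2real (cstar_seminorm X a))" for X :: "('a \<Rightarrow> complex) star_alg"
    by (simp add: cstar_norm_def fun_eq_iff)
  show ?thesis
    unfolding groupoid_cstar_def cstar_completion_def cstar_embed_def cn[symmetric]
    using iso by (intro exI conjI ballI) auto
qed

end

theorem proposition3p4:
  fixes G :: "'g groupoid_data"
  assumes "ample_groupoid G"
  shows "(\<forall>(H :: 'h inner_space) \<pi>. representation (steinberg_alg G) H \<pi> \<longrightarrow>
            (\<forall>a\<in>steinberg G. op_norm H (\<pi> a) \<le> I_norm G a)) \<and>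
         cstar_completion_well_defined (steinberg_alg G) \<and>
         (\<exists>\<Phi>. cstar_isomorphism (cstar_completion (steinberg_alg G)) (groupoid_cstar G) \<Phi> \<and>
            (\<forall>a\<in>steinberg G. \<Phi> (cstar_embed (steinberg_alg G) a) = cstar_embed (Cc_alg G) a))"
proof -
  interpret ample_groupoid G by fact
  have "op_norm H (\<pi> a) \<le> I_norm G a"
    if "representation (steinberg_alg G) H \<pi>" "a \<in> steinberg G" for H :: "'h inner_space" and \<pi> a
  proof -
    interpret representation "steinberg_alg G" H \<pi> by (rule that(1))
    interpret steinberg_representation G H \<pi> by unfold_locales
    show ?thesis by (rule op_norm_le_I_norm[OF that(2)])
  qed
  then show ?thesis using well_defined_steinberg cstar_isomorphism_steinberg by blast
qed

end
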